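(* Let $\ell \in \{2,3,5\}$ and let $k > 2\ell$ be an odd integer (both fixed). Let $G$ be a $\mathcal{C}_{2\ell} \cup \{C_k\}$-free graph on $n$ vertices with average degree $d = \Theta(n^{1/\ell})$. Then $G$ has a bipartite subgraph $H$ with at least $d^{\ell+1} - o(n^{1+1/\ell})$ edges. If in addition $d \ge (1+o(1))(n/2)^{1/\ell}$, then $d \sim (n/2)^{1/\ell}$ and $e(H) \sim e(G) \sim (n/2)^{1+1/\ell}$. In particular, $$\mathrm{ex}(n, \mathcal{C}_{2\ell} \cup \{C_k\}) \sim \mathrm{z}(n, \mathcal{C}_{2\ell}).$$
   Context: Graphs are finite and simple. $C_j$ denotes the cycle of length $j$, and $\mathcal{C}_{2\ell} = \{C_4, C_6, \dots, C_{2\ell}\}$ is the set of even cycles of length at most $2\ell$. For a family $\mathcal{F}$ of graphs, a graph is $\mathcal{F}$-free if it contains no member of $\mathcal{F}$ as a (not necessarily induced) subgraph. $\mathrm{ex}(n,\mathcal{F})$ is the maximum number of edges in an $\mathcal{F}$-free graph on $n$ vertices; $\mathrm{z}(n,\mathcal{F})$ is the maximum number of edges in an $\mathcal{F}$-free bipartite graph on $n$ vertices. $e(G)$ is the number of edges of $G$. Asymptotic notation is as $n \to \infty$ with $\ell,k$ fixed, so statements about "a graph $G$ on $n$ vertices" refer to sequences of graphs with $n\to\infty$; $f(n)\sim g(n)$ means $f(n)/g(n)\to 1$ and $f(n) = o(g(n))$ means $f(n)/g(n) \to 0$. *)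

theory Defs
  imports Complex_Main "HOL-Library.Landau_Symbols"
begin

record 'a sgraph =
  verts :: "'a set"
  edges :: "'a set set"

definition simple_graph :: "'a sgraph \<Rightarrow> bool" where
  "simple_graph G \<longleftrightarrow>
     finite (verts G) \<and> (\<forall>e\<in>edges G. e \<subseteq> verts G \<and> card e = 2)"

definition num_verts :: "'a sgraph \<Rightarrow> nat" where
  "num_verts G = card (verts G)"

definition num_edges :: "'a sgraph \<Rightarrow> nat" where
  "num_edges G = card (edges G)"

definition vertex_degree :: "'a sgraph \<Rightarrow> 'a \<Rightarrow> nat" where
  "vertex_degree G v = card {e \<in> edges G. v \<in> e}"

definition average_degree :: "'a sgraph \<Rightarrow> real" where
  "average_degree G = (\<Sum>v\<in>verts G. real (vertex_degree G v)) / real (num_verts G)"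

definition is_bipartite :: "'a sgraph \<Rightarrow> bool" where
  "is_bipartite G \<longleftrightarrow>
     (\<exists>A B. A \<union> B = verts G \<and> A \<inter> B = {} \<and>
            (\<forall>e\<in>edges G. \<exists>a\<in>A. \<exists>b\<in>B. e = {a, b}))"

definition is_subgraph :: "'a sgraph \<Rightarrow> 'a sgraph \<Rightarrow> bool" where
  "is_subgraph H G \<longleftrightarrow>
     simple_graph H \<and> verts H \<subseteq> verts G \<and> edges H \<subseteq> edges G"

text \<open>\<open>G\<close> has a (not necessarily induced) subgraph isomorphic to \<open>F\<close>.\<close>

definition contains_copy :: "'a sgraph \<Rightarrow> 'b sgraph \<Rightarrow> bool" where
  "contains_copy G F \<longleftrightarrow>
     (\<exists>f. inj_on f (verts F) \<and> f ` verts F \<subseteq> verts G \<and>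
          (\<forall>e\<in>edges F. f ` e \<in> edges G))"

definition family_free :: "'b sgraph set \<Rightarrow> 'a sgraph \<Rightarrow> bool" where
  "family_free \<F> G \<longleftrightarrow> (\<forall>F\<in>\<F>. \<not> contains_copy G F)"

text \<open>The cycle of length \<open>j\<close>; only meaningful for \<open>j \<ge> 3\<close>.\<close>

definition cycle_graph :: "nat \<Rightarrow> nat sgraph" where
  "cycle_graph j = \<lparr>verts = {..<j}, edges = (\<lambda>i. {i, Suc i mod j}) ` {..<j}\<rparr>"

definition even_cycles :: "nat \<Rightarrow> nat sgraph set" where
  "even_cycles l = (\<lambda>i. cycle_graph (2 * i)) ` {2..l}"

text \<open>
  Every finite graph is isomorphic to one with vertices in \<^typ>\<open>nat\<close>, so the
  maxima below range over all graphs on \<open>n\<close> vertices up to isomorphism. The sets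
  of edge counts are finite; they are nonempty as soon as the edgeless graph is
  \<open>\<F>\<close>-free, in particular for every family of cycles of length at least 3.
\<close>

definition ex_number :: "nat \<Rightarrow> 'b sgraph set \<Rightarrow> nat" where
  "ex_number n \<F> =
     Max {num_edges G | G :: nat sgraph.
            simple_graph G \<and> num_verts G = n \<and> family_free \<F> G}"

definition z_number :: "nat \<Rightarrow> 'b sgraph set \<Rightarrow> nat" where
  "z_number n \<F> =
     Max {num_edges G | G :: nat sgraph.
            simple_graph G \<and> num_verts G = n \<and> is_bipartite G \<and> family_free \<F> G}"

end

theory Submission imports Defs "HOL-Complex_Analysis.Complex_Analysis" "HOL-Number_Theory.Prime_Powers"
  "HOL-Number_Theory.Cong" "HOL-Real_Asymp.Real_Asymp"
begin

text \<open>
  Let \<open>G\<close> be free of \<open>C\<^sub>4, \<dots>, C\<^bsub>2l\<^esub>\<close> and \<open>C\<^sub>k\<close>, and let \<open>N\<^sub>i\<close> be the vertices at distance \<open>i \<le> l\<close> from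
  a vertex \<open>v\<close>. A vertex of \<open>N\<^sub>i\<close> has one neighbour in \<open>N\<^bsub>i-1\<^esub>\<close>, and its neighbours in \<open>N\<^sub>i\<close> lie in different
  branches of the search tree. So a dense subgraph of \<open>G[N\<^sub>i]\<close> would contain a path of length \<open>k - 2i\<close>
  with ends in different branches, hence \<open>C\<^sub>k\<close>; thus \<open>G[N\<^sub>i]\<close> has \<open>O(|N\<^sub>i|)\<close> edges, and almost all walks
  from \<open>v\<close> are geodesics as long as degrees are \<open>O(n\<^bsup>1/l\<^esup>)\<close>, which holds after deleting a negligible
  set of edges. Some \<open>v\<close> starts at least \<open>d\<^bsup>l+1\<^esup>\<close> walks of length \<open>l + 1\<close>, so about that many edges
  leave \<open>N\<^sub>l\<close>; these form the bipartite subgraph. Since \<open>H\<close> has at most \<open>nd/2\<close> edges, \<open>d\<close> cannot exceed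
  \<open>(1 + o(1)) (n/2)\<^bsup>1/l\<^esup>\<close>.

  The matching lower bound on \<open>z(n, C\<^bsub>2l\<^esub>)\<close> for every \<open>n\<close> comes from the affine parts of generalized
  \<open>(l+1)\<close>-gons over prime fields, whose orders are dense enough because there are primes between \<open>x\<close> and
  \<open>(1 + \<epsilon>) x\<close>. The latter follows from the nonvanishing of the zeta function on \<open>Re s = 1\<close> by Newman's method:
  \<open>\<Sum> (\<psi>(n) - n) / n\<^sup>2\<close> converges, which is impossible if \<open>\<psi>\<close> is nearly constant on long intervals.
\<close>

section \<open>Breadth-first search in graphs without short even cycles\<close>

definition nbrs :: "'a sgraph \<Rightarrow> 'a \<Rightarrow> 'a set" where
  "nbrs G u = {w. {u, w} \<in> edges G}"

lemma nbrs_sym: "w \<in> nbrs G u \<longleftrightarrow> u \<in> nbrs G w"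
  by (simp add: nbrs_def insert_commute)

lemma simple_graph_edge:
  assumes "simple_graph G" "{u, w} \<in> edges G"
  shows "u \<in> verts G" "w \<in> verts G" "u \<noteq> w"
  using assms by (auto simp: simple_graph_def)

lemma nbrs_subset: "simple_graph G \<Longrightarrow> nbrs G u \<subseteq> verts G - {u}"
  by (auto simp: nbrs_def simple_graph_def)

lemma finite_nbrs [intro]: "simple_graph G \<Longrightarrow> finite (nbrs G u)"
  by (meson finite_Diff finite_subset nbrs_subset simple_graph_def)

lemma simple_graph_finite_edges: "simple_graph G \<Longrightarrow> finite (edges G)"
  unfolding simple_graph_def by (metis (no_types, lifting) PowI finite_Pow_iff finite_subset subsetI)

lemma vertex_degree_eq_card_nbrs:
  assumes "simple_graph G"
  shows "vertex_degree G u = card (nbrs G u)"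
proof -
  have "bij_betw (\<lambda>w. {u, w}) (nbrs G u) {e \<in> edges G. u \<in> e}"
    unfolding bij_betw_def
  proof
    show "inj_on (\<lambda>w. {u, w}) (nbrs G u)"
      by (auto simp: inj_on_def doubleton_eq_iff)
    show "(\<lambda>w. {u, w}) ` nbrs G u = {e \<in> edges G. u \<in> e}"
    proof (intro equalityI subsetI)
      fix e assume e: "e \<in> {e \<in> edges G. u \<in> e}"
      then have "card e = 2" using assms by (auto simp: simple_graph_def)
      then obtain w where "e = {u, w}" using e
        by (metis (no_types, lifting) card_2_iff doubleton_eq_iff insert_iff mem_Collect_eq singletonD)
      then show "e \<in> (\<lambda>w. {u, w}) ` nbrs G u" using e by (auto simp: nbrs_def)
    qed (auto simp: nbrs_def)
  qed
  then show ?thesis by (simp add: vertex_degree_def bij_betw_same_card)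
qed

lemma sum_degree:
  assumes "simple_graph G"
  shows "(\<Sum>v\<in>verts G. vertex_degree G v) = 2 * num_edges G"
proof -
  have fin: "finite (verts G)" "finite (edges G)"
    using assms simple_graph_finite_edges by (auto simp: simple_graph_def)
  have "(\<Sum>v\<in>verts G. vertex_degree G v) = (\<Sum>v\<in>verts G. \<Sum>e\<in>edges G. if v \<in> e then 1 else 0)"
    by (simp add: vertex_degree_def fin sum.If_cases Int_def)
  also have "\<dots> = (\<Sum>e\<in>edges G. \<Sum>v\<in>verts G. if v \<in> e then 1 else 0)"
    by (rule sum.swap)
  also have "\<dots> = (\<Sum>e\<in>edges G. 2)"
  proof (rule sum.cong)
    fix e assume "e \<in> edges G"
    then have "e \<subseteq> verts G" "card e = 2" using assms by (auto simp: simple_graph_def)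
    then show "(\<Sum>v\<in>verts G. if v \<in> e then 1 else 0) = (2::nat)"
      by (simp add: fin sum.If_cases Int_absorb1)
  qed simp
  finally show ?thesis by (simp add: num_edges_def)
qed

lemma average_degree_eq:
  assumes "simple_graph G"
  shows "average_degree G = 2 * real (num_edges G) / real (num_verts G)"
  by (simp add: average_degree_def flip: of_nat_sum) (simp add: sum_degree[OF assms])

lemma average_degree_nonneg: "average_degree G \<ge> 0"
  by (simp add: average_degree_def sum_nonneg)

lemma contains_copy_mono:
  "\<lbrakk>contains_copy H F; verts H \<subseteq> verts G; edges H \<subseteq> edges G\<rbrakk> \<Longrightarrow> contains_copy G F"
  unfolding contains_copy_def by blast

lemma family_free_mono:
  "\<lbrakk>family_free \<F> G; verts H \<subseteq> verts G; edges H \<subseteq> edges G\<rbrakk> \<Longrightarrow> family_free \<F> H"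
  unfolding family_free_def using contains_copy_mono by blast

lemma simple_graph_subset:
  "\<lbrakk>simple_graph G; finite V; E \<subseteq> edges G; \<And>e. e \<in> E \<Longrightarrow> e \<subseteq> V\<rbrakk>
    \<Longrightarrow> simple_graph \<lparr>verts = V, edges = E\<rparr>"
  by (auto simp: simple_graph_def)

lemma contains_cycleI:
  assumes "simple_graph G" "distinct xs" "length xs \<ge> 3"
    and "successively (\<lambda>u w. {u, w} \<in> edges G) xs" "{last xs, hd xs} \<in> edges G"
  shows "contains_copy G (cycle_graph (length xs))"
proof -
  let ?n = "length xs"
  have adj: "{xs ! i, xs ! (Suc i mod ?n)} \<in> edges G" if "i < ?n" for i
  proof (cases "Suc i < ?n")
    case True
    then show ?thesis using assms(4) by (simp add: successively_conv_nth)
  next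
    case False
    then have "i = ?n - 1" using that by simp
    moreover have "xs \<noteq> []" using assms(3) by auto
    ultimately show ?thesis using assms(3,5) by (simp add: last_conv_nth hd_conv_nth)
  qed
  have "xs ! i \<in> verts G" if "i < ?n" for i
    using simple_graph_edge(1)[OF assms(1) adj[OF that]] .
  then show ?thesis
    unfolding contains_copy_def cycle_graph_def
    using adj assms(2) by (intro exI[of _ "(!) xs"]) (auto simp: inj_on_nth)
qed

lemma family_freeD_even:
  assumes "family_free (even_cycles l \<union> \<F>) G" "2 \<le> j" "j \<le> l"
  shows "\<not> contains_copy G (cycle_graph (2 * j))"
  using assms by (auto simp: family_free_def even_cycles_def)

subsection \<open>Breadth-first layers\<close>

primrec bfs_ball :: "'a sgraph \<Rightarrow> 'a \<Rightarrow> nat \<Rightarrow> 'a set" where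
  "bfs_ball G v 0 = {v}"
| "bfs_ball G v (Suc i) = bfs_ball G v i \<union> (\<Union>u\<in>bfs_ball G v i. nbrs G u)"

primrec layer :: "'a sgraph \<Rightarrow> 'a \<Rightarrow> nat \<Rightarrow> 'a set" where
  "layer G v 0 = {v}"
| "layer G v (Suc i) = bfs_ball G v (Suc i) - bfs_ball G v i"

lemma bfs_ball_mono: "i \<le> j \<Longrightarrow> bfs_ball G v i \<subseteq> bfs_ball G v j"
  by (induction j rule: dec_induct) auto

lemma layer_subset_ball: "layer G v i \<subseteq> bfs_ball G v i"
  by (cases i) auto

lemma layer_disjoint: "i \<noteq> j \<Longrightarrow> layer G v i \<inter> layer G v j = {}"
proof -
  have "layer G v i \<inter> layer G v j = {}" if ij: "i < j" for i j
  proof -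
    obtain j' where j: "j = Suc j'" using less_imp_Suc_add[OF ij] by blast
    have "layer G v i \<subseteq> bfs_ball G v j'"
      using layer_subset_ball[of G v i] bfs_ball_mono[of i j' G v] ij j by auto
    then show ?thesis using j by auto
  qed
  then show "i \<noteq> j \<Longrightarrow> ?thesis" by (metis inf_commute nat_neq_iff)
qed

lemma layer_unique: "\<lbrakk>u \<in> layer G v i; u \<in> layer G v j\<rbrakk> \<Longrightarrow> i = j"
  using layer_disjoint[of i j G v] by blast

lemma in_ball_iff_layer: "u \<in> bfs_ball G v i \<longleftrightarrow> (\<exists>j\<le>i. u \<in> layer G v j)"
proof
  show "u \<in> bfs_ball G v i \<Longrightarrow> \<exists>j\<le>i. u \<in> layer G v j"
  proof (induction i)
    case (Suc i)
    show ?case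
    proof (cases "u \<in> bfs_ball G v i")
      case True
      then show ?thesis using Suc.IH le_SucI by blast
    next
      case False
      then have "u \<in> layer G v (Suc i)" using Suc.prems by simp
      then show ?thesis by blast
    qed
  qed auto
next
  assume "\<exists>j\<le>i. u \<in> layer G v j"
  then obtain j where "j \<le> i" "u \<in> layer G v j" by blast
  then show "u \<in> bfs_ball G v i"
    using layer_subset_ball[of G v j] bfs_ball_mono[of j i G v] by blast
qed

lemma layer_nbr:
  assumes "u \<in> layer G v i" "w \<in> nbrs G u"
  obtains "w \<in> layer G v (Suc i)" | "w \<in> layer G v i" | j where "i = Suc j" "w \<in> layer G v j"
proof -
  have "w \<in> bfs_ball G v (Suc i)" using assms layer_subset_ball by fastforce
  then obtain j where j: "j \<le> Suc i" "w \<in> layer G v j" by (auto simp only: in_ball_iff_layer)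
  have "u \<in> bfs_ball G v (Suc j)"
    using assms j layer_subset_ball[of G v j] nbrs_sym by fastforce
  then obtain m where "m \<le> Suc j" "u \<in> layer G v m" by (auto simp only: in_ball_iff_layer)
  then have "i \<le> Suc j" using assms layer_unique by metis
  then have "j = Suc i \<or> j = i \<or> i = Suc j" using j by linarith
  then show ?thesis using j(2) that by blast
qed

lemma ex_parent:
  assumes "u \<in> layer G v (Suc i)"
  shows "\<exists>w\<in>layer G v i. w \<in> nbrs G u"
proof -
  have "u \<in> bfs_ball G v (Suc i)" "u \<notin> bfs_ball G v i" using assms by auto
  then obtain w where w: "w \<in> bfs_ball G v i" "u \<in> nbrs G w" by auto
  moreover have "w \<notin> bfs_ball G v j" if "Suc j \<le> i" for j
  proof
    assume "w \<in> bfs_ball G v j"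
    then have "u \<in> bfs_ball G v (Suc j)" using w by auto
    then have "u \<in> bfs_ball G v i" using bfs_ball_mono[OF that, of G v] by blast
    then show False using assms by simp
  qed
  ultimately have "w \<in> layer G v i" by (cases i) auto
  then show ?thesis using w nbrs_sym by metis
qed

definition parent :: "'a sgraph \<Rightarrow> 'a \<Rightarrow> 'a \<Rightarrow> 'a" where
  "parent G v u = (SOME w. w \<in> nbrs G u \<and> (\<exists>i. w \<in> layer G v i \<and> u \<in> layer G v (Suc i)))"

lemma parent:
  assumes "u \<in> layer G v (Suc i)"
  shows "parent G v u \<in> nbrs G u" "parent G v u \<in> layer G v i"
proof -
  have "\<exists>w. w \<in> nbrs G u \<and> (\<exists>i. w \<in> layer G v i \<and> u \<in> layer G v (Suc i))"
    using ex_parent[OF assms] assms by blast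
  from someI_ex[OF this, folded parent_def]
  obtain j where j: "parent G v u \<in> nbrs G u" "parent G v u \<in> layer G v j" "u \<in> layer G v (Suc j)"
    by blast
  then show "parent G v u \<in> nbrs G u" "parent G v u \<in> layer G v i"
    using layer_unique[OF assms j(3)] by simp_all
qed

lemma parent_pow_layer:
  "\<lbrakk>u \<in> layer G v i; j \<le> i\<rbrakk> \<Longrightarrow> (parent G v ^^ j) u \<in> layer G v (i - j)"
proof (induction j)
  case (Suc j)
  then have "(parent G v ^^ j) u \<in> layer G v (Suc (i - Suc j))" by (simp add: Suc_diff_Suc)
  then show ?case using parent(2) by simp
qed simp

lemma parent_pow_adj:
  assumes "u \<in> layer G v i" "j < i"
  shows "{(parent G v ^^ j) u, (parent G v ^^ Suc j) u} \<in> edges G"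
proof -
  have "(parent G v ^^ j) u \<in> layer G v (Suc (i - Suc j))"
    using parent_pow_layer[OF assms(1), of j] assms(2) by (simp add: Suc_diff_Suc)
  then show ?thesis using parent(1) by (fastforce simp: nbrs_def)
qed

lemma tree_path:
  assumes x: "x \<in> layer G v i" and y: "y \<in> layer G v i" and "x \<noteq> y"
    and s: "(parent G v ^^ s) x = (parent G v ^^ s) y"
    and minimal: "\<And>j. j < s \<Longrightarrow> (parent G v ^^ j) x \<noteq> (parent G v ^^ j) y" and "s \<le> i"
  obtains P where "distinct P" "length P = 2 * s + 1" "P \<noteq> []" "hd P = x" "last P = y"
    "successively (\<lambda>u w. {u, w} \<in> edges G) P"
    "\<And>q. q \<in> set P \<Longrightarrow> q = x \<or> q = y \<or> (\<exists>j<i. q \<in> layer G v j)"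
proof -
  let ?p = "\<lambda>u j. (parent G v ^^ j) u"
  let ?P = "map (?p x) [0..<Suc s] @ rev (map (?p y) [0..<s])"
  have s0: "s > 0" using s \<open>x \<noteq> y\<close> by (cases s) auto
  have lev: "?p u j = ?p w j' \<Longrightarrow> j = j'" if "u \<in> layer G v i" "w \<in> layer G v i" "j \<le> s" "j' \<le> s" for u w j j'
    using parent_pow_layer[OF that(1), of j] parent_pow_layer[OF that(2), of j'] that \<open>s \<le> i\<close>
      layer_unique[of "?p u j" G v "i - j" "i - j'"] by auto
  have inj: "inj_on (?p u) {..s}" if "u \<in> layer G v i" for u
    using lev[OF that that] by (auto simp: inj_on_def)
  have sub: "{0..<Suc s} \<subseteq> {..s}" "{0..<s} \<subseteq> {..s}" by auto
  have "distinct ?P"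
  proof -
    have "?p x j \<noteq> ?p y j'" if "j < Suc s" "j' < s" for j j'
      using lev[OF x y, of j j'] minimal[of j'] that by auto
    then have "?p x ` {0..<Suc s} \<inter> ?p y ` {0..<s} = {}" by (auto simp del: funpow.simps)
    moreover have "inj_on (?p x) {0..<Suc s}" "inj_on (?p y) {0..<s}"
      using inj_on_subset[OF inj[OF x] sub(1)] inj_on_subset[OF inj[OF y] sub(2)] .
    ultimately show ?thesis
      by (simp only: distinct_append distinct_rev distinct_map distinct_upt set_map set_rev set_upt
          simp_thms)
  qed
  moreover have "length ?P = 2 * s + 1" "?P \<noteq> []" by simp_all
  moreover have "hd ?P = x" by (simp add: upt_rec del: upt_Suc)
  moreover have "last ?P = y" using s0 by (simp add: last_rev hd_map del: upt_Suc)
  moreover have "successively (\<lambda>u w. {u, w} \<in> edges G) ?P"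
    unfolding successively_append_iff successively_rev successively_map
  proof (intro conjI disjI2)
    show "successively (\<lambda>j j'. {?p x j, ?p x j'} \<in> edges G) [0..<Suc s]"
      using parent_pow_adj[OF x] \<open>s \<le> i\<close>
      by (auto simp: successively_conv_nth simp del: upt_Suc funpow.simps)
    show "successively (\<lambda>j j'. {?p y j', ?p y j} \<in> edges G) [0..<s]"
      using parent_pow_adj[OF y] \<open>s \<le> i\<close>
      by (auto simp: successively_conv_nth insert_commute simp del: upt_Suc funpow.simps)
    have "{?p y (s - 1), ?p y s} \<in> edges G"
      using parent_pow_adj[OF y, of "s - 1"] \<open>s \<le> i\<close> s0 by (simp del: funpow.simps)
    moreover have "last (map (?p x) [0..<Suc s]) = ?p x s" by simp
    moreover have "hd (rev (map (?p y) [0..<s])) = ?p y (s - 1)" using s0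
      by (simp add: hd_rev last_map)
    ultimately show "{last (map (?p x) [0..<Suc s]), hd (rev (map (?p y) [0..<s]))} \<in> edges G"
      using s by (simp add: insert_commute del: funpow.simps)
  qed
  moreover have "q = x \<or> q = y \<or> (\<exists>j<i. q \<in> layer G v j)" if qP: "q \<in> set ?P" for q
  proof -
    have "q \<in> ?p x ` {0..<Suc s} \<union> ?p y ` {0..<s}"
      using qP by (simp only: set_append set_map set_rev set_upt)
    then obtain u j where q: "q = ?p u j" "u = x \<or> u = y" "j \<le> s" by fastforce
    then have "q \<in> layer G v (i - j)" using parent_pow_layer x y \<open>s \<le> i\<close> by fastforce
    then show ?thesis using q \<open>s \<le> i\<close> s0 by (cases "j = 0") auto
  qed
  ultimately show ?thesis using that[of ?P] by blast
qed

lemma cycle_through_tree: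
  assumes G: "simple_graph G"
    and x: "x \<in> layer G v i" and y: "y \<in> layer G v i" and xy: "x \<noteq> y"
    and zs: "distinct zs" "x \<notin> set zs" "y \<notin> set zs"
      "\<And>z j. \<lbrakk>z \<in> set zs; z \<in> layer G v j\<rbrakk> \<Longrightarrow> i \<le> j"
      "successively (\<lambda>u w. {u, w} \<in> edges G) (y # zs @ [x])"
  obtains t where "1 \<le> t" "t \<le> i" "contains_copy G (cycle_graph (2 * t + 1 + length zs))"
    "\<And>s. (parent G v ^^ s) x = (parent G v ^^ s) y \<Longrightarrow> t \<le> s"
    "(parent G v ^^ t) x = (parent G v ^^ t) y"
proof -
  let ?Q = "\<lambda>s. (parent G v ^^ s) x = (parent G v ^^ s) y"
  define t where "t = (LEAST s. ?Q s)"
  have "?Q i" using parent_pow_layer[OF x, of i] parent_pow_layer[OF y, of i] by simp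
  then have t: "?Q t" "t \<le> i" "\<And>s. ?Q s \<Longrightarrow> t \<le> s"
    unfolding t_def by (auto intro: LeastI Least_le)
  have min: "\<And>j. j < t \<Longrightarrow> \<not> ?Q j" using t(3) by fastforce
  have "t \<noteq> 0" using t(1) xy by (metis funpow_0)
  then have t1: "1 \<le> t" by simp
  obtain P where P: "distinct P" "length P = 2 * t + 1" "P \<noteq> []" "hd P = x" "last P = y"
    "successively (\<lambda>u w. {u, w} \<in> edges G) P"
    "\<And>q. q \<in> set P \<Longrightarrow> q = x \<or> q = y \<or> (\<exists>j<i. q \<in> layer G v j)"
    using tree_path[OF x y xy t(1) min t(2)] by blast
  have "distinct (P @ zs)" using P(1,7) zs(1-4) by (fastforce simp: disjoint_iff)
  moreover have "successively (\<lambda>u w. {u, w} \<in> edges G) (P @ zs)"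
    using P(3,5,6) zs(5) by (cases zs) (auto simp: successively_append_iff successively_Cons hd_append split: if_splits)
  moreover have "{last (P @ zs), hd (P @ zs)} \<in> edges G"
    using P(3,4,5) zs(5) by (cases zs rule: rev_cases) (auto simp: successively_append_iff successively_Cons)
  moreover have "3 \<le> length (P @ zs)" using P(2) t1 by simp
  ultimately have "contains_copy G (cycle_graph (length (P @ zs)))"
    using contains_cycleI[OF G] by blast
  then show ?thesis using that[OF t1 t(2) _ t(3,1)] P(2) by simp
qed

lemma unique_parent:
  assumes G: "simple_graph G" "family_free (even_cycles l \<union> \<F>) G"
    and u: "u \<in> layer G v (Suc i)" "Suc i \<le> l"
    and x: "x \<in> layer G v i" "x \<in> nbrs G u" and y: "y \<in> layer G v i" "y \<in> nbrs G u"
  shows "x = y"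
proof (rule ccontr)
  assume xy: "x \<noteq> y"
  have "u \<notin> layer G v i" using layer_unique[OF u(1), of i] by auto
  then have ux: "u \<noteq> x" "u \<noteq> y" using x y by auto
  obtain t where t: "1 \<le> t" "t \<le> i" "contains_copy G (cycle_graph (2 * t + 1 + length [u]))"
  proof (rule cycle_through_tree[OF G(1) x(1) y(1) xy, of "[u]"])
    show "i \<le> j" if "z \<in> set [u]" "z \<in> layer G v j" for z j
      using that layer_unique[OF u(1), of j] by simp
  qed (use ux x y in \<open>simp_all add: nbrs_def insert_commute\<close>)
  then have "contains_copy G (cycle_graph (2 * (t + 1)))" by simp
  then show False using family_freeD_even[OF G(2), of "t + 1"] t u(2) by simp
qed

lemma layer_nbrs_branch:
  assumes G: "simple_graph G" "family_free (even_cycles l \<union> \<F>) G"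
    and u: "u \<in> layer G v i" "i \<le> l"
    and x: "x \<in> layer G v i" "x \<in> nbrs G u" and y: "y \<in> layer G v i" "y \<in> nbrs G u"
    and b: "(parent G v ^^ (i - 1)) x = (parent G v ^^ (i - 1)) y"
  shows "x = y"
proof (rule ccontr)
  assume xy: "x \<noteq> y"
  have ux: "u \<noteq> x" "u \<noteq> y" using x y nbrs_subset[OF G(1)] by blast+
  have i: "i \<noteq> 0" using xy x y by (intro notI) simp
  obtain t where t: "1 \<le> t" "t \<le> i" "contains_copy G (cycle_graph (2 * t + 1 + length [u]))" "t \<le> i - 1"
  proof (rule cycle_through_tree[OF G(1) x(1) y(1) xy, of "[u]"])
    show "i \<le> j" if "z \<in> set [u]" "z \<in> layer G v j" for z j
      using that layer_unique[OF u(1), of j] by simp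
  qed (use ux x y b in \<open>simp_all add: nbrs_def insert_commute\<close>)
  then have "contains_copy G (cycle_graph (2 * (t + 1)))" by simp
  moreover have "2 \<le> t + 1" "t + 1 \<le> l" using t u(2) i by linarith+
  ultimately show False using family_freeD_even[OF G(2), of "t + 1"] by blast
qed

subsection \<open>Subgraphs of large minimum degree\<close>

definition induced_edges :: "'a sgraph \<Rightarrow> 'a set \<Rightarrow> 'a set set" where
  "induced_edges G W = {e \<in> edges G. e \<subseteq> W}"

lemma min_degree_subset:
  fixes \<tau> :: "'a \<Rightarrow> real"
  assumes G: "simple_graph G" and V: "finite V" and less: "(\<Sum>v\<in>V. \<tau> v) < card (induced_edges G V)"
  obtains W where "W \<subseteq> V" "W \<noteq> {}" "\<And>v. v \<in> W \<Longrightarrow> \<tau> v < card (nbrs G v \<inter> W)"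
proof -
  let ?R = "\<lambda>W. W \<subseteq> V \<and> (\<Sum>v\<in>W. \<tau> v) < card (induced_edges G W)"
  have "?R V" using less by simp
  then obtain W where W: "?R W" and minW: "\<And>W'. ?R W' \<Longrightarrow> card W \<le> card W'"
    using ex_has_least_nat[of ?R V card] by auto
  have finW: "finite W" using W V finite_subset by auto
  have fE: "finite (edges G)" using simple_graph_finite_edges[OF G] .
  have "induced_edges G {} = {}"
    using G by (auto simp: induced_edges_def simple_graph_def)
  then have "W \<noteq> {}" using W by auto
  moreover have "\<tau> v < card (nbrs G v \<inter> W)" if v: "v \<in> W" for v
  proof -
    have "card (W - {v}) < card W" using v finW by (metis card_Diff1_less)
    then have "\<not> ?R (W - {v})" using minW[of "W - {v}"] by linarith
    then have le: "card (induced_edges G (W - {v})) \<le> (\<Sum>u\<in>W - {v}. \<tau> u)" using W by auto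
    have "induced_edges G W \<subseteq> induced_edges G (W - {v}) \<union> (\<lambda>w. {v, w}) ` (nbrs G v \<inter> W)"
    proof
      fix e assume e: "e \<in> induced_edges G W"
      then have ce: "card e = 2" "e \<subseteq> W" "e \<in> edges G" using G by (auto simp: induced_edges_def simple_graph_def)
      show "e \<in> induced_edges G (W - {v}) \<union> (\<lambda>w. {v, w}) ` (nbrs G v \<inter> W)"
      proof (cases "v \<in> e")
        case True
        then obtain w where "e = {v, w}" using ce(1)
          by (metis card_2_iff doubleton_eq_iff insert_iff singletonD)
        then show ?thesis using ce by (auto simp: nbrs_def)
      qed (use ce in \<open>auto simp: induced_edges_def\<close>)
    qed
    then have "card (induced_edges G W) \<le> card (induced_edges G (W - {v}) \<union> (\<lambda>w. {v, w}) ` (nbrs G v \<inter> W))"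
      using fE finW by (intro card_mono) (auto simp: induced_edges_def)
    also have "\<dots> \<le> card (induced_edges G (W - {v})) + card (nbrs G v \<inter> W)"
      using card_Un_le card_image_le[of "nbrs G v \<inter> W" "\<lambda>w. {v, w}"] finW
      by (meson add_left_mono finite_Int order_trans)
    finally have "real (card (induced_edges G W)) \<le> card (induced_edges G (W - {v})) + card (nbrs G v \<inter> W)"
      by linarith
    moreover have "(\<Sum>u\<in>W. \<tau> u) = \<tau> v + (\<Sum>u\<in>W - {v}. \<tau> u)" by (rule sum.remove[OF finW v])
    ultimately show ?thesis using W le by linarith
  qed
  ultimately show ?thesis using that W by blast
qed

lemma greedy_path:
  assumes G: "simple_graph G" and W: "finite W" "W \<noteq> {}" "\<And>v. v \<in> W \<Longrightarrow> card (nbrs G v \<inter> W) > m"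
  shows "1 \<le> r \<Longrightarrow> r \<le> Suc m \<Longrightarrow> \<exists>xs. length xs = r \<and> distinct xs \<and> set xs \<subseteq> W \<and>
     successively (\<lambda>u w. {u, w} \<in> edges G) xs"
proof (induction r rule: dec_induct)
  case base
  obtain w where "w \<in> W" using W by blast
  then show ?case by (intro exI[of _ "[w]"]) auto
next
  case (step r)
  then obtain xs where xs: "length xs = r" "distinct xs" "set xs \<subseteq> W"
    "successively (\<lambda>u w. {u, w} \<in> edges G) xs" by auto
  then obtain x ys where x: "xs = x # ys" using step by (cases xs) auto
  have "card (set xs) < card (nbrs G x \<inter> W)"
    using W(3)[of x] xs x step distinct_card[of xs] by auto
  then obtain w where "w \<in> nbrs G x \<inter> W" "w \<notin> set xs"
    by (meson List.finite_set card_mono leD subsetI)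
  then show ?case using xs x
    by (intro exI[of _ "w # xs"]) (auto simp: nbrs_def insert_commute)
qed

text \<open>
  The end of a greedy path of length \<open>k - 2 i - 1\<close> has two further neighbours; they lie in different
  branches, so one of them is joined to the start of the path through the root, closing a \<open>k\<close>-cycle.
\<close>

lemma layer_sparse:
  assumes G: "simple_graph G" "family_free (even_cycles l \<union> {cycle_graph k}) G"
    and i: "i \<le> l" and k: "odd k" "k > 2 * l" and v: "v \<in> verts G"
    and fin: "finite (layer G v i)"
  shows "card (induced_edges G (layer G v i)) \<le> k * card (layer G v i)"
proof (rule ccontr)
  let ?L = "layer G v i"
  assume "\<not> ?thesis"
  then have "real (k * card ?L) < real (card (induced_edges G ?L))" by (simp only: of_nat_less_iff not_le)
  then have "(\<Sum>v\<in>?L. real k) < card (induced_edges G ?L)" by (simp add: mult.commute)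
  from min_degree_subset[OF G(1) fin this]
  obtain W where W: "W \<subseteq> ?L" "W \<noteq> {}" "\<And>v. v \<in> W \<Longrightarrow> k < card (nbrs G v \<inter> W)"
    by (metis of_nat_less_iff)
  have fW: "finite W" using W(1) fin finite_subset by blast
  define m where "m = k - 2 * i"
  have m: "1 \<le> m" "m \<le> k" "k = 2 * i + m" using i k by (auto simp: m_def)
  obtain xs where xs: "length xs = m" "distinct xs" "set xs \<subseteq> W"
    "successively (\<lambda>u w. {u, w} \<in> edges G) xs"
    using greedy_path[OF G(1) fW W(2,3), of m] m by auto
  then obtain x ys where x: "xs = x # ys" using m by (cases xs) auto
  define z where "z = last xs"
  have xsne: "xs \<noteq> []" using x by simp
  have zW: "z \<in> W" "x \<in> W" using xs x unfolding z_def by auto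
  have card: "card (nbrs G x \<inter> W - set xs) \<ge> 2"
  proof -
    have "x \<notin> nbrs G x" using nbrs_subset[OF G(1)] by blast
    then have "nbrs G x \<inter> W - set xs = nbrs G x \<inter> W - set ys" using x by auto
    moreover have "card (set ys) = m - 1" using xs x distinct_card[of ys] by auto
    ultimately show ?thesis
      using diff_card_le_card_Diff[of "set ys" "nbrs G x \<inter> W"] W(3)[OF zW(2)] m by simp
  qed
  then obtain y y' where yy: "y \<in> nbrs G x \<inter> W - set xs" "y' \<in> nbrs G x \<inter> W - set xs" "y \<noteq> y'"
    by (metis card_le_Suc0_iff_eq not_less_eq_eq numeral_2_eq_2 card.infinite zero_le)
  have "(parent G v ^^ (i - 1)) y \<noteq> (parent G v ^^ (i - 1)) y'"
    using layer_nbrs_branch[OF G _ i, of x v y y'] yy W(1) zW by auto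
  then obtain w where w: "w \<in> nbrs G x \<inter> W - set xs" "(parent G v ^^ (i - 1)) w \<noteq> (parent G v ^^ (i - 1)) z"
    using yy by metis
  have wz: "w \<noteq> z" using w by auto
  have ww: "w \<in> ?L" "z \<in> ?L" using w zW W by auto
  have "i \<noteq> 0" using ww wz by (intro notI) simp
  obtain t where t: "1 \<le> t" "t \<le> i" "contains_copy G (cycle_graph (2 * t + 1 + length (butlast xs)))"
    "(parent G v ^^ t) z = (parent G v ^^ t) w"
  proof (rule cycle_through_tree[OF G(1) ww(2,1) wz[symmetric], of "butlast xs"])
    show "distinct (butlast xs)" using xs by (simp add: distinct_butlast)
    show "z \<notin> set (butlast xs)"
      using xs(2) xsne unfolding z_def by (metis append_butlast_last_id distinct_append list.set_intros(1) disjoint_iff)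
    show "w \<notin> set (butlast xs)" using w by (auto dest: in_set_butlastD)
    show "i \<le> j" if "q \<in> set (butlast xs)" "q \<in> layer G v j" for q j
    proof -
      have "q \<in> layer G v i" using that xs(3) W(1) in_set_butlastD[of q xs] by auto
      then show ?thesis using layer_unique[OF that(2), of i] by simp
    qed
    have "successively (\<lambda>u w. {u, w} \<in> edges G) (w # xs)"
      using xs(4) w x by (auto simp: nbrs_def insert_commute)
    then show "successively (\<lambda>u w. {u, w} \<in> edges G) (w # butlast xs @ [z])"
      using xsne by (simp add: z_def)
  qed
  have "t = i"
  proof (rule ccontr)
    assume "t \<noteq> i"
    then have "t \<le> i - 1" using t by simp
    then have "i - 1 = (i - 1 - t) + t" by simp
    then have "(parent G v ^^ (i - 1)) z = (parent G v ^^ (i - 1)) w"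
      using t(4) by (metis comp_apply funpow_add)
    then show False using w by simp
  qed
  then have "contains_copy G (cycle_graph k)" using t(3) m xs(1) by simp
  then show False using G(2) by (auto simp: family_free_def)
qed

subsection \<open>Counting walks\<close>

lemma sum_card_nbrs_within:
  assumes G: "simple_graph G" and W: "finite W"
  shows "(\<Sum>u\<in>W. card (nbrs G u \<inter> W)) = 2 * card (induced_edges G W)"
proof -
  let ?J = "\<lparr>verts = W, edges = induced_edges G W\<rparr>"
  have J: "simple_graph ?J" using G W by (auto simp: simple_graph_def induced_edges_def)
  have "nbrs ?J u = nbrs G u \<inter> W" if "u \<in> W" for u
    using that by (auto simp: nbrs_def induced_edges_def)
  then show ?thesis
    using sum_degree[OF J] by (simp add: vertex_degree_eq_card_nbrs[OF J] num_edges_def)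
qed

definition cut_graph :: "'a sgraph \<Rightarrow> 'a set \<Rightarrow> 'a sgraph" where
  "cut_graph G A = \<lparr>verts = verts G, edges = {e \<in> edges G. \<exists>a\<in>A. \<exists>b\<in>verts G - A. e = {a, b}}\<rparr>"

lemma cut_graph:
  assumes "simple_graph G" "A \<subseteq> verts G"
  shows "is_subgraph (cut_graph G A) G" "is_bipartite (cut_graph G A)"
proof -
  show "is_subgraph (cut_graph G A) G"
    using assms by (auto simp: is_subgraph_def cut_graph_def simple_graph_def)
  show "is_bipartite (cut_graph G A)"
    using assms unfolding is_bipartite_def cut_graph_def
    by (intro exI[of _ A] exI[of _ "verts G - A"]) auto
qed

lemma sum_card_nbrs_outside:
  assumes G: "simple_graph G" and A: "A \<subseteq> verts G"
  shows "(\<Sum>u\<in>A. card (nbrs G u - A)) \<le> num_edges (cut_graph G A)"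
proof -
  have fA: "finite A" using assms finite_subset by (auto simp: simple_graph_def)
  have "(\<Sum>u\<in>A. card (nbrs G u - A)) = card (SIGMA u:A. nbrs G u - A)"
    using fA finite_nbrs[OF G] by (simp add: card_SigmaI)
  also have "\<dots> = card ((\<lambda>(u, w). {u, w}) ` (SIGMA u:A. nbrs G u - A))"
    by (intro card_image[symmetric]) (auto simp: inj_on_def doubleton_eq_iff)
  also have "\<dots> \<le> num_edges (cut_graph G A)"
    unfolding num_edges_def
  proof (rule card_mono)
    show "finite (edges (cut_graph G A))"
      using simple_graph_finite_edges[OF G] by (simp add: cut_graph_def)
    show "(\<lambda>(u, w). {u, w}) ` (SIGMA u:A. nbrs G u - A) \<subseteq> edges (cut_graph G A)"
      using nbrs_subset[OF G] by (fastforce simp: cut_graph_def nbrs_def)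
  qed
  finally show ?thesis .
qed

definition adj_op :: "'a sgraph \<Rightarrow> ('a \<Rightarrow> real) \<Rightarrow> 'a \<Rightarrow> real" where
  "adj_op G f u = (\<Sum>w\<in>nbrs G u. f w)"

lemma sum_ln_le:
  fixes f :: "'a \<Rightarrow> real"
  assumes "finite A" "A \<noteq> {}" "\<And>x. x \<in> A \<Longrightarrow> f x > 0"
  shows "(\<Sum>x\<in>A. ln (f x)) \<le> card A * (ln (\<Sum>x\<in>A. f x) - ln (card A))"
proof -
  define m where "m = (\<Sum>x\<in>A. f x) / card A"
  have S: "(\<Sum>x\<in>A. f x) > 0" using assms by (intro sum_pos) auto
  have c: "real (card A) > 0" using assms by (simp add: card_gt_0_iff)
  have m: "m > 0" using S c by (simp add: m_def)
  have "ln (f x) \<le> ln m + (f x / m - 1)" if "x \<in> A" for x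
    using ln_le_minus_one[of "f x / m"] assms(3)[OF that] m by (simp add: ln_div)
  then have "(\<Sum>x\<in>A. ln (f x)) \<le> (\<Sum>x\<in>A. ln m + (f x / m - 1))" by (intro sum_mono)
  also have "\<dots> = card A * ln m + ((\<Sum>x\<in>A. f x) / m - card A)"
    by (simp add: sum.distrib sum_subtractf sum_divide_distrib)
  also have "(\<Sum>x\<in>A. f x) / m = card A" using S c by (simp add: m_def)
  finally show ?thesis using S c by (simp add: m_def ln_div)
qed

lemma sum_mult_ln_ge:
  fixes f :: "'a \<Rightarrow> real"
  assumes "finite A" "\<And>x. x \<in> A \<Longrightarrow> f x \<ge> 0" "(\<Sum>x\<in>A. f x) > 0"
  shows "(\<Sum>x\<in>A. f x * ln (f x)) \<ge> (\<Sum>x\<in>A. f x) * ln ((\<Sum>x\<in>A. f x) / card A)"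
proof -
  have c: "real (card A) > 0" using assms(1,3) by (cases "A = {}") (auto simp: card_gt_0_iff)
  define m where "m = (\<Sum>x\<in>A. f x) / card A"
  have m: "m > 0" using assms(3) c by (simp add: m_def)
  have "f x * ln m + (f x - m) \<le> f x * ln (f x)" if "x \<in> A" for x
  proof (cases "f x = 0")
    case False
    then have fx: "f x > 0" using assms(2)[OF that] by simp
    have "ln m - ln (f x) \<le> m / f x - 1"
      using ln_le_minus_one[of "m / f x"] fx m by (simp add: ln_div)
    then have "f x * (ln m - ln (f x)) \<le> f x * (m / f x - 1)" using fx by (intro mult_left_mono) auto
    then show ?thesis using fx by (simp add: algebra_simps)
  qed (use m in simp)
  then have "(\<Sum>x\<in>A. f x * ln m + (f x - m)) \<le> (\<Sum>x\<in>A. f x * ln (f x))" by (intro sum_mono)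
  moreover have "(\<Sum>x\<in>A. f x * ln m + (f x - m)) = (\<Sum>x\<in>A. f x) * ln m + ((\<Sum>x\<in>A. f x) - card A * m)"
    by (simp add: sum.distrib sum_subtractf sum_distrib_right)
  moreover have "card A * m = (\<Sum>x\<in>A. f x)" using c by (simp add: m_def)
  ultimately show ?thesis by (simp add: m_def)
qed

text \<open>
  By concavity of the logarithm, the degree-weighted mean of the logarithm of the number of
  walks of length \<open>r\<close> is at least \<open>r\<close> times that of the logarithm of the degree.
\<close>

lemma exists_vertex_many_walks:
  assumes G: "simple_graph G" and ne: "verts G \<noteq> {}"
  obtains v where "v \<in> verts G" "(adj_op G ^^ r) (\<lambda>_. 1) v \<ge> average_degree G ^ r"
proof (cases "edges G = {}")
  case True
  obtain v where v: "v \<in> verts G" using ne by blast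
  have d: "average_degree G = 0" by (simp add: average_degree_eq[OF G] num_edges_def True)
  have "nbrs G v = {}" for v using True by (simp add: nbrs_def)
  then have "adj_op G f = (\<lambda>_. 0)" for f by (simp add: adj_op_def fun_eq_iff)
  then have "(adj_op G ^^ r) (\<lambda>_. 1) v \<ge> average_degree G ^ r"
    by (cases r) (simp_all add: d)
  then show ?thesis using that v by blast
next
  case False
  let ?V = "verts G" and ?g = "\<lambda>r. (adj_op G ^^ r) (\<lambda>_. 1::real)"
  define \<delta> where "\<delta> v = real (card (nbrs G v))" for v
  have fV: "finite ?V" using G by (simp add: simple_graph_def)
  have D: "(\<Sum>v\<in>?V. \<delta> v) = 2 * real (num_edges G)"
    using sum_degree[OF G] by (simp add: \<delta>_def vertex_degree_eq_card_nbrs[OF G] flip: of_nat_sum)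
  have e: "num_edges G > 0"
    using False simple_graph_finite_edges[OF G] by (simp add: num_edges_def card_gt_0_iff)
  have d: "(\<Sum>v\<in>?V. \<delta> v) / card ?V = average_degree G"
    by (simp add: D average_degree_eq[OF G] num_verts_def)
  have dpos: "average_degree G > 0"
    using e ne fV by (simp add: average_degree_eq[OF G] num_verts_def card_gt_0_iff)
  have nb: "nbrs G w \<noteq> {}" if "w \<in> nbrs G v" for v w using that nbrs_sym by fastforce
  have pos: "?g r v > 0" if "nbrs G v \<noteq> {}" for r v
    using that
  proof (induction r arbitrary: v)
    case (Suc r)
    have "(\<Sum>w\<in>nbrs G v. ?g r w) > 0"
      by (rule sum_pos) (use Suc nb finite_nbrs[OF G] in auto)
    then have "adj_op G (?g r) v > 0" unfolding adj_op_def[of G "?g r" v] .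
    then show ?case by simp
  qed simp
  have main: "(\<Sum>v\<in>?V. \<delta> v * ln (?g r v)) \<ge> r * (\<Sum>v\<in>?V. \<delta> v * ln (\<delta> v))" for r
  proof (induction r)
    case (Suc r)
    have step: "\<delta> v * ln (\<delta> v) + (\<Sum>w\<in>nbrs G v. ln (?g r w)) \<le> \<delta> v * ln (?g (Suc r) v)" for v
    proof (cases "nbrs G v = {}")
      case False
      have "(\<Sum>w\<in>nbrs G v. ln (?g r w)) \<le> card (nbrs G v) * (ln (\<Sum>w\<in>nbrs G v. ?g r w) - ln (card (nbrs G v)))"
        by (rule sum_ln_le) (use False nb pos finite_nbrs[OF G] in auto)
      then show ?thesis by (simp add: \<delta>_def adj_op_def algebra_simps)
    qed (simp add: \<delta>_def)
    have "(\<Sum>v\<in>?V. \<Sum>w\<in>nbrs G v. ln (?g r w)) = (\<Sum>v\<in>?V. \<Sum>w\<in>?V. if w \<in> nbrs G v then ln (?g r w) else 0)"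
    proof (rule sum.cong)
      fix v
      have "?V \<inter> {w. w \<in> nbrs G v} = nbrs G v" using nbrs_subset[OF G, of v] by blast
      then show "(\<Sum>w\<in>nbrs G v. ln (?g r w)) = (\<Sum>w\<in>?V. if w \<in> nbrs G v then ln (?g r w) else 0)"
        using fV by (simp add: sum.If_cases)
    qed simp
    also have "\<dots> = (\<Sum>w\<in>?V. \<Sum>v\<in>?V. if w \<in> nbrs G v then ln (?g r w) else 0)" by (rule sum.swap)
    also have "\<dots> = (\<Sum>w\<in>?V. \<delta> w * ln (?g r w))"
    proof (rule sum.cong)
      fix w
      have "{v \<in> ?V. w \<in> nbrs G v} = nbrs G w" using nbrs_subset[OF G] nbrs_sym by fastforce
      then show "(\<Sum>v\<in>?V. if w \<in> nbrs G v then ln (?g r w) else 0) = \<delta> w * ln (?g r w)"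
        using fV by (simp add: sum.If_cases \<delta>_def Int_def)
    qed simp
    finally have "(\<Sum>v\<in>?V. \<delta> v * ln (\<delta> v)) + (\<Sum>w\<in>?V. \<delta> w * ln (?g r w))
        = (\<Sum>v\<in>?V. \<delta> v * ln (\<delta> v) + (\<Sum>w\<in>nbrs G v. ln (?g r w)))" by (simp add: sum.distrib)
    also have "\<dots> \<le> (\<Sum>v\<in>?V. \<delta> v * ln (?g (Suc r) v))" by (intro sum_mono step)
    finally show ?case using Suc by (simp add: algebra_simps)
  qed simp
  have "(\<Sum>v\<in>?V. \<delta> v * ln (\<delta> v)) \<ge> (\<Sum>v\<in>?V. \<delta> v) * ln (average_degree G)"
    using sum_mult_ln_ge[of ?V \<delta>] fV D e unfolding d by (simp add: \<delta>_def)
  then have a: "r * (\<Sum>v\<in>?V. \<delta> v * ln (\<delta> v)) \<ge> r * ((\<Sum>v\<in>?V. \<delta> v) * ln (average_degree G))"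
    by (intro mult_left_mono) auto
  have "(\<Sum>v\<in>?V. \<delta> v * ln (?g r v)) \<ge> (\<Sum>v\<in>?V. \<delta> v * (r * ln (average_degree G)))"
  proof -
    have "(\<Sum>v\<in>?V. \<delta> v * (r * ln (average_degree G))) = r * ((\<Sum>v\<in>?V. \<delta> v) * ln (average_degree G))"
      by (simp add: sum_distrib_left sum_distrib_right mult_ac)
    with a main[of r] show ?thesis by linarith
  qed
  moreover have "(\<Sum>v\<in>?V. \<delta> v * ln (?g r v)) < (\<Sum>v\<in>?V. \<delta> v * (r * ln (average_degree G)))"
    if H: "\<forall>v\<in>?V. nbrs G v \<noteq> {} \<longrightarrow> ln (?g r v) < r * ln (average_degree G)"
  proof (rule sum_strict_mono_ex1[OF fV])
    show "\<forall>v\<in>?V. \<delta> v * ln (?g r v) \<le> \<delta> v * (r * ln (average_degree G))"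
    proof
      fix v assume v: "v \<in> ?V"
      show "\<delta> v * ln (?g r v) \<le> \<delta> v * (r * ln (average_degree G))"
      proof (cases "nbrs G v = {}")
        case False
        then show ?thesis using H v by (intro mult_left_mono) (auto simp: \<delta>_def less_imp_le)
      qed (simp add: \<delta>_def)
    qed
    obtain v where v: "v \<in> ?V" "\<delta> v \<noteq> 0" using D e by (metis mult_eq_0_iff of_nat_eq_0_iff sum.neutral zero_neq_numeral less_irrefl_nat)
    then have "nbrs G v \<noteq> {}" "\<delta> v > 0" by (auto simp: \<delta>_def)
    then show "\<exists>v\<in>?V. \<delta> v * ln (?g r v) < \<delta> v * (r * ln (average_degree G))"
      using H v mult_strict_left_mono by blast
  qed
  ultimately have "\<not> (\<forall>v\<in>?V. nbrs G v \<noteq> {} \<longrightarrow> ln (?g r v) < r * ln (average_degree G))"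
    by linarith
  then obtain v where v: "v \<in> ?V" "nbrs G v \<noteq> {}" "ln (?g r v) \<ge> r * ln (average_degree G)"
    by (auto simp: not_less)
  have "average_degree G ^ r = exp (r * ln (average_degree G))"
    using dpos by (simp add: exp_of_nat_mult)
  also have "\<dots> \<le> exp (ln (?g r v))" using v by simp
  also have "\<dots> = ?g r v" using pos[OF v(2)] by simp
  finally show ?thesis using that v by blast
qed

locale cycle_free =
  fixes G :: "'a sgraph" and l k :: nat
  assumes simple: "simple_graph G"
    and free: "family_free (even_cycles l \<union> {cycle_graph k}) G"
    and odd_k: "odd k" and k_gt: "k > 2 * l"
begin

lemma cycle_free_subgraph:
  "\<lbrakk>V \<subseteq> verts G; E \<subseteq> edges G; \<And>e. e \<in> E \<Longrightarrow> e \<subseteq> V\<rbrakk> \<Longrightarrow> cycle_free \<lparr>verts = V, edges = E\<rparr> l k"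
  using simple free odd_k k_gt family_free_mono[OF free, of "\<lparr>verts = V, edges = E\<rparr>"]
    simple_graph_subset[OF simple, of V E] finite_subset[of V "verts G"]
  by (auto simp: cycle_free_def simple_graph_def)

lemma finite_verts: "finite (verts G)"
  using simple by (simp add: simple_graph_def)

lemma layer_subset_verts: "v \<in> verts G \<Longrightarrow> layer G v i \<subseteq> verts G"
proof -
  assume v: "v \<in> verts G"
  have "bfs_ball G v i \<subseteq> verts G"
    using nbrs_subset[OF simple] v by (induction i) auto
  then show ?thesis using layer_subset_ball[of G v i] by blast
qed

lemma finite_layer: "v \<in> verts G \<Longrightarrow> finite (layer G v i)"
  using layer_subset_verts finite_verts finite_subset by metis

lemma sum_layer_nbrs_within:
  assumes "v \<in> verts G" "i \<le> l"
  shows "(\<Sum>u\<in>layer G v i. card (nbrs G u \<inter> layer G v i)) \<le> 2 * k * card (layer G v i)"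
  using sum_card_nbrs_within[OF simple finite_layer[OF assms(1)], of i]
    layer_sparse[OF simple free assms(2) odd_k k_gt assms(1) finite_layer[OF assms(1)]]
  by simp

lemma card_nbrs_layer_below:
  assumes "u \<in> layer G v (Suc i)" "Suc i \<le> l"
  shows "card (nbrs G u \<inter> layer G v i) \<le> 1"
  using unique_parent[OF simple free assms]
  by (auto simp: card_le_Suc0_iff_eq finite_nbrs[OF simple])

lemma sum_layer_step:
  fixes f :: "'a \<Rightarrow> real" and M :: real
  assumes v: "v \<in> verts G" and i: "i < l"
    and f: "\<And>w. w \<in> verts G \<Longrightarrow> 0 \<le> f w" "\<And>w. w \<in> verts G \<Longrightarrow> f w \<le> M"
  shows "(\<Sum>u\<in>layer G v i. adj_op G f u)
    \<le> (\<Sum>w\<in>layer G v (Suc i). f w) + (2 * k + 1) * M * card (layer G v i)"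
proof -
  define L where "L = layer G v"
  have LV: "L j \<subseteq> verts G" for j using layer_subset_verts[OF v] by (simp add: L_def)
  have fL: "finite (L j)" for j using finite_layer[OF v] by (simp add: L_def)
  have M: "M \<ge> 0" using f[OF v] by linarith
  have fn: "finite (nbrs G u)" for u using finite_nbrs[OF simple] .
  have nV: "nbrs G u \<subseteq> verts G" for u using nbrs_subset[OF simple] by blast
  have pt: "adj_op G f u \<le> (\<Sum>w\<in>nbrs G u \<inter> L (Suc i). f w) + (card (nbrs G u \<inter> L i) + 1) * M"
    if u: "u \<in> L i" for u
  proof -
    let ?D = "nbrs G u - L (Suc i) - L i"
    have D: "card ?D \<le> 1"
    proof (cases i)
      case 0
      have "w \<in> L (Suc i) \<or> w \<in> L i" if w: "w \<in> nbrs G u" for w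
      proof -
        have "u \<in> layer G v i" "w \<in> nbrs G u" using u w by (auto simp: L_def)
        then show ?thesis
          by (cases rule: layer_nbr) (use 0 in \<open>auto simp: L_def simp del: layer.simps\<close>)
      qed
      then have D0: "?D = {}" by blast
      show ?thesis unfolding D0 by simp
    next
      case (Suc j)
      have "?D \<subseteq> nbrs G u \<inter> L j"
      proof
        fix w assume w: "w \<in> ?D"
        have "u \<in> layer G v i" "w \<in> nbrs G u" using u w by (auto simp: L_def)
        then show "w \<in> nbrs G u \<inter> L j"
          by (cases rule: layer_nbr) (use w Suc in \<open>auto simp: L_def simp del: layer.simps\<close>)
      qed
      then have "card ?D \<le> card (nbrs G u \<inter> L j)" using fn by (intro card_mono) auto
      moreover have "u \<in> layer G v (Suc j)" using u unfolding L_def Suc .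
      ultimately show ?thesis using card_nbrs_layer_below[of u v j] i Suc unfolding L_def by linarith
    qed
    have b: "(\<Sum>w\<in>X. f w) \<le> card X * M" if "X \<subseteq> nbrs G u" for X
      using sum_bounded_above[of X f M] f(2) that nV by blast
    have dis: "L (Suc i) \<inter> L i = {}" using layer_disjoint[of "Suc i" i G v] unfolding L_def by simp
    have "adj_op G f u = (\<Sum>w\<in>(nbrs G u \<inter> L (Suc i)) \<union> ((nbrs G u \<inter> L i) \<union> ?D). f w)"
      unfolding adj_op_def by (rule sum.cong) auto
    also have "\<dots> = (\<Sum>w\<in>nbrs G u \<inter> L (Suc i). f w) + ((\<Sum>w\<in>nbrs G u \<inter> L i. f w) + (\<Sum>w\<in>?D. f w))"
      using dis fn by (subst sum.union_disjoint; (subst sum.union_disjoint)?) auto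
    also have "(\<Sum>w\<in>nbrs G u \<inter> L i. f w) \<le> card (nbrs G u \<inter> L i) * M" by (rule b) auto
    also have "(\<Sum>w\<in>?D. f w) \<le> card ?D * M" by (rule b) auto
    also have "card ?D * M \<le> 1 * M" using D M by (intro mult_right_mono) auto
    finally show ?thesis by (simp add: algebra_simps)
  qed
  have "(\<Sum>u\<in>L i. adj_op G f u)
      \<le> (\<Sum>u\<in>L i. (\<Sum>w\<in>nbrs G u \<inter> L (Suc i). f w) + (card (nbrs G u \<inter> L i) + 1) * M)"
    by (intro sum_mono pt)
  also have "\<dots> = (\<Sum>u\<in>L i. \<Sum>w\<in>nbrs G u \<inter> L (Suc i). f w)
      + (real (\<Sum>u\<in>L i. card (nbrs G u \<inter> L i)) + card (L i)) * M"
    by (simp add: sum.distrib algebra_simps sum_distrib_left)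
  also have "(\<Sum>u\<in>L i. \<Sum>w\<in>nbrs G u \<inter> L (Suc i). f w)
      = (\<Sum>u\<in>L i. \<Sum>w\<in>L (Suc i). if w \<in> nbrs G u then f w else 0)"
  proof (rule sum.cong)
    fix u
    have "L (Suc i) \<inter> {w. w \<in> nbrs G u} = nbrs G u \<inter> L (Suc i)" by blast
    then show "(\<Sum>w\<in>nbrs G u \<inter> L (Suc i). f w) = (\<Sum>w\<in>L (Suc i). if w \<in> nbrs G u then f w else 0)"
      using fL by (simp add: sum.If_cases)
  qed simp
  also have "\<dots> = (\<Sum>w\<in>L (Suc i). \<Sum>u\<in>L i. if w \<in> nbrs G u then f w else 0)" by (rule sum.swap)
  also have "\<dots> \<le> (\<Sum>w\<in>L (Suc i). f w)"
  proof (rule sum_mono)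
    fix w assume w: "w \<in> L (Suc i)"
    have eq: "L i \<inter> {u. w \<in> nbrs G u} = nbrs G w \<inter> L i" using nbrs_sym by fastforce
    have "(\<Sum>u\<in>L i. if w \<in> nbrs G u then f w else 0) = card (nbrs G w \<inter> L i) * f w"
      using fL by (simp add: sum.If_cases eq)
    also have "\<dots> \<le> 1 * f w"
      using card_nbrs_layer_below[of w v i] w i f(1) LV unfolding L_def
      by (intro mult_right_mono) (auto simp del: layer.simps)
    finally show "(\<Sum>u\<in>L i. if w \<in> nbrs G u then f w else 0) \<le> f w" by simp
  qed
  also have "real (\<Sum>u\<in>L i. card (nbrs G u \<inter> L i)) \<le> real (2 * k * card (L i))"
    using sum_layer_nbrs_within[OF v, of i] i unfolding L_def by (simp only: of_nat_le_iff)
  finally have "(\<Sum>u\<in>L i. adj_op G f u) \<le> (\<Sum>w\<in>L (Suc i). f w) + (real (2 * k * card (L i)) + card (L i)) * M"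
    using M by (simp add: mult_right_mono)
  then show ?thesis by (simp add: L_def algebra_simps)
qed

lemma layer_growth:
  fixes \<tau> :: real
  assumes v: "v \<in> verts G" and i: "i < l" and deg: "\<And>u. u \<in> layer G v i \<Longrightarrow> real (card (nbrs G u)) \<ge> \<tau>"
  shows "(\<tau> - (2 * k + 1)) * card (layer G v i) \<le> card (layer G v (Suc i))"
proof -
  have "\<tau> * card (layer G v i) \<le> (\<Sum>u\<in>layer G v i. adj_op G (\<lambda>_. 1) u)"
    using sum_bounded_below[of "layer G v i" \<tau> "adj_op G (\<lambda>_. 1)"] deg
    by (simp add: adj_op_def mult.commute)
  also have "\<dots> \<le> card (layer G v (Suc i)) + (2 * k + 1) * card (layer G v i)"
    using sum_layer_step[OF v i, of "\<lambda>_. 1" 1] by (simp add: algebra_simps del: layer.simps)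
  finally show ?thesis by (simp add: algebra_simps)
qed

lemma card_layer_le:
  fixes T :: real
  assumes v: "v \<in> verts G" and T: "\<And>u. u \<in> verts G \<Longrightarrow> real (card (nbrs G u)) \<le> T"
  shows "real (card (layer G v i)) \<le> T ^ i"
proof (induction i)
  case (Suc i)
  have T0: "T \<ge> 0" using T[OF v] by linarith
  have "layer G v (Suc i) \<subseteq> (\<Union>u\<in>layer G v i. nbrs G u)"
    using ex_parent[of _ G v i] nbrs_sym by fastforce
  then have "card (layer G v (Suc i)) \<le> card (\<Union>u\<in>layer G v i. nbrs G u)"
    using finite_layer[OF v] finite_nbrs[OF simple] by (intro card_mono) auto
  also have "\<dots> \<le> (\<Sum>u\<in>layer G v i. card (nbrs G u))"
    using finite_layer[OF v] by (rule card_UN_le)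
  finally have "real (card (layer G v (Suc i))) \<le> (\<Sum>u\<in>layer G v i. real (card (nbrs G u)))"
    by (simp flip: of_nat_sum)
  also have "\<dots> \<le> card (layer G v i) * T"
    using sum_bounded_above[of "layer G v i" "\<lambda>u. real (card (nbrs G u))" T] T layer_subset_verts[OF v]
    by blast
  also have "\<dots> \<le> T ^ i * T" using Suc T0 by (intro mult_right_mono) auto
  finally show ?case by (simp add: mult.commute)
qed simp

lemma walks_le_layer:
  fixes f :: "'a \<Rightarrow> real" and M T :: real
  assumes v: "v \<in> verts G" and T: "\<And>u. u \<in> verts G \<Longrightarrow> real (card (nbrs G u)) \<le> T"
  shows "\<lbrakk>i \<le> l; \<And>w. w \<in> verts G \<Longrightarrow> 0 \<le> f w; \<And>w. w \<in> verts G \<Longrightarrow> f w \<le> M\<rbrakk> \<Longrightarrow>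
    (adj_op G ^^ i) f v \<le> (\<Sum>w\<in>layer G v i. f w) + i * (2 * k + 1) * T ^ (i - 1) * M"
proof (induction i arbitrary: f M)
  case (Suc i)
  have M: "M \<ge> 0" using Suc.prems(2,3)[OF v] by linarith
  have nV: "nbrs G u \<subseteq> verts G" for u using nbrs_subset[OF simple] by blast
  have a: "0 \<le> adj_op G f w" "adj_op G f w \<le> T * M" if "w \<in> verts G" for w
  proof -
    show "0 \<le> adj_op G f w" unfolding adj_op_def using nV Suc.prems(2) by (intro sum_nonneg) blast
    have "adj_op G f w \<le> card (nbrs G w) * M"
      unfolding adj_op_def using sum_bounded_above[of "nbrs G w" f M] Suc.prems(3) nV by blast
    also have "\<dots> \<le> T * M" using T[OF that] M by (intro mult_right_mono)
    finally show "adj_op G f w \<le> T * M" .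
  qed
  have "(adj_op G ^^ Suc i) f v = (adj_op G ^^ i) (adj_op G f) v" by (simp add: funpow_swap1)
  also have "\<dots> \<le> (\<Sum>w\<in>layer G v i. adj_op G f w) + i * (2 * k + 1) * T ^ (i - 1) * (T * M)"
    using Suc.prems(1) by (intro Suc.IH a) auto
  also have "i * (2 * k + 1) * T ^ (i - 1) * (T * M) = i * (2 * k + 1) * T ^ i * M"
    by (cases i) auto
  also have "(\<Sum>w\<in>layer G v i. adj_op G f w)
      \<le> (\<Sum>w\<in>layer G v (Suc i). f w) + (2 * k + 1) * M * card (layer G v i)"
    by (rule sum_layer_step[OF v]) (use Suc.prems in auto)
  also have "(2 * k + 1) * M * card (layer G v i) \<le> (2 * k + 1) * M * T ^ i"
    using card_layer_le[OF v T] M by (intro mult_left_mono) auto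
  finally show ?case by (simp add: algebra_simps del: layer.simps)
qed simp

lemma bipartite_subgraph_bounded_degree:
  fixes T :: real
  assumes ne: "verts G \<noteq> {}" and T: "\<And>u. u \<in> verts G \<Longrightarrow> real (card (nbrs G u)) \<le> T"
  obtains H where "is_subgraph H G" "is_bipartite H"
    "average_degree G ^ (l + 1) \<le> num_edges H + (l + 1) * (2 * k + 1) * T ^ l"
proof -
  obtain v where v: "v \<in> verts G" "(adj_op G ^^ (l + 1)) (\<lambda>_. 1) v \<ge> average_degree G ^ (l + 1)"
    using exists_vertex_many_walks[OF simple ne] by blast
  let ?L = "layer G v l"
  let ?H = "cut_graph G ?L"
  have T0: "T \<ge> 0" using T[OF v(1)] by linarith
  have "average_degree G ^ (l + 1) \<le> (adj_op G ^^ l) (adj_op G (\<lambda>_. 1)) v"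
    using v(2) by (simp add: funpow_swap1)
  also have "\<dots> \<le> (\<Sum>w\<in>?L. adj_op G (\<lambda>_. 1) w) + l * (2 * k + 1) * T ^ (l - 1) * T"
    by (rule walks_le_layer[OF v(1) T]) (use T in \<open>auto simp: adj_op_def\<close>)
  also have "l * (2 * k + 1) * T ^ (l - 1) * T = l * (2 * k + 1) * T ^ l" by (cases l) (auto simp: algebra_simps)
  also have "(\<Sum>w\<in>?L. adj_op G (\<lambda>_. 1) w) = real (\<Sum>w\<in>?L. card (nbrs G w))" by (simp add: adj_op_def)
  also have "(\<Sum>w\<in>?L. card (nbrs G w)) = (\<Sum>w\<in>?L. card (nbrs G w \<inter> ?L) + card (nbrs G w - ?L))"
    using finite_nbrs[OF simple] by (intro sum.cong card_Int_Diff) auto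
  also have "\<dots> \<le> 2 * k * card ?L + num_edges ?H"
    using sum_layer_nbrs_within[OF v(1), of l] sum_card_nbrs_outside[OF simple layer_subset_verts[OF v(1)], of l]
    by (simp add: sum.distrib)
  finally have "average_degree G ^ (l + 1) \<le> 2 * k * real (card ?L) + num_edges ?H + l * (2 * k + 1) * T ^ l"
    by simp
  also have "2 * k * real (card ?L) \<le> (2 * k + 1) * T ^ l"
    using card_layer_le[OF v(1) T, of l] T0 by (intro mult_mono) auto
  finally have "average_degree G ^ (l + 1) \<le> num_edges ?H + (l + 1) * (2 * k + 1) * T ^ l"
    by (simp add: algebra_simps)
  then show ?thesis using that cut_graph[OF simple layer_subset_verts[OF v(1)]] by blast
qed

end

context cycle_free
begin

text \<open>
  If every edge meets \<open>S\<close>, one of the first two steps of the breadth-first search starts in \<open>S\<close>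
  and gains the larger factor \<open>a\<close>.
\<close>

lemma power_le_card_verts:
  fixes a b :: real
  assumes W: "W \<subseteq> verts G" "W \<noteq> {}" and l: "2 \<le> l"
    and S: "\<And>e. e \<in> edges G \<Longrightarrow> e \<subseteq> W \<Longrightarrow> e \<inter> S \<noteq> {}"
    and b: "0 \<le> b" "b \<le> a"
    and degS: "\<And>u. u \<in> W \<inter> S \<Longrightarrow> a + (2 * k + 1) \<le> card (nbrs G u \<inter> W)"
    and degW: "\<And>u. u \<in> W - S \<Longrightarrow> b + (2 * k + 1) \<le> card (nbrs G u \<inter> W)"
  shows "a * b ^ (l - 1) \<le> num_verts G"
proof -
  let ?J = "\<lparr>verts = W, edges = induced_edges G W\<rparr>"
  interpret J: cycle_free ?J l k
    by (rule cycle_free_subgraph) (use W in \<open>auto simp: induced_edges_def\<close>)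
  have nb: "nbrs ?J u = nbrs G u \<inter> W" if "u \<in> W" for u
    using that by (auto simp: nbrs_def induced_edges_def)
  obtain v where v: "v \<in> W" using W by blast
  define L where "L = layer ?J v"
  have LW: "L i \<subseteq> W" for i using J.layer_subset_verts[of v i] v by (simp add: L_def)
  have L0: "L 0 = {v}" by (simp add: L_def)
  have degb: "b + (2 * k + 1) \<le> card (nbrs G u \<inter> W)" if "u \<in> W" for u
    using degS[of u] degW[of u] b that by (cases "u \<in> S") auto
  have growb: "b * card (L i) \<le> card (L (Suc i))" if "i < l" for i
  proof -
    have "b + (2 * k + 1) \<le> card (nbrs ?J u)" if "u \<in> L i" for u
      using degb[of u] nb[of u] LW[of i] that by auto
    then show ?thesis using J.layer_growth[of v i "b + (2 * k + 1)"] that v unfolding L_def by simp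
  qed
  have grow: "a * card (L i) \<le> card (L (Suc i))" if "i < l" "L i \<subseteq> S" for i
  proof -
    have "a + (2 * k + 1) \<le> card (nbrs ?J u)" if "u \<in> L i" for u
    proof -
      have "u \<in> W \<inter> S" using that LW \<open>L i \<subseteq> S\<close> by blast
      then show ?thesis using degS[of u] nb[of u] by simp
    qed
    then show ?thesis using J.layer_growth[of v i "a + (2 * k + 1)"] that v unfolding L_def by simp
  qed
  have base: "a * b \<le> card (L 2)"
  proof (cases "v \<in> S")
    case True
    then have "a \<le> card (L 1)" using grow[of 0] l L0 by simp
    then have "a * b \<le> card (L 1) * b" using b by (intro mult_right_mono)
    then show ?thesis using growb[of 1] l by (simp add: mult.commute numeral_2_eq_2)
  next
    case False
    have "L 1 \<subseteq> S"
    proof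
      fix w assume w: "w \<in> L 1"
      then have "{v, w} \<in> edges G" "w \<in> W"
        using ex_parent[of w ?J v 0] unfolding L_def by (auto simp: nbrs_def induced_edges_def insert_commute)
      then show "w \<in> S" using S[of "{v, w}"] v False by auto
    qed
    then have 1: "a * card (L 1) \<le> card (L 2)" using grow[of 1] l by (simp add: numeral_2_eq_2)
    have "b \<le> card (L 1)" using growb[of 0] l L0 by simp
    then have "a * b \<le> a * card (L 1)" using b by (intro mult_left_mono) auto
    then show ?thesis using 1 by linarith
  qed
  have "a * b ^ Suc i \<le> card (L (i + 2))" if "i + 2 \<le> l" for i
    using that
  proof (induction i)
    case 0
    show ?case using base by (simp add: numeral_2_eq_2)
  next
    case (Suc i)
    then have "a * b ^ Suc i * b \<le> card (L (i + 2)) * b" using b by (intro mult_right_mono) auto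
    also have "\<dots> \<le> card (L (Suc i + 2))" using growb[of "i + 2"] Suc by (simp add: mult.commute)
    finally show ?case by (simp add: mult_ac)
  qed
  moreover have "l - 2 + 2 = l" "Suc (l - 2) = l - 1" using l by linarith+
  ultimately have "a * b ^ (l - 1) \<le> card (L l)" by (metis order_refl)
  also have "card (L l) \<le> num_verts G"
    unfolding num_verts_def using LW W finite_verts by (intro card_mono) auto
  finally show ?thesis by simp
qed

lemma num_edges_le:
  assumes l: "2 \<le> l" and n: "num_verts G > 0"
  shows "num_edges G \<le> 4 * (k + 1) * real (num_verts G) powr (1 + 1 / l)"
proof (cases "num_edges G = 0")
  case False
  define n e N where "n = real (num_verts G)" and "e = real (num_edges G)" and "N = n powr (1 / l)"
  have n0: "n \<ge> 1" "e > 0" using n False by (auto simp: n_def e_def)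
  have N: "N ^ l = n" "N \<ge> 1" using n0 l by (auto simp: N_def powr_power ge_one_powr_ge_zero)
  have ind: "induced_edges G (verts G) = edges G"
    using simple by (auto simp: induced_edges_def simple_graph_def)
  have "(\<Sum>v\<in>verts G. e / (2 * n)) = e / 2"
    using n0 by (simp add: n_def num_verts_def)
  also have "\<dots> < card (induced_edges G (verts G))" using n0 by (simp add: ind e_def num_edges_def)
  finally obtain W where W: "W \<subseteq> verts G" "W \<noteq> {}" "\<And>v. v \<in> W \<Longrightarrow> e / (2 * n) < card (nbrs G v \<inter> W)"
    using min_degree_subset[OF simple finite_verts] by metis
  define b where "b = e / (2 * n) - (2 * k + 1)"
  have "b \<le> N"
  proof (rule ccontr)
    assume "\<not> b \<le> N"
    then have b: "b > N" by simp
    have "b * b ^ (l - 1) \<le> num_verts G"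
    proof (rule power_le_card_verts[OF W(1,2) l, of "verts G"])
      show "e \<inter> verts G \<noteq> {}" if "e \<in> edges G" "e \<subseteq> W" for e
        using that simple W(1) by (auto simp: simple_graph_def card_2_iff)
    qed (use W(3) N b in \<open>auto simp: b_def intro: less_imp_le\<close>)
    then have "b ^ l \<le> n" using l by (simp add: n_def flip: power_Suc)
    then show False using power_strict_mono[OF b, of l] N l by simp
  qed
  then have "e / (2 * n) \<le> N + (2 * k + 1)" by (simp add: b_def)
  also have "\<dots> \<le> N + (2 * k + 1) * N" using N by (intro add_left_mono) auto
  finally have "e \<le> (2 * k + 2) * N * (2 * n)" using n0 by (simp add: field_simps)
  also have "\<dots> = 4 * (k + 1) * (n powr 1 * N)" using n0 by (simp add: algebra_simps)
  also have "n powr 1 * N = n powr (1 + 1 / l)" unfolding N_def by (rule powr_add[symmetric])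
  finally show ?thesis by (simp add: e_def n_def)
qed simp

lemma card_edges_meeting:
  fixes a b :: real
  assumes l: "2 \<le> l" and S: "S \<subseteq> verts G" "S \<noteq> {}"
    and e: "e = real (card {E \<in> edges G. E \<inter> S \<noteq> {}})" "e > 0"
    and b: "b = e / (4 * num_verts G) - (2 * k + 1)" "b \<ge> 0"
    and a: "a = e / (4 * card S) - (2 * k + 1)"
  shows "a * b ^ (l - 1) \<le> num_verts G"
proof -
  let ?J = "\<lparr>verts = verts G, edges = {E \<in> edges G. E \<inter> S \<noteq> {}}\<rparr>"
  interpret J: cycle_free ?J l k
    by (rule cycle_free_subgraph) (use simple in \<open>auto simp: simple_graph_def\<close>)
  have fS: "finite S" using S finite_verts finite_subset by blast
  have cS: "0 < card S" "card S \<le> num_verts G"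
    using S fS finite_verts by (auto simp: card_gt_0_iff num_verts_def card_mono)
  define \<tau> where "\<tau> v = (if v \<in> S then e / (4 * card S) else e / (4 * num_verts G))" for v
  have ind: "induced_edges ?J (verts G) = {E \<in> edges G. E \<inter> S \<noteq> {}}"
    using simple by (auto simp: induced_edges_def simple_graph_def)
  have "(\<Sum>v\<in>verts G. \<tau> v) = card S * (e / (4 * card S)) + card (verts G - S) * (e / (4 * num_verts G))"
    using finite_verts S by (simp add: \<tau>_def sum.If_cases Int_absorb1 Diff_eq)
  also have "\<dots> \<le> card S * (e / (4 * card S)) + num_verts G * (e / (4 * num_verts G))"
    using finite_verts e(2) by (intro add_left_mono mult_right_mono) (auto simp: num_verts_def card_mono)
  also have "\<dots> < e" using cS e(2) by simp
  also have "e = card (induced_edges ?J (verts G))" by (simp add: ind e)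
  finally have "(\<Sum>v\<in>verts G. \<tau> v) < card (induced_edges ?J (verts G))" .
  from min_degree_subset[OF J.simple finite_verts this]
  obtain W where W: "W \<subseteq> verts G" "W \<noteq> {}" "\<And>v. v \<in> W \<Longrightarrow> \<tau> v < card (nbrs ?J v \<inter> W)"
    by blast
  have "a * b ^ (l - 1) \<le> num_verts ?J"
  proof (rule J.power_le_card_verts[of W S])
    show "b \<le> a" unfolding a b using cS e(2) by (simp add: frac_le)
    show "a + (2 * k + 1) \<le> card (nbrs ?J u \<inter> W)" if "u \<in> W \<inter> S" for u
      using W(3)[of u] that by (simp add: \<tau>_def a)
    show "b + (2 * k + 1) \<le> card (nbrs ?J u \<inter> W)" if "u \<in> W - S" for u
      using W(3)[of u] that by (simp add: \<tau>_def b)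
  qed (use W b l in auto)
  then show ?thesis by (simp add: num_verts_def)
qed

end

lemma power_diff_le:
  fixes x y X :: real
  assumes "0 \<le> y" "y \<le> x" "x \<le> X"
  shows "x ^ Suc m - y ^ Suc m \<le> Suc m * X ^ m * (x - y)"
proof (induction m)
  case (Suc m)
  have "x ^ Suc (Suc m) - y ^ Suc (Suc m) = x * (x ^ Suc m - y ^ Suc m) + y ^ Suc m * (x - y)"
    by (simp add: algebra_simps)
  also have "x * (x ^ Suc m - y ^ Suc m) \<le> X * (Suc m * X ^ m * (x - y))"
    using assms Suc power_mono[of y x "Suc m"] by (intro mult_mono) auto
  also have "y ^ Suc m * (x - y) \<le> X ^ Suc m * (x - y)"
    using assms by (intro mult_right_mono power_mono) auto
  finally show ?case by (simp add: algebra_simps)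
qed simp

theorem bipartite_subgraph:
  fixes \<epsilon> :: real
  assumes l: "2 \<le> l" and k: "odd k" "k > 2 * l" and \<epsilon>: "\<epsilon> > 0"
  obtains n\<^sub>0 where "\<And>G :: 'a sgraph. \<lbrakk>simple_graph G; family_free (even_cycles l \<union> {cycle_graph k}) G;
      num_verts G \<ge> n\<^sub>0\<rbrakk> \<Longrightarrow>
      \<exists>H. is_subgraph H G \<and> is_bipartite H \<and>
        average_degree G ^ (l + 1) - \<epsilon> * real (num_verts G) powr (1 + 1 / l) \<le> num_edges H"
proof -
  define c where "c = real (2 * k + 1)"
  define C where "C = real (4 * (k + 1))"
  define \<eta> where "\<eta> = \<epsilon> / (4 * Suc l * (2 * C) ^ l)"
  define K where "K = (16 * C / \<eta>) * (8 / \<eta>) ^ (l - 1) + 1"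
  define B where "B = (l + 1) * c * K ^ l"
  have pos1: "c > 0" "C > 0" by (simp_all add: c_def C_def)
  then have pos2: "\<eta> > 0" using \<epsilon> by (simp add: \<eta>_def)
  then have pos3: "K \<ge> 1" using pos1 by (simp add: K_def)
  then have "B > 0" using pos1 by (simp add: B_def)
  note pos = pos1 pos2 pos3 this
  have "filterlim (\<lambda>n::nat. real n powr (1 / l)) at_top sequentially"
    using l by real_asymp
  then have "eventually (\<lambda>n::nat. real n powr (1 / l) \<ge> max (max (8 * c / \<eta>) (16 * C * c / \<eta>)) (max 1 (2 * B / \<epsilon>))) sequentially"
    unfolding filterlim_at_top by blast
  then obtain n0 where n0: "\<And>n. n \<ge> n0 \<Longrightarrow> real n powr (1 / l) \<ge> max (max (8 * c / \<eta>) (16 * C * c / \<eta>)) (max 1 (2 * B / \<epsilon>))"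
    unfolding eventually_sequentially by blast
  show ?thesis
  proof (rule that[of n0])
    fix G :: "'a sgraph"
    assume G: "simple_graph G" "family_free (even_cycles l \<union> {cycle_graph k}) G" "num_verts G \<ge> n0"
    interpret cycle_free G l k using G k by unfold_locales
    define n N d where "n = real (num_verts G)" and "N = n powr (1 / l)" and "d = average_degree G"
    have N: "N \<ge> 8 * c / \<eta>" "N \<ge> 16 * C * c / \<eta>" "N \<ge> 1" "N \<ge> 2 * B / \<epsilon>"
      using n0[OF G(3)] by (auto simp: N_def n_def)
    have n_pos: "n > 0" using N(3) unfolding N_def by (cases "n = 0") (auto simp: n_def)
    have n1: "num_verts G > 0" using n_pos by (simp add: n_def)
    have Nl: "N ^ l = n" using n_pos l by (simp add: N_def powr_power)
    have nN: "n powr (1 + 1 / l) = n * N" using n_pos by (simp add: N_def powr_add)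
    have e_le: "num_edges G \<le> C * (n * N)"
      using num_edges_le[OF l n1] by (simp add: n_def[symmetric] nN C_def)
    have d_eq: "d = 2 * num_edges G / n" by (simp add: d_def n_def average_degree_eq[OF simple])
    have d_le: "d \<le> 2 * C * N"
      using e_le n_pos by (simp add: d_eq field_simps)
    define S where "S = {u \<in> verts G. card (nbrs G u) > K * N}"
    define ES where "ES = {E \<in> edges G. E \<inter> S \<noteq> {}}"
    have SV: "S \<subseteq> verts G" by (auto simp: S_def)
    have fS: "finite S" using SV finite_verts finite_subset by blast
    have fE: "finite (edges G)" by (rule simple_graph_finite_edges[OF simple])
    have S_le: "card S * K \<le> 2 * C * n"
    proof -
      have "card S * (K * N) \<le> (\<Sum>u\<in>S. real (card (nbrs G u)))"
        using sum_bounded_below[of S "K * N" "\<lambda>u. real (card (nbrs G u))"] by (simp add: S_def)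
      also have "\<dots> \<le> (\<Sum>u\<in>verts G. real (card (nbrs G u)))"
        using SV finite_verts by (intro sum_mono2) auto
      also have "\<dots> = 2 * num_edges G"
        using sum_degree[OF simple] by (simp add: vertex_degree_eq_card_nbrs[OF simple] flip: of_nat_sum)
      also have "\<dots> \<le> 2 * (C * (n * N))" using e_le by simp
      finally show ?thesis using N(3) by simp
    qed
    have ES_le: "card ES \<le> \<eta> * (n * N)"
    proof (rule ccontr)
      assume "\<not> ?thesis"
      then have big: "card ES > \<eta> * (n * N)" by simp
      moreover have "\<eta> * (n * N) > 0" using pos n_pos N(3) by simp
      ultimately have e0: "real (card ES) > 0" by linarith
      have "S \<noteq> {}" using e0 by (auto simp: ES_def)
      then have cS: "card S > 0" using fS by (simp add: card_gt_0_iff)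
      define a b where "a = real (card ES) / (4 * card S) - c" and "b = card ES / (4 * num_verts G) - c"
      have "\<eta> * N / 4 \<le> card ES / (4 * num_verts G)"
        using big n_pos by (simp add: n_def field_simps)
      moreover have "\<eta> * N / 8 \<ge> c" using N(1) pos by (simp add: field_simps)
      ultimately have b_ge: "b \<ge> \<eta> * N / 8" by (simp add: b_def)
      have b0: "\<eta> * N / 8 > 0" "b \<ge> 0"
      proof -
        show "\<eta> * N / 8 > 0" using pos N(3) by simp
        then show "b \<ge> 0" using b_ge by linarith
      qed
      have "\<eta> * K / (8 * C) * N \<le> card ES / (4 * card S)"
      proof -
        have "\<eta> * K / (8 * C) * N * (4 * card S) = \<eta> * N / (2 * C) * (card S * K)" using pos by (simp add: field_simps)
        also have "\<dots> \<le> \<eta> * N / (2 * C) * (2 * C * n)" using S_le pos N(3) by (intro mult_left_mono) auto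
        also have "\<dots> = \<eta> * (n * N)" using pos by simp
        also have "\<dots> \<le> card ES" using big by simp
        finally show ?thesis using cS by (simp add: pos_le_divide_eq)
      qed
      moreover have "\<eta> * K / (16 * C) * N \<ge> c"
      proof -
        have "c \<le> \<eta> / (16 * C) * N" using N(2) pos by (simp add: field_simps)
        also have "\<dots> \<le> \<eta> / (16 * C) * N * K"
          using mult_left_mono[of 1 K "\<eta> / (16 * C) * N"] pos N(3) by simp
        finally show ?thesis by (simp add: mult_ac)
      qed
      ultimately have a_ge: "a \<ge> \<eta> * K / (16 * C) * N" by (simp add: a_def)
      have "K > (16 * C / \<eta>) * (8 / \<eta>) ^ (l - 1)" by (simp add: K_def)
      moreover have "\<eta> / (16 * C) * (\<eta> / 8) ^ (l - 1) * ((16 * C / \<eta>) * (8 / \<eta>) ^ (l - 1)) = 1"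
        using pos by (simp add: power_divide)
      ultimately have "1 < \<eta> / (16 * C) * (\<eta> / 8) ^ (l - 1) * K"
        using pos by (metis mult_less_cancel_left_pos divide_pos_pos mult_pos_pos zero_less_numeral zero_less_power)
      from mult_strict_right_mono[OF this n_pos]
      have "n < \<eta> / (16 * C) * (\<eta> / 8) ^ (l - 1) * K * n" by simp
      also have "\<dots> = (\<eta> * K / (16 * C) * N) * (\<eta> * N / 8) ^ (l - 1)"
      proof -
        have "n = N * N ^ (l - 1)" using Nl l by (simp add: power_eq_if[of N l])
        then show ?thesis by (simp add: power_divide power_mult_distrib mult_ac)
      qed
      also have "\<dots> \<le> a * b ^ (l - 1)"
      proof (rule mult_mono[OF a_ge])
        show "(\<eta> * N / 8) ^ (l - 1) \<le> b ^ (l - 1)" using b_ge b0 by (intro power_mono) auto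
        have "0 \<le> \<eta> * K / (16 * C) * N" using pos N(3) by simp
        then show "0 \<le> a" using a_ge by linarith
      qed (use b0 in auto)
      also have "\<dots> \<le> num_verts G"
        by (rule card_edges_meeting[OF l SV \<open>S \<noteq> {}\<close>, of "card ES"])
          (use e0 b0 in \<open>auto simp: ES_def a_def b_def c_def\<close>)
      finally show False by (simp add: n_def)
    qed
    define G' where "G' = \<lparr>verts = verts G, edges = edges G - ES\<rparr>"
    interpret G': cycle_free G' l k
      unfolding G'_def by (rule cycle_free_subgraph) (use simple in \<open>auto simp: simple_graph_def\<close>)
    define d' where "d' = average_degree G'"
    have "num_edges G = num_edges G' + card ES"
    proof -
      have "ES \<subseteq> edges G" by (auto simp: ES_def)
      then show ?thesis using fE
        by (simp add: num_edges_def G'_def card_Diff_subset finite_subset card_mono)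
    qed
    moreover have "d' = 2 * num_edges G' / n"
      unfolding d'_def average_degree_eq[OF G'.simple] n_def by (simp add: G'_def num_verts_def)
    ultimately have dd: "d - d' = 2 * card ES / n"
      by (simp add: d_eq diff_divide_distrib[symmetric])
    have dd_le: "d - d' \<le> 2 * \<eta> * N" unfolding dd using ES_le n_pos by (simp add: field_simps)
    have dd_ge: "d' \<le> d" using dd n_pos by (metis diff_ge_0_iff_ge divide_nonneg_pos mult_nonneg_nonneg of_nat_0_le_iff zero_le_numeral)
    have deg: "real (card (nbrs G' u)) \<le> K * N" if u: "u \<in> verts G'" for u
    proof (cases "u \<in> S")
      case True
      then have "nbrs G' u = {}" by (auto simp: nbrs_def G'_def ES_def)
      then show ?thesis using pos N(3) by simp
    next
      case False
      have "card (nbrs G' u) \<le> card (nbrs G u)"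
        using finite_nbrs[OF simple] by (intro card_mono) (auto simp: nbrs_def G'_def)
      then show ?thesis using False u by (auto simp: S_def G'_def)
    qed
    have "verts G' \<noteq> {}" using n1 by (auto simp: G'_def num_verts_def)
    from G'.bipartite_subgraph_bounded_degree[OF this deg]
    obtain H where H: "is_subgraph H G'" "is_bipartite H"
      "d' ^ (l + 1) \<le> num_edges H + (l + 1) * (2 * k + 1) * (K * N) ^ l"
      unfolding d'_def by blast
    have "is_subgraph H G" using H(1) by (auto simp: is_subgraph_def G'_def)
    moreover have "d ^ (l + 1) - \<epsilon> * n powr (1 + 1 / l) \<le> num_edges H"
    proof -
      have "d ^ Suc l - d' ^ Suc l \<le> Suc l * (2 * C * N) ^ l * (d - d')"
        by (rule power_diff_le) (use dd_ge d_le average_degree_nonneg in \<open>auto simp: d'_def\<close>)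
      also have "\<dots> \<le> Suc l * (2 * C * N) ^ l * (2 * \<eta> * N)"
        using dd_le pos N(3) by (intro mult_left_mono) auto
      also have "\<dots> = (Suc l * (2 * C) ^ l * 2 * \<eta>) * (n * N)"
        by (simp add: power_mult_distrib Nl mult_ac)
      also have "Suc l * (2 * C) ^ l * 2 * \<eta> = (4 * Suc l * (2 * C) ^ l) * \<eta> / 2" by simp
      also have "(4 * Suc l * (2 * C) ^ l) * \<eta> = \<epsilon>" unfolding \<eta>_def using pos1 by simp
      finally have 1: "d ^ Suc l - d' ^ Suc l \<le> \<epsilon> / 2 * (n * N)" .
      have "(l + 1) * (2 * k + 1) * (K * N) ^ l = B * n"
        by (simp add: B_def c_def power_mult_distrib Nl algebra_simps)
      also have "B * n \<le> \<epsilon> / 2 * (n * N)"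
        using N(4) n_pos \<epsilon> by (simp add: field_simps)
      finally have "(l + 1) * (2 * k + 1) * (K * N) ^ l \<le> \<epsilon> / 2 * (n * N)" .
      with 1 H(3) show ?thesis unfolding nN by (simp add: field_simps)
    qed
    ultimately show "\<exists>H. is_subgraph H G \<and> is_bipartite H \<and>
        average_degree G ^ (l + 1) - \<epsilon> * real (num_verts G) powr (1 + 1 / l) \<le> num_edges H"
      using H(2) unfolding d_def n_def by blast
  qed
qed

section \<open>Generalized polygons\<close>

subsection \<open>Vandermonde systems modulo a prime\<close>

lemma vandermonde2_mod:
  fixes P :: int
  assumes P: "prime P" and a: "\<not> P dvd a0 - a1"
    and E: "P dvd d0 + d1" "P dvd d0 * a0 + d1 * a1"
  shows "P dvd d0"
proof -
  have "d0 * (a0 - a1) = (d0 * a0 + d1 * a1) - a1 * (d0 + d1)" by algebra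
  then have "P dvd d0 * (a0 - a1)" using E by (metis dvd_diff dvd_mult)
  then show ?thesis using P a prime_dvd_mult_iff by blast
qed

lemma vandermonde3_mod:
  fixes P :: int
  assumes P: "prime P" and a: "\<not> P dvd a0 - a1" "\<not> P dvd a0 - a2"
    and E: "P dvd d0 + d1 + d2" "P dvd d0 * a0 + d1 * a1 + d2 * a2"
      "P dvd d0 * a0 ^ 2 + d1 * a1 ^ 2 + d2 * a2 ^ 2"
  shows "P dvd d0"
proof -
  have "d0 * ((a0 - a1) * (a0 - a2)) = (d0 * a0 ^ 2 + d1 * a1 ^ 2 + d2 * a2 ^ 2)
      - (a1 + a2) * (d0 * a0 + d1 * a1 + d2 * a2) + a1 * a2 * (d0 + d1 + d2)" by algebra
  then have "P dvd d0 * ((a0 - a1) * (a0 - a2))"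
    using E by (metis dvd_diff dvd_mult dvd_add)
  then show ?thesis using P a prime_dvd_mult_iff by blast
qed

lemma vandermonde4_mod:
  fixes P :: int
  assumes P: "prime P" and a: "\<not> P dvd a0 - a1" "\<not> P dvd a0 - a2" "\<not> P dvd a0 - a3"
    and E: "P dvd d0 + d1 + d2 + d3" "P dvd d0 * a0 + d1 * a1 + d2 * a2 + d3 * a3"
      "P dvd d0 * a0 ^ 2 + d1 * a1 ^ 2 + d2 * a2 ^ 2 + d3 * a3 ^ 2"
      "P dvd d0 * a0 ^ 3 + d1 * a1 ^ 3 + d2 * a2 ^ 3 + d3 * a3 ^ 3"
  shows "P dvd d0"
proof -
  have "d0 * ((a0 - a1) * (a0 - a2) * (a0 - a3)) = (d0 * a0 ^ 3 + d1 * a1 ^ 3 + d2 * a2 ^ 3 + d3 * a3 ^ 3)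
      - (a1 + a2 + a3) * (d0 * a0 ^ 2 + d1 * a1 ^ 2 + d2 * a2 ^ 2 + d3 * a3 ^ 2)
      + (a1 * a2 + a1 * a3 + a2 * a3) * (d0 * a0 + d1 * a1 + d2 * a2 + d3 * a3)
      - a1 * a2 * a3 * (d0 + d1 + d2 + d3)" by algebra
  then have "P dvd d0 * ((a0 - a1) * (a0 - a2) * (a0 - a3))"
    using E by (metis dvd_diff dvd_mult dvd_add)
  then show ?thesis using P a prime_dvd_mult_iff by blast
qed

text \<open>
  A solution of the Vandermonde system is proportional to \<open>d\<^sub>i = t / \<Prod>\<^bsub>j \<noteq> i\<^esub> (a\<^sub>i - a\<^sub>j)\<close>, for which
  the quadratic form equals \<open>2 t\<^sup>2 / \<Prod>\<^sub>i (a\<^bsub>i+2\<^esub> - a\<^sub>i)\<close> with cyclic indices.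
\<close>

lemma pentagon_form_mod:
  fixes P :: int
  assumes P: "prime P" "\<not> P dvd 2"
    and a: "\<not> P dvd a1 - a0" "\<not> P dvd a2 - a0" "\<not> P dvd a3 - a0" "\<not> P dvd a4 - a0" "\<not> P dvd a2 - a1"
      "\<not> P dvd a3 - a1" "\<not> P dvd a4 - a1" "\<not> P dvd a3 - a2" "\<not> P dvd a4 - a2" "\<not> P dvd a4 - a3"
    and d4: "\<not> P dvd d4"
    and E: "P dvd d0 + d1 + d2 + d3 + d4" "P dvd d0 * a0 + d1 * a1 + d2 * a2 + d3 * a3 + d4 * a4"
      "P dvd d0 * a0 ^ 2 + d1 * a1 ^ 2 + d2 * a2 ^ 2 + d3 * a3 ^ 2 + d4 * a4 ^ 2"
      "P dvd d0 * a0 ^ 3 + d1 * a1 ^ 3 + d2 * a2 ^ 3 + d3 * a3 ^ 3 + d4 * a4 ^ 3"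
  shows "\<not> P dvd d0 * d1 * (a1 - a0) ^ 3 + d0 * d2 * (a2 - a0) ^ 3 + d0 * d3 * (a3 - a0) ^ 3 + d0 * d4 * (a4 - a0) ^ 3
    + d1 * d2 * (a2 - a1) ^ 3 + d1 * d3 * (a3 - a1) ^ 3 + d1 * d4 * (a4 - a1) ^ 3
    + d2 * d3 * (a3 - a2) ^ 3 + d2 * d4 * (a4 - a2) ^ 3 + d3 * d4 * (a4 - a3) ^ 3" (is "\<not> P dvd ?Q")
proof
  assume Q: "P dvd ?Q"
  define b x y z where "b = a1 - a0" and "x = a2 - a1" and "y = a3 - a2" and "z = a4 - a3"
  have a_eq: "a1 = a0 + b" "a2 = a0 + b + x" "a3 = a0 + b + x + y" "a4 = a0 + b + x + y + z"
    by (simp_all add: b_def x_def y_def z_def)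
  define h1 h2 h3 h4 where "h1 = d1 * b" and "h2 = d2 * (b + x)" and "h3 = d3 * (b + x + y)"
    and "h4 = d4 * (b + x + y + z)"
  note pm = prime_dvd_mult_iff[OF P(1)]
  have nd: "\<not> P dvd b" "\<not> P dvd b + x" "\<not> P dvd b + x + y" "\<not> P dvd b + x + y + z" "\<not> P dvd x"
    "\<not> P dvd x + y" "\<not> P dvd x + y + z" "\<not> P dvd y" "\<not> P dvd y + z" "\<not> P dvd z"
    using a by (simp_all add: a_eq add.assoc algebra_simps)
  have F3: "P dvd h1 * b ^ 2 + h2 * (b + x) ^ 2 + h3 * (b + x + y) ^ 2 + h4 * (b + x + y + z) ^ 2" (is "P dvd ?F3")
  proof -
    have "?F3 = (d0 * a0 ^ 3 + d1 * a1 ^ 3 + d2 * a2 ^ 3 + d3 * a3 ^ 3 + d4 * a4 ^ 3)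
      - 3 * a0 * (d0 * a0 ^ 2 + d1 * a1 ^ 2 + d2 * a2 ^ 2 + d3 * a3 ^ 2 + d4 * a4 ^ 2)
      + 3 * a0 ^ 2 * (d0 * a0 + d1 * a1 + d2 * a2 + d3 * a3 + d4 * a4)
      - a0 ^ 3 * (d0 + d1 + d2 + d3 + d4)" unfolding a_eq h1_def h2_def h3_def h4_def by algebra
    then show ?thesis using E by (metis dvd_diff dvd_mult dvd_add)
  qed
  have F2: "P dvd h1 * b + h2 * (b + x) + h3 * (b + x + y) + h4 * (b + x + y + z)" (is "P dvd ?F2")
  proof -
    have "?F2 = (d0 * a0 ^ 2 + d1 * a1 ^ 2 + d2 * a2 ^ 2 + d3 * a3 ^ 2 + d4 * a4 ^ 2)
      - 2 * a0 * (d0 * a0 + d1 * a1 + d2 * a2 + d3 * a3 + d4 * a4)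
      + a0 ^ 2 * (d0 + d1 + d2 + d3 + d4)" unfolding a_eq h1_def h2_def h3_def h4_def by algebra
    then show ?thesis using E by (metis dvd_diff dvd_mult dvd_add)
  qed
  have F1: "P dvd h1 + h2 + h3 + h4" (is "P dvd ?F1")
  proof -
    have "?F1 = (d0 * a0 + d1 * a1 + d2 * a2 + d3 * a3 + d4 * a4)
      - a0 * (d0 + d1 + d2 + d3 + d4)" unfolding a_eq h1_def h2_def h3_def h4_def by algebra
    then show ?thesis using E by (metis dvd_diff dvd_mult)
  qed
  have "coprime (x * y * (x + y)) P"
    using nd P(1) by (simp add: pm prime_imp_coprime coprime_commute)
  then obtain s where s: "[x * y * (x + y) * s = h4] (mod P)"
    using cong_solve_dvd_int[of "x * y * (x + y)" P h4] by (auto simp: coprime_iff_gcd_eq_1)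
  then have e4: "P dvd h4 - s * (x * y * (x + y))" by (metis cong_iff_dvd_diff cong_sym mult.commute)
  have cancel: "P dvd u" if "P dvd c * u" "\<not> P dvd c" for c u using that pm by blast
  have e3: "P dvd h3 + s * (x * (x + y + z) * (y + z))"
  proof (rule cancel[of "(x + y) * y"])
    have "(x + y) * y * (h3 + s * (x * (x + y + z) * (y + z))) = ?F3 - (b + (b + x)) * ?F2 + b * (b + x) * ?F1
      - (x + y + z) * (y + z) * (h4 - s * (x * y * (x + y)))" by algebra
    then show "P dvd (x + y) * y * (h3 + s * (x * (x + y + z) * (y + z)))"
      using F1 F2 F3 e4 by (metis dvd_diff dvd_mult dvd_add)
  qed (use nd pm in auto)
  have e2: "P dvd h2 - s * ((x + y) * (x + y + z) * z)"
  proof (rule cancel[of "- (x * y)"])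
    have "- (x * y) * (h2 - s * ((x + y) * (x + y + z) * z)) = ?F3 - (b + (b + x + y)) * ?F2 + b * (b + x + y) * ?F1
      - (x + y + z) * z * (h4 - s * (x * y * (x + y)))" by algebra
    then show "P dvd - (x * y) * (h2 - s * ((x + y) * (x + y + z) * z))"
      using F1 F2 F3 e4 by (metis dvd_diff dvd_mult dvd_add)
  qed (use nd pm in auto)
  have e1: "P dvd h1 + s * (y * z * (y + z))"
  proof (rule cancel[of "x * (x + y)"])
    have "x * (x + y) * (h1 + s * (y * z * (y + z))) = ?F3 - ((b + x) + (b + x + y)) * ?F2 + (b + x) * (b + x + y) * ?F1
      - (y + z) * z * (h4 - s * (x * y * (x + y)))" by algebra
    then show "P dvd x * (x + y) * (h1 + s * (y * z * (y + z)))"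
      using F1 F2 F3 e4 by (metis dvd_diff dvd_mult dvd_add)
  qed (use nd pm in auto)
  define g1 g2 g3 g4 where "g1 = - (y * z * (y + z))" and "g2 = (x + y) * (x + y + z) * z"
    and "g3 = - (x * (x + y + z) * (y + z))" and "g4 = x * y * (x + y)"
  have c: "[h1 = s * g1] (mod P)" "[h2 = s * g2] (mod P)" "[h3 = s * g3] (mod P)" "[h4 = s * g4] (mod P)"
    using e1 e2 e3 e4 by (simp_all add: cong_iff_dvd_diff g1_def g2_def g3_def g4_def)
  let ?R = "\<lambda>h1 h2 h3 h4. h1 * h2 * (x ^ 3 * (b + x + y) * (b + x + y + z))
    + h1 * h3 * ((x + y) ^ 3 * (b + x) * (b + x + y + z))
    + h1 * h4 * ((x + y + z) ^ 3 * (b + x) * (b + x + y)) + h2 * h3 * (y ^ 3 * b * (b + x + y + z))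
    + h2 * h4 * ((y + z) ^ 3 * b * (b + x + y)) + h3 * h4 * (z ^ 3 * b * (b + x))"
  have R: "b * (b + x) * (b + x + y) * (b + x + y + z) * ?Q = ?R h1 h2 h3 h4
     + b * (b + x) * (b + x + y) * (b + x + y + z) * d0 * ?F3"
    unfolding a_eq h1_def h2_def h3_def h4_def by algebra
  have "P dvd ?R h1 h2 h3 h4"
    using R Q F3 by (metis dvd_add_left_iff dvd_mult)
  moreover have "[?R h1 h2 h3 h4 = ?R (s * g1) (s * g2) (s * g3) (s * g4)] (mod P)"
    by (intro cong_add cong_mult c cong_refl)
  ultimately have "P dvd ?R (s * g1) (s * g2) (s * g3) (s * g4)" by (metis cong_dvd_iff)
  also have "?R (s * g1) (s * g2) (s * g3) (s * g4)
      = 2 * s * s * x * x * y * y * z * z * (x + y) * (y + z) * (x + y + z) * b * (b + x + y + z)"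
    unfolding g1_def g2_def g3_def g4_def by algebra
  finally have "P dvd s" using nd P by (auto simp: pm)
  then have "P dvd h4" using e4 by (metis dvd_diff_left_iff dvd_mult2 dvd_def)
  then show False using d4 nd by (auto simp: h4_def pm)
qed

subsection \<open>Closed walks in algebraically defined graphs\<close>

definition cyc_prev :: "nat \<Rightarrow> nat \<Rightarrow> nat" where
  "cyc_prev m i = (if i = 0 then m - 1 else i - 1)"

lemma sum_cyc_prev:
  fixes h :: "nat \<Rightarrow> 'b :: comm_monoid_add"
  assumes "m > 0"
  shows "(\<Sum>i<m. h (cyc_prev m i)) = (\<Sum>i<m. h i)"
proof -
  obtain m' where m: "m = Suc m'" using assms by (cases m) auto
  show ?thesis unfolding m by (subst sum.lessThan_Suc_shift) (simp add: cyc_prev_def add.commute)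
qed

locale closed_walk =
  fixes P :: int and m :: nat and a k :: "nat \<Rightarrow> int" and R :: "nat set" and pc lc :: "nat \<Rightarrow> nat \<Rightarrow> int"
  assumes m: "m > 0"
    and inc: "\<And>r i. \<lbrakk>r \<in> R; i < m\<rbrakk> \<Longrightarrow> P dvd pc r i + lc r i - a i ^ r * k i"
    and inc': "\<And>r i. \<lbrakk>r \<in> R; i < m\<rbrakk> \<Longrightarrow> P dvd pc r i + lc r (cyc_prev m i) - a i ^ r * k (cyc_prev m i)"
begin

definition "d i = k i - k (cyc_prev m i)"
definition "C r i = (if r = 0 then k i else lc r i)"

lemma step: "\<lbrakk>r \<in> insert 0 R; i < m\<rbrakk> \<Longrightarrow> P dvd C r i - C r (cyc_prev m i) - d i * a i ^ r"
proof (cases "r = 0")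
  case False
  assume "r \<in> insert 0 R" "i < m"
  then have r: "r \<in> R" "i < m" using False by auto
  have "P dvd (pc r i + lc r i - a i ^ r * k i)
      - (pc r i + lc r (cyc_prev m i) - a i ^ r * k (cyc_prev m i))"
    by (rule dvd_diff[OF inc[OF r] inc'[OF r]])
  then show ?thesis using False by (simp add: C_def d_def algebra_simps)
qed (simp add: C_def d_def)

lemma moment: "r \<in> insert 0 R \<Longrightarrow> P dvd (\<Sum>i<m. d i * a i ^ r)"
proof -
  assume r: "r \<in> insert 0 R"
  have "P dvd (\<Sum>i<m. C r i - C r (cyc_prev m i) - d i * a i ^ r)"
    using step[OF r] by (intro dvd_sum) auto
  then show ?thesis using sum_cyc_prev[OF m, of "C r"] by (simp add: sum_subtractf)
qed

lemma partial_sum: "\<lbrakk>r \<in> insert 0 R; i < m\<rbrakk> \<Longrightarrow> P dvd C r i - C r (m - 1) - (\<Sum>j\<le>i. d j * a j ^ r)"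
proof (induction i)
  case 0
  then show ?case using step[of r 0] by (simp add: cyc_prev_def)
next
  case (Suc i)
  then have "P dvd (C r i - C r (m - 1) - (\<Sum>j\<le>i. d j * a j ^ r)) + (C r (Suc i) - C r i - d (Suc i) * a (Suc i) ^ r)"
    using step[of r "Suc i"] by (intro dvd_add) (auto simp: cyc_prev_def)
  then show ?case by (simp add: algebra_simps)
qed

lemma quadratic_form:
  assumes R: "{1, 2, 3} \<subseteq> R"
    and B: "\<And>i. B i = 3 * a i ^ 2 * pc 1 i - 3 * a i * pc 2 i + pc 3 i"
    and w: "\<And>i. i < m \<Longrightarrow> P dvd w i + W i - k i * B i"
      "\<And>i. i < m \<Longrightarrow> P dvd w i + W (cyc_prev m i) - k (cyc_prev m i) * B i"
  shows "P dvd (\<Sum>i<m. \<Sum>j\<le>i. d i * d j * (a i - a j) ^ 3)"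
proof -
  have dB: "P dvd (\<Sum>i<m. d i * B i)"
  proof -
    have "P dvd (\<Sum>i<m. (w i + W i - k i * B i) - (w i + W (cyc_prev m i) - k (cyc_prev m i) * B i))"
      by (intro dvd_sum dvd_diff[OF w]) auto
    also have "(\<Sum>i<m. (w i + W i - k i * B i) - (w i + W (cyc_prev m i) - k (cyc_prev m i) * B i))
      = (\<Sum>i<m. W i - W (cyc_prev m i) - d i * B i)"
      by (intro sum.cong) (auto simp: d_def algebra_simps)
    finally show ?thesis using sum_cyc_prev[OF m, of W] by (simp add: sum_subtractf)
  qed
  define c where "c r = C r (m - 1)" for r
  define D where "D i = a i ^ 3 * c 0 - 3 * a i ^ 2 * c 1 + 3 * a i * c 2 - c 3" for i
  define q where "q r i = (\<Sum>j\<le>i. d j * a j ^ r)" for r i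
  have dD: "P dvd (\<Sum>i<m. d i * D i)"
  proof -
    have "(\<Sum>i<m. d i * D i) = c 0 * (\<Sum>i<m. d i * a i ^ 3) - 3 * c 1 * (\<Sum>i<m. d i * a i ^ 2)
        + 3 * c 2 * (\<Sum>i<m. d i * a i ^ 1) - c 3 * (\<Sum>i<m. d i * a i ^ 0)"
      by (simp add: D_def sum_distrib_left algebra_simps sum.distrib sum_subtractf)
    moreover have M: "P dvd (\<Sum>i<m. d i * a i ^ r)" if "r \<in> {0, 1, 2, 3}" for r
      using moment R that by blast
    ultimately show ?thesis by (simp only:) (intro dvd_diff dvd_add dvd_mult M; simp only: insert_iff simp_thms)
  qed
  have "P dvd B i - D i - (\<Sum>j\<le>i. d j * (a i - a j) ^ 3)" if i: "i < m" for i
  proof -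
    have S: "(\<Sum>j\<le>i. d j * (a i - a j) ^ 3) = a i ^ 3 * q 0 i - 3 * a i ^ 2 * q 1 i + 3 * a i * q 2 i - q 3 i"
      by (simp add: q_def sum_distrib_left power3_eq_cube power2_eq_square algebra_simps sum.distrib sum_subtractf)
    have inc: "P dvd pc r i + lc r i - a i ^ r * k i" if "r \<in> {1, 2, 3}" for r using inc i R that by auto
    have ps: "P dvd C r i - c r - q r i" if "r \<in> {0, 1, 2, 3}" for r
      using partial_sum[of r i] i R that unfolding c_def q_def by auto
    define u v where "u r = pc r i + lc r i - a i ^ r * k i" and "v r = C r i - c r - q r i" for r
    have "B i - D i - (\<Sum>j\<le>i. d j * (a i - a j) ^ 3)
       = 3 * a i ^ 2 * u 1 - 3 * a i * u 2 + u 3 + a i ^ 3 * v 0 - 3 * a i ^ 2 * v 1 + 3 * a i * v 2 - v 3"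
      unfolding S B D_def u_def v_def by (simp add: C_def power3_eq_cube power2_eq_square algebra_simps)
    moreover have "P dvd u 1" "P dvd u 2" "P dvd u 3" "P dvd v 0" "P dvd v 1" "P dvd v 2" "P dvd v 3"
      unfolding u_def v_def by (intro inc ps; simp)+
    ultimately show ?thesis by (simp only:) (intro dvd_diff dvd_add dvd_mult; simp only:)
  qed
  then have "P dvd (\<Sum>i<m. d i * (B i - D i - (\<Sum>j\<le>i. d j * (a i - a j) ^ 3)))"
    by (intro dvd_sum dvd_mult) auto
  also have "\<dots> = (\<Sum>i<m. d i * B i) - (\<Sum>i<m. d i * D i) - (\<Sum>i<m. \<Sum>j\<le>i. d i * d j * (a i - a j) ^ 3)"
    by (simp add: right_diff_distrib sum_subtractf sum_distrib_left mult.assoc)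
  finally show ?thesis using dvd_diff[OF dvd_diff[OF dB dD]] by fastforce
qed

end

lemma atMost_numeral: "{..numeral n :: nat} = insert (numeral n) {..pred_numeral n}"
  by (simp add: numeral_eq_Suc atMost_Suc)

lemmas unroll = lessThan_nat_numeral lessThan_Suc atMost_numeral atMost_Suc

lemma no_digon:
  assumes "closed_walk P 2 a k R pc lc" "prime P" "1 \<in> R"
    and "\<not> P dvd a 0 - a 1" "\<not> P dvd k 0 - k 1"
  shows False
proof -
  interpret closed_walk P 2 a k R pc lc by fact
  have d: "d 0 = k 0 - k 1" by (simp add: d_def cyc_prev_def)
  have "P dvd d 0"
    by (rule vandermonde2_mod[OF assms(2,4), of _ "d 1"])
      (use moment[of 0] moment[of 1] assms(3) in \<open>simp_all add: unroll add_ac\<close>)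
  then show False using assms(5) d by simp
qed

lemma no_triangle:
  assumes "closed_walk P 3 a k R pc lc" "prime P" "{1, 2} \<subseteq> R"
    and "\<not> P dvd a 0 - a 1" "\<not> P dvd a 0 - a 2" "\<not> P dvd k 0 - k 2"
  shows False
proof -
  interpret closed_walk P 3 a k R pc lc by fact
  have d: "d 0 = k 0 - k 2" by (simp add: d_def cyc_prev_def)
  have "P dvd d 0"
    by (rule vandermonde3_mod[OF assms(2,4,5), of _ "d 1" "d 2"])
      (use moment[of 0] moment[of 1] moment[of 2] assms(3) in \<open>simp_all add: unroll add_ac\<close>)
  then show False using assms(6) d by simp
qed

lemma no_quadrangle:
  assumes "closed_walk P 4 a k R pc lc" "prime P" "{1, 2, 3} \<subseteq> R" "\<not> P dvd 2"
    and B: "\<And>i. B i = 3 * a i ^ 2 * pc 1 i - 3 * a i * pc 2 i + pc 3 i"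
    and w: "\<And>i. i < 4 \<Longrightarrow> P dvd w i + W i - k i * B i"
      "\<And>i. i < 4 \<Longrightarrow> P dvd w i + W (cyc_prev 4 i) - k (cyc_prev 4 i) * B i"
    and dist: "\<And>i j. \<lbrakk>i < 4; j < 4\<rbrakk> \<Longrightarrow> a i = a j \<or> \<not> P dvd a i - a j"
    and a: "\<And>i. i < 4 \<Longrightarrow> a i \<noteq> a (cyc_prev 4 i)"
    and k: "\<And>i. i < 4 \<Longrightarrow> \<not> P dvd k i - k (cyc_prev 4 i)"
  shows False
proof -
  interpret closed_walk P 4 a k R pc lc by fact
  have d: "\<not> P dvd d i" if "i < 4" for i using k[OF that] by (simp add: d_def)
  have E: "P dvd d 0 + d 1 + d 2 + d 3" "P dvd d 0 * a 0 + d 1 * a 1 + d 2 * a 2 + d 3 * a 3"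
      "P dvd d 0 * a 0 ^ 2 + d 1 * a 1 ^ 2 + d 2 * a 2 ^ 2 + d 3 * a 3 ^ 2"
      "P dvd d 0 * a 0 ^ 3 + d 1 * a 1 ^ 3 + d 2 * a 2 ^ 3 + d 3 * a 3 ^ 3"
    using moment[of 0] moment[of 1] moment[of 2] moment[of 3] assms(3) by (simp_all add: unroll add_ac)
  have adj: "a 0 \<noteq> a 1" "a 1 \<noteq> a 2" "a 2 \<noteq> a 3" "a 3 \<noteq> a 0"
    using a[of 0] a[of 1] a[of 2] a[of 3] by (auto simp: cyc_prev_def)
  have nd: "\<not> P dvd a i - a j" if "a i \<noteq> a j" "i < 4" "j < 4" for i j using dist that by blast
  have 02: "a 0 = a 2"
  proof (rule ccontr)
    assume ne: "a 0 \<noteq> a 2"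
    have "P dvd d 0"
      by (rule vandermonde4_mod[OF assms(2) nd nd nd E]) (use adj ne in auto)
    then show False using d by simp
  qed
  have 13: "a 1 = a 3"
  proof (rule ccontr)
    assume ne: "a 1 \<noteq> a 3"
    have "P dvd d 1"
      by (rule vandermonde4_mod[OF assms(2), of "a 1" "a 0" "a 2" "a 3" "d 1" "d 0" "d 2" "d 3"])
        (use adj ne E nd in \<open>auto simp: add_ac\<close>)
    then show False using d by simp
  qed
  have n01: "\<not> P dvd a 0 - a 1" using nd adj by simp
  have 1: "P dvd d 0 + d 2"
    by (rule vandermonde2_mod[OF assms(2) n01, of _ "d 1 + d 3"])
      (use E(1,2) in \<open>simp_all add: 02[symmetric] 13[symmetric] algebra_simps\<close>)
  have n10: "\<not> P dvd a 1 - a 0" using nd adj by simp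
  have 2: "P dvd d 1 + d 3"
    by (rule vandermonde2_mod[OF assms(2) n10, of _ "d 0 + d 2"])
      (use E(1,2) in \<open>simp_all add: 02[symmetric] 13[symmetric] algebra_simps\<close>)
  have "P dvd (\<Sum>i<4. \<Sum>j\<le>i. d i * d j * (a i - a j) ^ 3)"
    using quadratic_form[OF assms(3) B w] by simp
  also have "\<dots> = (d 0 * d 1 - d 1 * d 2 + d 0 * d 3 + d 2 * d 3) * (a 1 - a 0) ^ 3"
    by (simp add: unroll 02[symmetric] 13[symmetric]) algebra
  also have "\<dots> = (d 0 + d 2) * (d 3 - d 1) * (a 1 - a 0) ^ 3 + 2 * (d 0 * d 1 * (a 1 - a 0) ^ 3)"
    by algebra
  finally have "P dvd 2 * (d 0 * d 1 * (a 1 - a 0) ^ 3)"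
    using 1 by (metis dvd_add_right_iff dvd_mult2)
  then have "P dvd a 1 - a 0" using assms(4) d[of 0] d[of 1]
    by (auto simp: prime_dvd_mult_iff[OF assms(2)] dest: prime_dvd_power[OF assms(2)])
  then show False using n10 by simp
qed

lemma pentagon_not_repeated:
  fixes P :: int
  assumes P: "prime P"
    and E: "P dvd d0 + d1 + d2 + d3 + d4" "P dvd d0 * a0 + d1 * a1 + d2 * a2 + d3 * a3 + d4 * a4"
      "P dvd d0 * a0 ^ 2 + d1 * a1 ^ 2 + d2 * a2 ^ 2 + d3 * a3 ^ 2 + d4 * a4 ^ 2"
      "P dvd d0 * a0 ^ 3 + d1 * a1 ^ 3 + d2 * a2 ^ 3 + d3 * a3 ^ 3 + d4 * a4 ^ 3"
    and nd: "\<And>x y. \<lbrakk>x \<in> {a0, a1, a2, a3, a4}; y \<in> {a0, a1, a2, a3, a4}; x \<noteq> y\<rbrakk> \<Longrightarrow> \<not> P dvd x - y"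
    and adj: "a0 \<noteq> a1" "a1 \<noteq> a2" "a2 \<noteq> a3" "a3 \<noteq> a4" "a4 \<noteq> a0"
    and d: "\<not> P dvd d1" "\<not> P dvd d3" "\<not> P dvd d4"
  shows "a0 \<noteq> a2"
proof
  assume eq: "a0 = a2"
  show False
  proof (cases "a1 = a3")
    case True
    have "P dvd d4"
      by (rule vandermonde3_mod[OF P, of a4 a0 a1 d4 "d0 + d2" "d1 + d3"])
        (use E adj eq True nd in \<open>simp_all add: algebra_simps\<close>)
    then show False using d by simp
  next
    case n13: False
    show False
    proof (cases "a1 = a4")
      case True
      have "P dvd d3"
        by (rule vandermonde3_mod[OF P, of a3 a0 a1 d3 "d0 + d2" "d1 + d4"])
          (use E adj eq True nd in \<open>simp_all add: algebra_simps\<close>)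
      then show False using d by simp
    next
      case False
      have "P dvd d1"
        by (rule vandermonde4_mod[OF P, of a1 a0 a3 a4 d1 "d0 + d2" d3 d4])
          (use E adj eq n13 False nd in \<open>simp_all add: algebra_simps\<close>)
      then show False using d by simp
    qed
  qed
qed

lemma no_pentagon:
  assumes "closed_walk P 5 a k R pc lc" "prime P" "{1, 2, 3} \<subseteq> R" "\<not> P dvd 2"
    and B: "\<And>i. B i = 3 * a i ^ 2 * pc 1 i - 3 * a i * pc 2 i + pc 3 i"
    and w: "\<And>i. i < 5 \<Longrightarrow> P dvd w i + W i - k i * B i"
      "\<And>i. i < 5 \<Longrightarrow> P dvd w i + W (cyc_prev 5 i) - k (cyc_prev 5 i) * B i"
    and dist: "\<And>i j. \<lbrakk>i < 5; j < 5\<rbrakk> \<Longrightarrow> a i = a j \<or> \<not> P dvd a i - a j"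
    and a: "\<And>i. i < 5 \<Longrightarrow> a i \<noteq> a (cyc_prev 5 i)"
    and k: "\<And>i. i < 5 \<Longrightarrow> \<not> P dvd k i - k (cyc_prev 5 i)"
  shows False
proof -
  interpret closed_walk P 5 a k R pc lc by fact
  have d: "\<not> P dvd d i" if "i < 5" for i using k[OF that] by (simp add: d_def)
  have E: "P dvd d 0 + d 1 + d 2 + d 3 + d 4" "P dvd d 0 * a 0 + d 1 * a 1 + d 2 * a 2 + d 3 * a 3 + d 4 * a 4"
      "P dvd d 0 * a 0 ^ 2 + d 1 * a 1 ^ 2 + d 2 * a 2 ^ 2 + d 3 * a 3 ^ 2 + d 4 * a 4 ^ 2"
      "P dvd d 0 * a 0 ^ 3 + d 1 * a 1 ^ 3 + d 2 * a 2 ^ 3 + d 3 * a 3 ^ 3 + d 4 * a 4 ^ 3"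
    using moment[of 0] moment[of 1] moment[of 2] moment[of 3] assms(3) by (simp_all add: unroll add_ac)
  have adj: "a 0 \<noteq> a 1" "a 1 \<noteq> a 2" "a 2 \<noteq> a 3" "a 3 \<noteq> a 4" "a 4 \<noteq> a 0"
    using a[of 0] a[of 1] a[of 2] a[of 3] a[of 4] by (auto simp: cyc_prev_def)
  have nd: "\<not> P dvd a i - a j" if "a i \<noteq> a j" "i < 5" "j < 5" for i j using dist that by blast
  have nd': "\<not> P dvd x - y" if x: "x \<in> {a 0, a 1, a 2, a 3, a 4}" and y: "y \<in> {a 0, a 1, a 2, a 3, a 4}" and "x \<noteq> y" for x y
  proof -
    obtain i where "i < 5" "x = a i" using x by (elim insertE emptyE) (force intro: that)+
    moreover obtain j where "j < 5" "y = a j" using y by (elim insertE emptyE) (force intro: that)+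
    ultimately show ?thesis using nd \<open>x \<noteq> y\<close> by blast
  qed
  have 02: "a 0 \<noteq> a 2"
    by (rule pentagon_not_repeated[OF assms(2) E nd' adj]) (use d in auto)
  have 13: "a 1 \<noteq> a 3"
    by (rule pentagon_not_repeated[OF assms(2), of "d 1" "d 2" "d 3" "d 4" "d 0" "a 1" "a 2" "a 3" "a 4" "a 0"])
      (use d E nd' adj in \<open>auto simp: add_ac\<close>)
  have 24: "a 2 \<noteq> a 4"
    by (rule pentagon_not_repeated[OF assms(2), of "d 2" "d 3" "d 4" "d 0" "d 1" "a 2" "a 3" "a 4" "a 0" "a 1"])
      (use d E nd' adj in \<open>auto simp: add_ac\<close>)
  have 30: "a 3 \<noteq> a 0"
    by (rule pentagon_not_repeated[OF assms(2), of "d 3" "d 4" "d 0" "d 1" "d 2" "a 3" "a 4" "a 0" "a 1" "a 2"])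
      (use d E nd' adj in \<open>auto simp: add_ac\<close>)
  have 41: "a 4 \<noteq> a 1"
    by (rule pentagon_not_repeated[OF assms(2), of "d 4" "d 0" "d 1" "d 2" "d 3" "a 4" "a 0" "a 1" "a 2" "a 3"])
      (use d E nd' adj in \<open>auto simp: add_ac\<close>)
  have "P dvd (\<Sum>i<5. \<Sum>j\<le>i. d i * d j * (a i - a j) ^ 3)"
    using quadratic_form[OF assms(3) B w] by simp
  moreover have "\<not> P dvd (\<Sum>i<5. \<Sum>j\<le>i. d i * d j * (a i - a j) ^ 3)"
    using pentagon_form_mod[OF assms(2,4) nd nd nd nd nd nd nd nd nd nd d E] adj 02 13 24 30 41
    by (simp add: unroll mult_ac add_ac)
  ultimately show False by blast
qed

subsection \<open>The polygon graphs\<close>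

type_synonym coord = "int \<times> int \<times> int \<times> int \<times> int"

definition crd :: "nat \<Rightarrow> coord \<Rightarrow> int" where
  "crd r c = (case c of (a, x, y, z, w) \<Rightarrow> [a, x, y, z, w] ! r)"

definition coords :: "nat \<Rightarrow> nat \<Rightarrow> coord set" where
  "coords l p = (let R = {0..<int p} in
     R \<times> R \<times> (if l \<ge> 3 then R else {0}) \<times> (if l \<ge> 5 then R else {0}) \<times> (if l \<ge> 5 then R else {0}))"

definition twist :: "coord \<Rightarrow> int" where
  "twist c = 3 * crd 0 c ^ 2 * crd 1 c - 3 * crd 0 c * crd 2 c + crd 3 c"

text \<open>
  For \<open>l = 5\<close> the last coordinate realises the symplectic form \<open>(a - b)\<^sup>3\<close> on binary cubics, as in
  the Heisenberg parabolic subgroup of \<open>G\<^sub>2\<close>.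
\<close>

definition line_through :: "nat \<Rightarrow> nat \<Rightarrow> int \<Rightarrow> coord \<Rightarrow> coord" where
  "line_through l p k c = (k, (crd 0 c * k - crd 1 c) mod int p,
     (if l \<ge> 3 then (crd 0 c ^ 2 * k - crd 2 c) mod int p else 0),
     (if l \<ge> 5 then (crd 0 c ^ 3 * k - crd 3 c) mod int p else 0),
     (if l \<ge> 5 then (k * twist c - crd 4 c) mod int p else 0))"

definition polygon_graph :: "nat \<Rightarrow> nat \<Rightarrow> (coord + coord) sgraph" where
  "polygon_graph l p = \<lparr>verts = Inl ` coords l p \<union> Inr ` coords l p,
     edges = (\<lambda>(k, c). {Inl c, Inr (line_through l p k c)}) ` ({0..<int p} \<times> coords l p)\<rparr>"

definition on_line :: "nat \<Rightarrow> nat \<Rightarrow> coord \<Rightarrow> coord \<Rightarrow> bool" where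
  "on_line l p c e \<longleftrightarrow> c \<in> coords l p \<and> e \<in> coords l p \<and> e = line_through l p (crd 0 e) c"

lemma crd_simps [simp]:
  "crd 0 (a, x, y, z, w) = a" "crd (Suc 0) (a, x, y, z, w) = x" "crd 1 (a, x, y, z, w) = x" "crd 2 (a, x, y, z, w) = y"
  "crd 3 (a, x, y, z, w) = z" "crd 4 (a, x, y, z, w) = w"
  by (simp_all add: crd_def)

lemma finite_coords: "finite (coords l p)"
  by (simp add: coords_def Let_def)

lemma card_coords: "l \<in> {2, 3, 5} \<Longrightarrow> card (coords l p) = p ^ l"
  by (auto simp: coords_def Let_def card_cartesian_product power_numeral_reduce)

lemma line_through_in_coords:
  assumes "c \<in> coords l p" "k \<in> {0..<int p}"
  shows "line_through l p k c \<in> coords l p"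
  using assms by (auto simp: coords_def line_through_def Let_def)

lemma crd0_line_through [simp]: "crd 0 (line_through l p k c) = k"
  by (simp add: line_through_def)

lemma polygon_graph_edge_iff:
  "e \<in> edges (polygon_graph l p) \<longleftrightarrow> (\<exists>c e'. e = {Inl c, Inr e'} \<and> on_line l p c e')"
proof
  assume "e \<in> edges (polygon_graph l p)"
  then obtain k c where "k \<in> {0..<int p}" "c \<in> coords l p" "e = {Inl c, Inr (line_through l p k c)}"
    by (auto simp: polygon_graph_def)
  then show "\<exists>c e'. e = {Inl c, Inr e'} \<and> on_line l p c e'"
    by (intro exI[of _ c] exI[of _ "line_through l p k c"]) (simp add: on_line_def line_through_in_coords)
next
  assume "\<exists>c e'. e = {Inl c, Inr e'} \<and> on_line l p c e'"
  then obtain c e' where e: "e = {Inl c, Inr e'}" "on_line l p c e'" by blast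
  have "crd 0 e' \<in> {0..<int p}" using e by (auto simp: on_line_def coords_def Let_def)
  then show "e \<in> edges (polygon_graph l p)"
    using e by (force simp: polygon_graph_def on_line_def)
qed

lemma polygon_graph_simple: "simple_graph (polygon_graph l p)"
  unfolding simple_graph_def using finite_coords
  by (auto simp: polygon_graph_edge_iff on_line_def) (auto simp: polygon_graph_def)

lemma polygon_graph_bipartite: "is_bipartite (polygon_graph l p)"
  unfolding is_bipartite_def
  by (intro exI[of _ "Inl ` coords l p"] exI[of _ "Inr ` coords l p"])
    (auto simp: polygon_graph_edge_iff on_line_def, auto simp: polygon_graph_def)

lemma num_verts_polygon_graph: "l \<in> {2, 3, 5} \<Longrightarrow> num_verts (polygon_graph l p) = 2 * p ^ l"
  unfolding num_verts_def polygon_graph_def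
  by (simp add: card_Un_disjoint finite_coords card_image Int_def image_iff card_coords del: insert_iff)
    (subst card_Un_disjoint; auto simp: finite_coords card_image card_coords)

lemma num_edges_polygon_graph:
  assumes "l \<in> {2, 3, 5}"
  shows "num_edges (polygon_graph l p) = p ^ (l + 1)"
proof -
  have "inj_on (\<lambda>(k, c). {Inl c, Inr (line_through l p k c)}) ({0..<int p} \<times> coords l p)"
  proof (rule inj_onI, clarify)
    fix k c k' c'
    assume "{Inl c, Inr (line_through l p k c)} = {Inl c', Inr (line_through l p k' c')}"
    then have "c = c'" "line_through l p k c = line_through l p k' c'" by (auto simp: doubleton_eq_iff)
    then show "k = k' \<and> c = c'" by (metis crd0_line_through)
  qed
  then show ?thesis
    unfolding num_edges_def polygon_graph_def
    by (simp add: card_image card_cartesian_product card_coords[OF assms])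
qed

lemma dvd_add_mod: "(P::int) dvd x + (t - x) mod P - t"
proof -
  have "x + (t - x) mod P - t = P * (- ((t - x) div P))"
    by (simp add: minus_div_mult_eq_mod[symmetric] algebra_simps)
  then show ?thesis by simp
qed

lemma on_line_dvd:
  assumes "on_line l p c e"
  shows "int p dvd crd 1 c + crd 1 e - crd 0 c ^ 1 * crd 0 e"
    "l \<ge> 3 \<Longrightarrow> int p dvd crd 2 c + crd 2 e - crd 0 c ^ 2 * crd 0 e"
    "l \<ge> 5 \<Longrightarrow> int p dvd crd 3 c + crd 3 e - crd 0 c ^ 3 * crd 0 e"
    "l \<ge> 5 \<Longrightarrow> int p dvd crd 4 c + crd 4 e - crd 0 e * twist c"
proof -
  have e: "e = line_through l p (crd 0 e) c" using assms by (simp add: on_line_def)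
  define k where "k = crd 0 e"
  show "int p dvd crd 1 c + crd 1 e - crd 0 c ^ 1 * crd 0 e"
    "l \<ge> 3 \<Longrightarrow> int p dvd crd 2 c + crd 2 e - crd 0 c ^ 2 * crd 0 e"
    "l \<ge> 5 \<Longrightarrow> int p dvd crd 3 c + crd 3 e - crd 0 c ^ 3 * crd 0 e"
    "l \<ge> 5 \<Longrightarrow> int p dvd crd 4 c + crd 4 e - crd 0 e * twist c"
    unfolding k_def[symmetric] e[folded k_def]
    by (simp_all add: line_through_def dvd_add_mod del: One_nat_def)
qed

lemma residue_eqI:
  fixes u v :: int
  assumes "u \<in> {0..<int p}" "v \<in> {0..<int p}" "int p dvd u - v"
  shows "u = v"
  using assms by (metis atLeastLessThan_iff mod_eq_dvd_iff mod_pos_pos_trivial)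

lemma crd_range:
  assumes "c \<in> coords l p"
  shows "crd 0 c \<in> {0..<int p}" "crd 1 c \<in> {0..<int p}" "l \<ge> 3 \<Longrightarrow> crd 2 c \<in> {0..<int p}"
    "\<not> l \<ge> 3 \<Longrightarrow> crd 2 c = 0"
    "l \<ge> 5 \<Longrightarrow> crd 3 c \<in> {0..<int p}" "l \<ge> 5 \<Longrightarrow> crd 4 c \<in> {0..<int p}"
    "\<not> l \<ge> 5 \<Longrightarrow> crd 3 c = 0 \<and> crd 4 c = 0"
  using assms by (auto simp: coords_def Let_def simp del: One_nat_def split: if_splits)

lemma on_line_unique_line: "\<lbrakk>on_line l p c e; on_line l p c e'; crd 0 e = crd 0 e'\<rbrakk> \<Longrightarrow> e = e'"
  by (metis on_line_def)

lemma on_line_unique_point: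
  assumes e: "on_line l p c e" "on_line l p c' e" and eq: "crd 0 c = crd 0 c'"
  shows "c = c'"
proof -
  have dvd: "int p dvd u - u'" if "int p dvd u + s - t" "int p dvd u' + s - t" for u u' s t :: int
    using dvd_diff[OF that] by simp
  have c: "c \<in> coords l p" "c' \<in> coords l p" using e by (auto simp: on_line_def)
  note r = crd_range[OF c(1)] crd_range[OF c(2)]
  have 1: "crd 1 c = crd 1 c'"
    by (rule residue_eqI[OF r(2,9) dvd[OF on_line_dvd(1)[OF e(1)] on_line_dvd(1)[OF e(2), folded eq]]])
  have 2: "crd 2 c = crd 2 c'"
  proof (cases "l \<ge> 3")
    case True
    then show ?thesis
      by (intro residue_eqI[OF r(3,10) dvd[OF on_line_dvd(2)[OF e(1)] on_line_dvd(2)[OF e(2), folded eq]]])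
  qed (use r(4,11) in simp)
  have "crd 3 c = crd 3 c' \<and> crd 4 c = crd 4 c'"
  proof (cases "l \<ge> 5")
    case True
    have 3: "crd 3 c = crd 3 c'"
      using True
      by (intro residue_eqI[OF r(5,12) dvd[OF on_line_dvd(3)[OF e(1)] on_line_dvd(3)[OF e(2), folded eq]]])
    have tw: "twist c' = twist c" using 1 2 3 eq by (simp add: twist_def)
    have "crd 4 c = crd 4 c'"
      using True
      by (intro residue_eqI[OF r(6,13) dvd[OF on_line_dvd(4)[OF e(1)] on_line_dvd(4)[OF e(2), unfolded tw]]])
    then show ?thesis using 3 by simp
  qed (use r(7,14) in simp)
  note 34 = conjunct1[OF this] conjunct2[OF this]
  show ?thesis using eq 1 2 34 by (cases c; cases c') auto
qed

lemma polygon_graph_cycle: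
  assumes m: "m \<ge> 2" and copy: "contains_copy (polygon_graph l p) (cycle_graph (2 * m))"
  obtains pt ln where "\<And>i. i < m \<Longrightarrow> on_line l p (pt i) (ln i)"
    "\<And>i. i < m \<Longrightarrow> on_line l p (pt i) (ln (cyc_prev m i))"
    "\<And>i. i < m \<Longrightarrow> pt i \<noteq> pt (cyc_prev m i)" "\<And>i. i < m \<Longrightarrow> ln i \<noteq> ln (cyc_prev m i)"
proof -
  from copy obtain f where f: "inj_on f {..<2 * m}"
    "\<And>i. i < 2 * m \<Longrightarrow> {f i, f (Suc i mod (2 * m))} \<in> edges (polygon_graph l p)"
    unfolding contains_copy_def cycle_graph_def by auto
  define o' where "o' = (if isl (f 0) then 0 else 1::nat)"
  define g where "g i = f ((i + o') mod (2 * m))" for i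
  have edge: "(\<exists>c e. g i = Inl c \<and> g (Suc i) = Inr e \<and> on_line l p c e)
     \<or> (\<exists>c e. g i = Inr e \<and> g (Suc i) = Inl c \<and> on_line l p c e)" for i
  proof -
    have "{g i, g (Suc i)} \<in> edges (polygon_graph l p)"
      using f(2)[of "(i + o') mod (2 * m)"] m by (simp add: g_def mod_Suc_eq)
    then show ?thesis by (auto simp: polygon_graph_edge_iff doubleton_eq_iff)
  qed
  have isl0: "isl (g 0)"
  proof (cases "isl (f 0)")
    case False
    have "{f 0, f 1} \<in> edges (polygon_graph l p)" using f(2)[of 0] m by simp
    then have "isl (f 1)" using False by (auto simp: polygon_graph_edge_iff doubleton_eq_iff)
    then show ?thesis using False m by (simp add: g_def o'_def)
  qed (simp add: g_def o'_def)
  have isl: "isl (g i) \<longleftrightarrow> even i" for i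
  proof (induction i)
    case (Suc i)
    then show ?case using edge[of i] by auto
  qed (use isl0 in simp)
  have inj: "g i \<noteq> g j" if "i < j" "j < 2 * m" for i j
  proof
    assume "g i = g j"
    then have "(i + o') mod (2 * m) = (j + o') mod (2 * m)"
      using f(1) m unfolding g_def by (auto dest!: inj_onD)
    then have "i mod (2 * m) = j mod (2 * m)" by (metis cong_add_rcancel_nat cong_def)
    then show False using that by simp
  qed
  have per: "g (2 * m) = g 0" by (simp add: g_def)
  define pt ln where "pt i = projl (g (2 * i))" and "ln i = projr (g (2 * i + 1))" for i
  have gp: "g (2 * i) = Inl (pt i)" "g (2 * i + 1) = Inr (ln i)" for i
    using isl[of "2 * i"] isl[of "2 * i + 1"] by (auto simp: pt_def ln_def)
  have 1: "on_line l p (pt i) (ln i)" for i using edge[of "2 * i"] gp[of i] by auto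
  have next1: "on_line l p (pt (Suc i)) (ln i)" for i
    using edge[of "2 * i + 1"] gp(2)[of i] gp(1)[of "Suc i"] by auto
  have ptm: "pt m = pt 0" using per by (simp add: pt_def)
  have 2: "on_line l p (pt i) (ln (cyc_prev m i))" if "i < m" for i
    using next1[of "m - 1"] next1[of "i - 1"] ptm m that by (cases "i = 0") (auto simp: cyc_prev_def)
  have ptd: "pt i \<noteq> pt j" and lnd: "ln i \<noteq> ln j" if "i < j" "j < m" for i j
    using inj[of "2 * i" "2 * j"] inj[of "2 * i + 1" "2 * j + 1"] gp[of i] gp[of j] that by auto
  have 3: "pt i \<noteq> pt (cyc_prev m i)" "ln i \<noteq> ln (cyc_prev m i)" if "i < m" for i
  proof -
    have "pt i \<noteq> pt (cyc_prev m i) \<and> ln i \<noteq> ln (cyc_prev m i)"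
    proof (cases "i = 0")
      case True
      then show ?thesis using ptd[of 0 "m - 1"] lnd[of 0 "m - 1"] m by (simp add: cyc_prev_def)
    next
      case False
      then have "pt i \<noteq> pt (i - 1)" "ln i \<noteq> ln (i - 1)"
        using ptd[of "i - 1" i, symmetric] lnd[of "i - 1" i, symmetric] that by simp_all
      then show ?thesis using False by (simp add: cyc_prev_def)
    qed
    then show "pt i \<noteq> pt (cyc_prev m i)" "ln i \<noteq> ln (cyc_prev m i)" by simp_all
  qed
  show ?thesis by (rule that[of pt ln]; (rule 1 2 3)?; assumption?)
qed

lemma polygon_graph_no_even_cycle:
  assumes l: "l \<in> {2, 3, 5}" and p: "prime p" "p > 2" and m: "2 \<le> m" "m \<le> l"
  shows "\<not> contains_copy (polygon_graph l p) (cycle_graph (2 * m))"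
proof
  assume "contains_copy (polygon_graph l p) (cycle_graph (2 * m))"
  from polygon_graph_cycle[OF m(1) this]
  obtain pt ln where on: "\<And>i. i < m \<Longrightarrow> on_line l p (pt i) (ln i)"
    "\<And>i. i < m \<Longrightarrow> on_line l p (pt i) (ln (cyc_prev m i))"
    and ne: "\<And>i. i < m \<Longrightarrow> pt i \<noteq> pt (cyc_prev m i)" "\<And>i. i < m \<Longrightarrow> ln i \<noteq> ln (cyc_prev m i)"
    by blast
  define P where "P = int p"
  have P: "prime P" "\<not> P dvd 2" using p zdvd_not_zless[of 2 P] by (auto simp: P_def)
  define a k where "a i = crd 0 (pt i)" and "k i = crd 0 (ln i)" for i
  define R :: "nat set" where "R = {r. 1 \<le> r \<and> r \<le> 3 \<and> (r = 1 \<or> l \<ge> 3 \<and> r = 2 \<or> l \<ge> 5)}"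
  have cp: "cyc_prev m i < m" if "i < m" for i using that by (auto simp: cyc_prev_def)
  have inc: "P dvd crd r c + crd r e - crd 0 c ^ r * crd 0 e" if "on_line l p c e" "r \<in> R" for c e r
  proof -
    have "r = 1 \<or> l \<ge> 3 \<and> r = 2 \<or> l \<ge> 5 \<and> r = 3" using that(2) by (auto simp: R_def)
    then show ?thesis using on_line_dvd[OF that(1)] by (auto simp: P_def)
  qed
  have walk: "closed_walk P m a k R (\<lambda>r i. crd r (pt i)) (\<lambda>r i. crd r (ln i))"
    by unfold_locales (use m inc on in \<open>auto simp: a_def k_def\<close>)
  have ar: "a i \<in> {0..<int p}" "k i \<in> {0..<int p}" if "i < m" for i
    using on(1)[OF that] by (auto simp: on_line_def coords_def Let_def a_def k_def)
  have dist: "a i = a j \<or> \<not> P dvd a i - a j" if "i < m" "j < m" for i j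
    using residue_eqI ar that unfolding P_def by blast
  have kne: "\<not> P dvd k i - k (cyc_prev m i)" if "i < m" for i
    using residue_eqI[of "k i" p "k (cyc_prev m i)"] ar[OF that] ar[OF cp[OF that]]
      on_line_unique_line[OF on(1)[OF that] on(2)[OF that]] ne(2)[OF that]
    unfolding P_def k_def by blast
  have ane: "a i \<noteq> a (cyc_prev m i)" if "i < m" for i
    using on_line_unique_point[OF on(2)[OF that] on(1)[OF cp[OF that]]] ne(1)[OF that]
    unfolding a_def by blast
  have w: "P dvd crd 4 (pt i) + crd 4 (ln i) - k i * twist (pt i)"
    "P dvd crd 4 (pt i) + crd 4 (ln (cyc_prev m i)) - k (cyc_prev m i) * twist (pt i)" if "i < m" "l \<ge> 5" for i
    using on_line_dvd(4)[OF on(1)[OF that(1)] that(2)] on_line_dvd(4)[OF on(2)[OF that(1)] that(2)]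
    by (simp_all add: P_def k_def)
  have tw: "twist (pt i) = 3 * a i ^ 2 * crd 1 (pt i) - 3 * a i * crd 2 (pt i) + crd 3 (pt i)" for i
    by (simp add: twist_def a_def)
  have adist: "\<not> P dvd a i - a j" if "i < m" "j < m" "a i \<noteq> a j" for i j using dist that by blast
  consider "m = 2" | "m = 3" "l \<ge> 3" | "m = 4" "l \<ge> 5" | "m = 5" "l \<ge> 5" using l m by force
  then show False
  proof cases
    case 1
    show False
      by (rule no_digon[OF walk[unfolded 1] P(1)])
        (use 1 adist[of 0 1] ane[of 0] kne[of 0] in \<open>auto simp: R_def cyc_prev_def\<close>)
  next
    case 2
    show False
      by (rule no_triangle[OF walk[unfolded 2(1)] P(1)])
        (use 2 adist[of 0 1] adist[of 0 2] ane[of 0] ane[of 1] kne[of 0] in \<open>auto simp: R_def cyc_prev_def\<close>)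
  next
    case 3
    show False
      by (rule no_quadrangle[OF walk[unfolded 3(1)] P(1) _ P(2) tw w[unfolded 3(1)] dist[unfolded 3(1)]
            ane[unfolded 3(1)] kne[unfolded 3(1)]])
        (use 3(2) in \<open>auto simp: R_def\<close>)
  next
    case 4
    show False
      by (rule no_pentagon[OF walk[unfolded 4(1)] P(1) _ P(2) tw w[unfolded 4(1)] dist[unfolded 4(1)]
            ane[unfolded 4(1)] kne[unfolded 4(1)]])
        (use 4(2) in \<open>auto simp: R_def\<close>)
  qed
qed

corollary polygon_graph_free:
  assumes "l \<in> {2, 3, 5}" "prime p" "p > 2"
  shows "family_free (even_cycles l) (polygon_graph l p)"
  using polygon_graph_no_even_cycle[OF assms] by (auto simp: family_free_def even_cycles_def)

subsection \<open>Extremal numbers\<close>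

definition empty_graph :: "nat \<Rightarrow> nat sgraph" where
  "empty_graph n = \<lparr>verts = {..<n}, edges = {}\<rparr>"

lemma empty_graph: "simple_graph (empty_graph n)" "num_verts (empty_graph n) = n" "is_bipartite (empty_graph n)"
proof -
  show "is_bipartite (empty_graph n)"
    unfolding is_bipartite_def empty_graph_def by (intro exI[of _ "{..<n}"] exI[of _ "{}"]) simp
qed (simp_all add: empty_graph_def simple_graph_def num_verts_def)

lemma num_edges_le_power:
  assumes "simple_graph G"
  shows "num_edges G \<le> 2 ^ num_verts G"
proof -
  have "edges G \<subseteq> Pow (verts G)" "finite (verts G)" using assms by (auto simp: simple_graph_def)
  then show ?thesis unfolding num_edges_def num_verts_def by (metis card_Pow card_mono finite_Pow_iff)
qed

lemma finite_edge_numbers: "finite {num_edges G | G :: nat sgraph. simple_graph G \<and> num_verts G = n \<and> Q G}"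
  by (rule finite_subset[of _ "{..2 ^ n}"]) (use num_edges_le_power in fastforce)+

lemma cycle_graph_nontrivial: "k > 0 \<Longrightarrow> edges (cycle_graph k) \<noteq> {}"
  by (auto simp: cycle_graph_def)

lemma even_cycles_nontrivial: "F \<in> even_cycles l \<Longrightarrow> edges F \<noteq> {}"
  using cycle_graph_nontrivial by (auto simp: even_cycles_def)

lemma empty_graph_free:
  assumes "\<And>F. F \<in> \<F> \<Longrightarrow> edges F \<noteq> {}"
  shows "family_free \<F> (empty_graph n)"
  using assms by (auto simp: family_free_def contains_copy_def empty_graph_def)

lemma ex_number_attained:
  assumes "\<And>F. F \<in> \<F> \<Longrightarrow> edges F \<noteq> {}"
  obtains G :: "nat sgraph" where "simple_graph G" "num_verts G = n" "family_free \<F> G" "num_edges G = ex_number n \<F>"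
proof -
  let ?S = "{num_edges G | G :: nat sgraph. simple_graph G \<and> num_verts G = n \<and> family_free \<F> G}"
  have "num_edges (empty_graph n) \<in> ?S"
    using empty_graph_free[OF assms] empty_graph by blast
  then have "ex_number n \<F> \<in> ?S"
    unfolding ex_number_def by (intro Max_in finite_edge_numbers) auto
  then show ?thesis using that by auto
qed

lemma ex_number_ge:
  fixes G :: "nat sgraph"
  assumes "simple_graph G" "num_verts G = n" "family_free \<F> G"
  shows "num_edges G \<le> ex_number n \<F>"
  unfolding ex_number_def using assms finite_edge_numbers by (intro Max_ge) auto

lemma z_number_attained:
  assumes "\<And>F. F \<in> \<F> \<Longrightarrow> edges F \<noteq> {}"
  obtains G :: "nat sgraph" where "simple_graph G" "num_verts G = n" "is_bipartite G" "family_free \<F> G"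
    "num_edges G = z_number n \<F>"
proof -
  let ?S = "{num_edges G | G :: nat sgraph. simple_graph G \<and> num_verts G = n \<and> is_bipartite G \<and> family_free \<F> G}"
  have "num_edges (empty_graph n) \<in> ?S"
    using empty_graph_free[OF assms] empty_graph by blast
  then have "z_number n \<F> \<in> ?S"
    unfolding z_number_def by (intro Max_in finite_edge_numbers) auto
  then show ?thesis using that by auto
qed

lemma z_number_ge:
  fixes G :: "'a sgraph"
  assumes G: "simple_graph G" "num_verts G \<le> n" "is_bipartite G" "family_free \<F> G"
    and conn: "\<And>F v. \<lbrakk>F \<in> \<F>; v \<in> verts F\<rbrakk> \<Longrightarrow> \<exists>e\<in>edges F. v \<in> e"
  shows "num_edges G \<le> z_number n \<F>"
proof -
  have fV: "finite (verts G)" using G by (simp add: simple_graph_def)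
  obtain h where "bij_betw h (verts G) {0..<card (verts G)}"
    using ex_bij_betw_finite_nat[OF fV] by blast
  then have h: "inj_on h (verts G)" "h ` verts G = {0..<num_verts G}"
    by (auto simp: bij_betw_def num_verts_def)
  define G' where "G' = \<lparr>verts = {..<n}, edges = (`) h ` edges G\<rparr>"
  have eV: "e \<subseteq> verts G" "card e = 2" if "e \<in> edges G" for e using G(1) that by (auto simp: simple_graph_def)
  have hn: "h v < n" if "v \<in> verts G" for v
  proof -
    have "h v \<in> {0..<num_verts G}" using h(2) that by blast
    then show ?thesis using G(2) by simp
  qed
  have simple: "simple_graph G'"
    unfolding simple_graph_def
  proof (intro conjI ballI)
    fix e assume "e \<in> edges G'"
    then obtain e' where e: "e' \<in> edges G" "e = h ` e'" by (auto simp: G'_def)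
    show "e \<subseteq> verts G'" using e eV(1)[OF e(1)] hn by (auto simp: G'_def)
    show "card e = 2" using e eV[OF e(1)] h(1) by (metis card_image inj_on_subset)
  qed (simp add: G'_def)
  have "inj_on ((`) h) (edges G)"
    by (rule inj_on_subset[OF inj_on_image_Pow[OF h(1)]]) (use eV in auto)
  then have ne: "num_edges G' = num_edges G" by (simp add: num_edges_def G'_def card_image)
  have bip: "is_bipartite G'"
  proof -
    obtain A B where AB: "A \<union> B = verts G" "A \<inter> B = {}" "\<And>e. e \<in> edges G \<Longrightarrow> \<exists>a\<in>A. \<exists>b\<in>B. e = {a, b}"
      using G(3) by (auto simp: is_bipartite_def)
    have disj: "h ` A \<inter> h ` B = {}" using AB(1,2) inj_on_image_Int[OF h(1), of A B] by auto
    show ?thesis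
      unfolding is_bipartite_def
    proof (rule exI[of _ "h ` A"], rule exI[of _ "{..<n} - h ` A"], intro conjI ballI)
      show "h ` A \<union> ({..<n} - h ` A) = verts G'" using AB(1) hn by (auto simp: G'_def)
      fix e assume "e \<in> edges G'"
      then obtain e' where e: "e' \<in> edges G" "e = h ` e'" by (auto simp: G'_def)
      obtain a b where ab: "a \<in> A" "b \<in> B" "e' = {a, b}" using AB(3)[OF e(1)] by blast
      then have "h b \<in> {..<n} - h ` A" using hn AB(1) disj by auto
      then show "\<exists>a\<in>h ` A. \<exists>b\<in>{..<n} - h ` A. e = {a, b}" using ab e by auto
    qed auto
  qed
  have free: "family_free \<F> G'"
    unfolding family_free_def
  proof (intro ballI notI)
    fix F assume F: "F \<in> \<F>" and "contains_copy G' F"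
    then obtain f where f: "inj_on f (verts F)" "\<And>e. e \<in> edges F \<Longrightarrow> f ` e \<in> edges G'"
      by (auto simp: contains_copy_def)
    have fh: "f v \<in> h ` verts G" if v: "v \<in> verts F" for v
    proof -
      obtain e where e: "e \<in> edges F" "v \<in> e" using conn[OF F v] by blast
      then obtain e' where "e' \<in> edges G" "f ` e = h ` e'" using f(2)[OF e(1)] by (auto simp: G'_def)
      then show ?thesis using e(2) eV(1) by blast
    qed
    define i where "i = inv_into (verts G) h"
    have ih: "i (h v) = v" if "v \<in> verts G" for v using h(1) that by (simp add: i_def)
    have "inj_on (i \<circ> f) (verts F)"
      using fh f(1) h(1) unfolding i_def
      by (intro comp_inj_on) (auto intro: inj_on_inv_into simp: image_subset_iff)
    moreover have "(i \<circ> f) ` verts F \<subseteq> verts G" using fh ih by fastforce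
    moreover have "(i \<circ> f) ` e \<in> edges G" if e: "e \<in> edges F" for e
    proof -
      obtain e' where e': "e' \<in> edges G" "f ` e = h ` e'" using f(2)[OF e] by (auto simp: G'_def)
      have "(i \<circ> f) ` e = i ` h ` e'" by (simp only: image_comp[symmetric] e'(2))
      also have "\<dots> = e'" using ih eV(1)[OF e'(1)] by (force simp: image_image)
      finally show ?thesis using e'(1) by simp
    qed
    ultimately have "contains_copy G F" unfolding contains_copy_def by blast
    then show False using G(4) F by (auto simp: family_free_def)
  qed
  have "num_edges G' \<le> z_number n \<F>"
    unfolding z_number_def using simple bip free finite_edge_numbers
    by (intro Max_ge) (auto simp: num_verts_def G'_def)
  then show ?thesis by (simp add: ne)
qed

lemma even_cycles_no_isolated:
  assumes "F \<in> even_cycles l" "v \<in> verts F"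
  shows "\<exists>e\<in>edges F. v \<in> e"
  using assms by (auto simp: even_cycles_def cycle_graph_def)

lemma bipartite_no_odd_cycle:
  assumes "is_bipartite G" "odd k"
  shows "\<not> contains_copy G (cycle_graph k)"
proof
  assume "contains_copy G (cycle_graph k)"
  then obtain f where f: "\<And>i. i < k \<Longrightarrow> {f i, f (Suc i mod k)} \<in> edges G"
    unfolding contains_copy_def cycle_graph_def by auto
  obtain A B where AB: "A \<inter> B = {}" "\<And>e. e \<in> edges G \<Longrightarrow> \<exists>a\<in>A. \<exists>b\<in>B. e = {a, b}"
    using assms(1) by (auto simp: is_bipartite_def)
  have k: "k > 0" using assms(2) by (auto intro: Nat.gr0I)
  have step: "f i \<in> A \<longleftrightarrow> f (Suc i mod k) \<notin> A" if "i < k" for i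
    using AB(2)[OF f[OF that]] AB(1) by (auto simp: doubleton_eq_iff)
  have par: "i < k \<Longrightarrow> (f i \<in> A \<longleftrightarrow> (f 0 \<in> A \<longleftrightarrow> even i))" for i
  proof (induction i)
    case (Suc i)
    then show ?case using step[of i] by auto
  qed auto
  show False using par[of "k - 1"] step[of "k - 1"] k assms(2) by simp
qed

lemma z_number_le_ex_number:
  assumes "odd k"
  shows "z_number n (even_cycles l) \<le> ex_number n (even_cycles l \<union> {cycle_graph k})"
proof -
  obtain G :: "nat sgraph" where G: "simple_graph G" "num_verts G = n" "is_bipartite G"
    "family_free (even_cycles l) G" "num_edges G = z_number n (even_cycles l)"
    using z_number_attained[of "even_cycles l" n] even_cycles_nontrivial by metis
  then have "family_free (even_cycles l \<union> {cycle_graph k}) G"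
    using bipartite_no_odd_cycle[OF G(3) assms] by (auto simp: family_free_def)
  from ex_number_ge[OF G(1,2) this] show ?thesis using G(5) by simp
qed

lemma z_number_ge_power:
  assumes "l \<in> {2, 3, 5}" "prime p" "p > 2" "2 * p ^ l \<le> n"
  shows "p ^ (l + 1) \<le> z_number n (even_cycles l)"
  using z_number_ge[OF polygon_graph_simple _ polygon_graph_bipartite polygon_graph_free[OF assms(1-3)]
      even_cycles_no_isolated, of n]
    num_verts_polygon_graph[OF assms(1), of p] num_edges_polygon_graph[OF assms(1), of p] assms(4)
  by simp

section \<open>Primes in short intervals\<close>

subsection \<open>The zeta function to the right of the imaginary axis\<close>

definition zeta_term :: "nat \<Rightarrow> complex \<Rightarrow> complex" where
  "zeta_term n s = (s - 1) * of_nat n powr (- s) - of_nat n powr (1 - s) + of_nat (n + 1) powr (1 - s)"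

lemma norm_of_nat_powr: "norm (of_nat n powr s :: complex) = real n powr Re s"
  by (simp add: norm_powr_real_powr)

lemma norm_zeta_term_le:
  assumes n: "n > 0" and s: "Re s \<ge> -1"
  shows "norm (zeta_term n s) \<le> norm s * norm (s - 1) * real n powr (- Re s - 1)"
proof -
  define S where "S = {u. Im u = 0 \<and> Re u \<ge> real n}"
  define f where "f i u = (if i = 0 then u powr (1 - s) else if i = 1 then (1 - s) * u powr (- s)
    else (1 - s) * ((- s) * u powr (- s - 1)))" for i :: nat and u :: complex
  have S: "u \<notin> \<real>\<^sub>\<le>\<^sub>0" if "u \<in> S" for u
    using that n by (auto simp: S_def complex_nonpos_Reals_iff)
  have "norm (f 0 (of_nat (n + 1)) - (\<Sum>i\<le>1. f i (of_nat n) * (of_nat (n + 1) - of_nat n) ^ i / fact i))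
      \<le> (norm s * norm (s - 1) * real n powr (- Re s - 1)) * norm (of_nat (n + 1) - of_nat n :: complex) ^ Suc 1 / fact 1"
  proof (rule complex_Taylor[where S = S])
    show "convex S"
      unfolding S_def by (auto simp: convex_def algebra_simps) (metis add_mono mult_left_mono distrib_right mult_1)
    show "(f i has_field_derivative f (Suc i) u) (at u within S)" if u: "u \<in> S" and i: "i \<le> 1" for i u
    proof (cases "i = 0")
      case True
      have "((\<lambda>u. u powr (1 - s)) has_field_derivative (1 - s) * u powr (1 - s - 1)) (at u)"
        by (rule has_field_derivative_powr[OF S[OF u]])
      then show ?thesis using True
        by (auto simp: f_def[abs_def] intro: has_field_derivative_at_within)
    next
      case False
      then have i: "i = 1" using i by simp
      have "((\<lambda>u. (1 - s) * u powr (- s)) has_field_derivative (1 - s) * ((- s) * u powr (- s - 1))) (at u)"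
        by (intro DERIV_cmult has_field_derivative_powr S u)
      then show ?thesis using i
        by (auto simp: f_def[abs_def] intro: has_field_derivative_at_within)
    qed
    show "cmod (f (Suc 1) u) \<le> norm s * norm (s - 1) * real n powr (- Re s - 1)" if u: "u \<in> S" for u
    proof -
      have ur: "u \<in> \<real>" "Re u \<ge> real n" using u by (auto simp: S_def complex_is_Real_iff)
      have "norm (u powr (- s - 1)) = Re u powr (- Re s - 1)"
        using ur by (subst norm_powr_real_powr) (auto intro: order_trans[OF of_nat_0_le_iff])
      also have "\<dots> \<le> real n powr (- Re s - 1)" using ur n s by (intro powr_mono2') auto
      finally have le: "norm (u powr (- s - 1)) \<le> real n powr (- Re s - 1)" .
      have "cmod (f (Suc 1) u) = norm s * norm (s - 1) * norm (u powr (- s - 1))"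
        by (simp add: f_def norm_mult norm_minus_commute mult_ac)
      also have "\<dots> \<le> norm s * norm (s - 1) * real n powr (- Re s - 1)"
        by (intro mult_left_mono le) auto
      finally show ?thesis .
    qed
  qed (auto simp: S_def)
  also have "f 0 (of_nat (n + 1)) - (\<Sum>i\<le>1. f i (of_nat n) * (of_nat (n + 1) - of_nat n) ^ i / fact i) = zeta_term n s"
    by (simp add: f_def zeta_term_def algebra_simps)
  finally show ?thesis by simp
qed

lemma summable_powr_Suc: "a < -1 \<Longrightarrow> summable (\<lambda>n. real (Suc n) powr a)"
  by (subst summable_Suc_iff) (simp add: summable_real_powr_iff)

lemma open_Re_gt: "open {s::complex. Re s > c}"
  by (rule open_halfspace_Re_gt)

lemma zeta_term_series:
  fixes \<beta> :: "nat \<Rightarrow> complex"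
  assumes \<theta>: "\<theta> \<ge> 0" and \<beta>: "\<And>n. n > 0 \<Longrightarrow> norm (\<beta> n) \<le> C * real n powr \<theta>"
  shows "(\<lambda>s. \<Sum>n. \<beta> (Suc n) * zeta_term (Suc n) s) holomorphic_on {s. Re s > \<theta>}"
    and "Re s > \<theta> \<Longrightarrow> summable (\<lambda>n. \<beta> (Suc n) * zeta_term (Suc n) s)"
proof -
  define f where "f n s = \<beta> (Suc n) * zeta_term (Suc n) s" for n s
  have C: "C \<ge> 0" using order_trans[OF norm_ge_zero \<beta>[of 1]] by simp
  have "f n holomorphic_on UNIV" for n
    unfolding f_def zeta_term_def by (intro holomorphic_intros)
  then have der: "(f n has_field_derivative deriv (f n) s) (at s)" for n s
    using holomorphic_derivI open_UNIV by blast
  have "\<exists>g g'. \<forall>s\<in>{s. Re s > \<theta>}. (\<lambda>n. f n s) sums g s \<and> (\<lambda>n. deriv (f n) s) sums g' s \<and> (g has_field_derivative g' s) (at s)"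
  proof (rule series_and_derivative_comparison_local[OF open_Re_gt der])
    fix s assume "s \<in> {s. Re s > \<theta>}"
    then have s: "Re s > \<theta>" by simp
    define d where "d = (Re s - \<theta>) / 2"
    define h where "h n = C * ((norm s + d) * (norm s + d + 1)) * real (Suc n) powr (- d - 1)" for n
    have d: "d > 0" using s by (simp add: d_def)
    have "summable h" unfolding h_def using d by (intro summable_mult summable_powr_Suc) auto
    moreover have "norm (f n y) \<le> h n" if y: "y \<in> ball s d" for n y
    proof -
      have yd: "norm (y - s) < d" using y by (simp add: dist_norm norm_minus_commute)
      have ny: "norm y \<le> norm s + d" using yd norm_triangle_sub[of y s] by linarith
      have ny1: "norm (y - 1) \<le> norm s + d + 1" using ny norm_triangle_ineq4[of y 1] by simp
      have "Re s - Re y < d"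
        using y complex_Re_le_cmod[of "s - y"] by (simp add: dist_norm)
      then have Rey: "Re y \<ge> \<theta> + d" using s by (simp add: d_def field_simps)
      have "norm (f n y) \<le> (C * real (Suc n) powr \<theta>) * (norm y * norm (y - 1) * real (Suc n) powr (- Re y - 1))"
        unfolding f_def norm_mult using Rey \<theta> d C
        by (intro mult_mono \<beta> norm_zeta_term_le) auto
      also have "\<dots> = C * (norm y * norm (y - 1)) * (real (Suc n) powr (\<theta> + (- Re y - 1)))"
        by (simp add: powr_add mult_ac)
      also have "\<dots> \<le> C * ((norm s + d) * (norm s + d + 1)) * (real (Suc n) powr (- d - 1))"
        using C ny ny1 Rey d by (intro mult_mono powr_mono mult_nonneg_nonneg) (auto intro: add_nonneg_nonneg less_imp_le)
      finally show ?thesis by (simp add: h_def)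
    qed
    ultimately show "\<exists>d h. 0 < d \<and> summable h \<and> (\<forall>\<^sub>F n in sequentially. \<forall>y\<in>ball s d \<inter> {s. Re s > \<theta>}. norm (f n y) \<le> h n)"
      using d by (intro exI[of _ d] exI[of _ h]) auto
  qed
  then obtain g g' where g: "\<And>s. Re s > \<theta> \<Longrightarrow> (\<lambda>n. f n s) sums g s"
     "\<And>s. Re s > \<theta> \<Longrightarrow> (g has_field_derivative g' s) (at s)" by auto
  have "g holomorphic_on {s. Re s > \<theta>}"
    using g(2) by (auto simp: holomorphic_on_open[OF open_Re_gt])
  then show "(\<lambda>s. \<Sum>n. \<beta> (Suc n) * zeta_term (Suc n) s) holomorphic_on {s. Re s > \<theta>}"
    by (rule holomorphic_transform) (use g(1) in \<open>auto simp: f_def sums_iff\<close>)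
  show "Re s > \<theta> \<Longrightarrow> summable (\<lambda>n. \<beta> (Suc n) * zeta_term (Suc n) s)"
    using g(1) by (auto simp: f_def sums_iff)
qed

text \<open>\<open>zeta_pole s = (s - 1) \<zeta>(s)\<close>, continued to \<open>Re s > 0\<close> by Euler--Maclaurin summation.\<close>

definition zeta_pole :: "complex \<Rightarrow> complex" where
  "zeta_pole s = 1 + (\<Sum>n. zeta_term (Suc n) s)"

lemma zeta_pole_holomorphic: "zeta_pole holomorphic_on {s. Re s > 0}"
proof -
  have "(\<lambda>s. \<Sum>n. 1 * zeta_term (Suc n) s) holomorphic_on {s. Re s > 0}"
    by (rule zeta_term_series(1)[where C = 1 and \<beta> = "\<lambda>_. 1"]) auto
  then show ?thesis unfolding zeta_pole_def[abs_def] by (intro holomorphic_intros) auto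
qed

lemma zeta_pole_1: "zeta_pole 1 = 1"
  by (simp add: zeta_pole_def zeta_term_def del: of_nat_Suc)

lemma summable_norm_of_nat_powr: "Re s > 1 \<Longrightarrow> summable (\<lambda>n. norm (of_nat (Suc n) powr (- s) :: complex))"
  unfolding norm_of_nat_powr by (intro summable_powr_Suc) auto

lemma tendsto_of_nat_powr: "Re s > 0 \<Longrightarrow> (\<lambda>n. of_nat n powr (- s) :: complex) \<longlonglongrightarrow> 0"
  by (rule tendsto_norm_zero_cancel) (simp only: norm_of_nat_powr uminus_complex.sel, real_asymp)

definition zeta_sum :: "complex \<Rightarrow> complex" where
  "zeta_sum s = (\<Sum>n. of_nat (Suc n) powr (- s))"

lemma zeta_sum_sums: "Re s > 1 \<Longrightarrow> (\<lambda>n. of_nat (Suc n) powr (- s)) sums zeta_sum s"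
  unfolding zeta_sum_def using summable_norm_cancel[OF summable_norm_of_nat_powr] summable_sums by blast

lemma zeta_pole_eq:
  assumes s: "Re s > 1"
  shows "zeta_pole s = (s - 1) * zeta_sum s"
proof -
  have "(\<lambda>n. of_nat n powr (1 - s) :: complex) \<longlonglongrightarrow> 0"
    using tendsto_of_nat_powr[of "s - 1"] s by simp
  then have "(\<lambda>n. of_nat (Suc n) powr (1 - s) :: complex) \<longlonglongrightarrow> 0"
    by (rule LIMSEQ_Suc)
  from telescope_sums[OF this]
  have "(\<lambda>n. of_nat (Suc (Suc n)) powr (1 - s) - of_nat (Suc n) powr (1 - s)) sums (0 - 1 :: complex)"
    by simp
  from sums_add[OF sums_mult[OF zeta_sum_sums[OF s], of "s - 1"] this]
  have "(\<lambda>n. zeta_term (Suc n) s) sums ((s - 1) * zeta_sum s - 1)"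
    by (simp add: zeta_term_def algebra_simps)
  then show ?thesis by (simp add: zeta_pole_def sums_iff)
qed

subsection \<open>The logarithmic derivative\<close>

lemma ln_le_powr: "x \<ge> 1 \<Longrightarrow> e > 0 \<Longrightarrow> ln x \<le> x powr e / e" for x e :: real
  using ln_bound[of "x powr e"] by (simp add: ln_powr field_simps)

definition mangoldt_series :: "complex \<Rightarrow> complex" where
  "mangoldt_series s = (\<Sum>n. mangoldt (Suc n) * of_nat (Suc n) powr (- s))"

lemma summable_norm_ln:
  assumes s: "Re s > 1" and c: "\<And>n. n > 0 \<Longrightarrow> norm (c n) \<le> ln (real n)"
  shows "summable (\<lambda>n. norm (c (Suc n) * of_nat (Suc n) powr (- s) :: complex))"
proof -
  define e where "e = (Re s - 1) / 2"
  have e: "e > 0" using s by (simp add: e_def)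
  have "summable (\<lambda>n. 1 / e * real (Suc n) powr (- 1 - e))"
    using e by (intro summable_mult summable_powr_Suc) auto
  then show ?thesis
  proof (rule summable_comparison_test'[where N = 0])
    fix n
    have "norm (c (Suc n) * of_nat (Suc n) powr (- s) :: complex) \<le> (real (Suc n) powr e / e) * real (Suc n) powr (- Re s)"
      unfolding norm_mult norm_of_nat_powr
      using order_trans[OF c[of "Suc n"] ln_le_powr[of "real (Suc n)" e]] e
      by (intro mult_mono) auto
    also have "\<dots> = 1 / e * real (Suc n) powr (e + (- Re s))" unfolding powr_add by simp
    also have "e + (- Re s) = - 1 - e" by (simp add: e_def field_simps)
    finally show "norm (norm (c (Suc n) * of_nat (Suc n) powr (- s))) \<le> 1 / e * real (Suc n) powr (- 1 - e)" by simp
  qed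
qed

lemma summable_norm_mangoldt:
  "Re s > 1 \<Longrightarrow> summable (\<lambda>n. norm (mangoldt (Suc n) * of_nat (Suc n) powr (- s) :: complex))"
proof (rule summable_norm_ln)
  show "norm (mangoldt n :: complex) \<le> ln (real n)" if "n > 0" for n
    using that by (auto intro: mangoldt_le)
qed

lemma mangoldt_series_sums:
  "Re s > 1 \<Longrightarrow> (\<lambda>n. mangoldt (Suc n) * of_nat (Suc n) powr (- s)) sums mangoldt_series s"
  unfolding mangoldt_series_def using summable_norm_cancel[OF summable_norm_mangoldt] summable_sums by blast

lemma zeta_sum_deriv:
  assumes s: "Re s > 1"
  shows "(zeta_sum has_field_derivative - (\<Sum>n. of_real (ln (real (Suc n))) * of_nat (Suc n) powr (- s))) (at s)"
proof -
  define f f' where "f n s = (of_nat (Suc n) powr (- s) :: complex)"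
    and "f' n s = - (of_real (ln (real (Suc n))) * of_nat (Suc n) powr (- s) :: complex)" for n s
  have "\<exists>g g'. \<forall>s\<in>{s. Re s > 1}. (\<lambda>n. f n s) sums g s \<and> (\<lambda>n. f' n s) sums g' s \<and> (g has_field_derivative g' s) (at s)"
  proof (rule series_and_derivative_comparison_local[OF open_Re_gt])
    show "(f n has_field_derivative f' n s) (at s)" for n s
    proof -
      have Ln: "Ln (of_nat (Suc n)) = of_real (ln (real (Suc n)))"
        using Ln_of_real[of "real (Suc n)"] by simp
      have "((\<lambda>s. of_nat (Suc n) powr (- s)) has_field_derivative (Ln (of_nat (Suc n)) * of_nat (Suc n) powr (- s)) * (- 1)) (at s)"
        by (rule DERIV_chain2[OF has_field_derivative_powr_right])
          (auto intro!: derivative_eq_intros simp del: of_nat_Suc)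
      then show ?thesis unfolding f_def f'_def Ln by (simp del: of_nat_Suc)
    qed
    fix s assume "s \<in> {s::complex. Re s > 1}"
    then have s: "Re s > 1" by simp
    define d where "d = (Re s - 1) / 2"
    have d: "d > 0" using s by (simp add: d_def)
    have "summable (\<lambda>n. real (Suc n) powr (- 1 - d))" using d by (intro summable_powr_Suc) auto
    moreover have "norm (f n y) \<le> real (Suc n) powr (- 1 - d)" if y: "y \<in> ball s d" for n y
    proof -
      have "Re s - Re y < d"
        using y complex_Re_le_cmod[of "s - y"] by (simp add: dist_norm)
      then have "Re y \<ge> 1 + d" using s by (simp add: d_def field_simps)
      then show ?thesis unfolding f_def norm_of_nat_powr by (intro powr_mono) auto
    qed
    ultimately show "\<exists>d h. 0 < d \<and> summable h \<and> (\<forall>\<^sub>F n in sequentially. \<forall>y\<in>ball s d \<inter> {s. Re s > 1}. norm (f n y) \<le> h n)"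
      using d by (intro exI[of _ d] exI[of _ "\<lambda>n. real (Suc n) powr (- 1 - d)"]) auto
  qed
  then obtain g g' where g: "\<And>s. Re s > 1 \<Longrightarrow> (\<lambda>n. f n s) sums g s" "\<And>s. Re s > 1 \<Longrightarrow> (\<lambda>n. f' n s) sums g' s"
     "\<And>s. Re s > 1 \<Longrightarrow> (g has_field_derivative g' s) (at s)" by auto
  have eq: "zeta_sum z = g z" if "Re z > 1" for z
    using zeta_sum_sums[OF that] g(1)[OF that] unfolding f_def by (rule sums_unique2)
  have "(zeta_sum has_field_derivative g' s) (at s)"
    by (rule has_field_derivative_transform_within_open[OF g(3)[OF s] open_Re_gt]) (use s eq in auto)
  moreover have "g' s = (\<Sum>n. f' n s)" using g(2)[OF s] by (simp add: sums_iff)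
  moreover have "(\<Sum>n. f' n s) = - (\<Sum>n. of_real (ln (real (Suc n))) * of_nat (Suc n) powr (- s))"
    unfolding f'_def
    by (rule suminf_minus[OF summable_norm_cancel[OF summable_norm_ln[OF s, of "\<lambda>n. of_real (ln (real n))"]]])
      (auto simp: abs_of_nonneg)
  ultimately show ?thesis by simp
qed

lemma mangoldt_series_times_zeta_sum:
  assumes s: "Re s > 1"
  shows "zeta_sum s * mangoldt_series s = (\<Sum>n. of_real (ln (real (Suc n))) * of_nat (Suc n) powr (- s))"
proof -
  define A where "A = {0::nat<..}"
  define x y where "x n = (of_nat n powr (- s) :: complex)" and "y n = (mangoldt n * of_nat n powr (- s) :: complex)" for n
  have A: "A = range Suc" by (auto simp: A_def image_iff gr0_conv_Suc)
  have conv: "(Infinite_Set_Sum.abs_summable_on f A \<longleftrightarrow> summable (\<lambda>n. norm (f (Suc n))))"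
     "summable (\<lambda>n. norm (f (Suc n))) \<Longrightarrow> infsetsum f A = (\<Sum>n. f (Suc n))" for f :: "nat \<Rightarrow> complex"
  proof -
    have bij: "bij_betw Suc UNIV A" unfolding A by (simp add: bij_betw_def)
    have iff: "Infinite_Set_Sum.abs_summable_on f A \<longleftrightarrow> Infinite_Set_Sum.abs_summable_on (\<lambda>n. f (Suc n)) UNIV"
      using abs_summable_on_reindex_bij_betw[OF bij, of f] by simp
    then show "(Infinite_Set_Sum.abs_summable_on f A \<longleftrightarrow> summable (\<lambda>n. norm (f (Suc n))))"
      by (simp add: abs_summable_on_nat_iff')
    assume "summable (\<lambda>n. norm (f (Suc n)))"
    then have "Infinite_Set_Sum.abs_summable_on (\<lambda>n. f (Suc n)) UNIV" by (simp add: abs_summable_on_nat_iff')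
    then show "infsetsum f A = (\<Sum>n. f (Suc n))"
      using infsetsum_reindex_bij_betw[OF bij, of f] by (simp add: infsetsum_nat')
  qed
  have sx: "Infinite_Set_Sum.abs_summable_on x A" "infsetsum x A = zeta_sum s"
    using conv[of x] summable_norm_of_nat_powr[OF s] by (simp_all add: x_def zeta_sum_def)
  have sy: "Infinite_Set_Sum.abs_summable_on y A" "infsetsum y A = mangoldt_series s"
    using conv[of y] summable_norm_mangoldt[OF s] by (simp_all add: y_def mangoldt_series_def)
  let ?f = "\<lambda>(a, b). x a * y b"
  let ?D = "Sigma A (\<lambda>n. {d. d dvd n})"
  let ?g = "\<lambda>(n, d). (n div d, d)"
  have bij: "bij_betw ?g ?D (A \<times> A)"
    by (rule bij_betw_byWitness[where f' = "\<lambda>(a, b). (a * b, b)"])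
      (auto simp: A_def dvd_pos_nat div_greater_zero_iff dvd_imp_le)
  have sum: "Infinite_Set_Sum.abs_summable_on ?f (A \<times> A)" by (rule abs_summable_on_product[OF _ _ sx(1) sy(1)]) auto
  have "zeta_sum s * mangoldt_series s = infsetsum ?f (A \<times> A)"
    using infsetsum_product[OF _ _ sx(1) sy(1)] sx sy by simp
  also have "\<dots> = infsetsum (\<lambda>z. ?f (?g z)) ?D"
    by (rule infsetsum_reindex_bij_betw[OF bij, symmetric])
  also have "\<dots> = infsetsum (\<lambda>n. infsetsum (\<lambda>d. ?f (?g (n, d))) {d. d dvd n}) A"
    by (rule infsetsum_Sigma) (use sum abs_summable_on_reindex_bij_betw[OF bij, of ?f] in auto)
  also have "\<dots> = infsetsum (\<lambda>n. of_real (ln (real n)) * of_nat n powr (- s)) A"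
  proof (rule infsetsum_cong)
    fix n assume n: "n \<in> A"
    then have n0: "n > 0" by (simp add: A_def)
    have "infsetsum (\<lambda>d. ?f (?g (n, d))) {d. d dvd n} = (\<Sum>d | d dvd n. x (n div d) * y d)"
      using n0 by (simp add: infsetsum_finite)
    also have "\<dots> = (\<Sum>d | d dvd n. mangoldt d * of_nat n powr (- s))"
    proof (rule sum.cong)
      fix d assume "d \<in> {d. d dvd n}"
      then have "n = n div d * d" by simp
      then have "(of_nat n :: complex) powr (- s) = of_nat (n div d * d) powr (- s)" by simp
      also have "\<dots> = of_nat (n div d) powr (- s) * of_nat d powr (- s)"
        using powr_times_real[of "of_nat (n div d)" "of_nat d" "- s"] by simp
      finally show "x (n div d) * y d = mangoldt d * of_nat n powr (- s)" by (simp add: x_def y_def mult_ac)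
    qed simp
    also have "\<dots> = of_real (ln (real n)) * of_nat n powr (- s)"
      using mangoldt_sum[of n, where ?'a = complex] n0 by (simp flip: sum_distrib_right)
    finally show "infsetsum (\<lambda>d. ?f (?g (n, d))) {d. d dvd n} = of_real (ln (real n)) * of_nat n powr (- s)" .
  qed simp
  also have "\<dots> = (\<Sum>n. of_real (ln (real (Suc n))) * of_nat (Suc n) powr (- s))"
    by (rule conv(2), rule summable_norm_ln[OF s]) (auto simp: abs_of_nonneg)
  finally show ?thesis .
qed

lemma zeta_pole_deriv:
  assumes s: "Re s > 1"
  shows "(zeta_pole has_field_derivative zeta_sum s - zeta_pole s * mangoldt_series s) (at s)"
proof -
  have "((\<lambda>s. (s - 1) * zeta_sum s) has_field_derivative
      zeta_sum s + (s - 1) * (- (zeta_sum s * mangoldt_series s))) (at s)"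
    unfolding mangoldt_series_times_zeta_sum[OF s]
    by (rule derivative_eq_intros zeta_sum_deriv s refl | simp)+
  then have "(zeta_pole has_field_derivative zeta_sum s + (s - 1) * (- (zeta_sum s * mangoldt_series s))) (at s)"
    by (rule has_field_derivative_transform_within_open[OF _ open_Re_gt[of 1]]) (use s zeta_pole_eq in auto)
  then show ?thesis by (simp add: zeta_pole_eq[OF s] mult.assoc)
qed

lemma zeta_pole_factor:
  assumes s: "Re s > 0"
  obtains m r g where "r > 0" "ball s r \<subseteq> {s. Re s > 0}" "g holomorphic_on ball s r"
    "\<And>w. w \<in> ball s r \<Longrightarrow> zeta_pole w = (w - s) ^ m * g w"
    "\<And>w. w \<in> ball s r \<Longrightarrow> g w \<noteq> 0" "zeta_pole s = 0 \<longleftrightarrow> m > 0"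
proof (cases "zeta_pole s = 0")
  case True
  have nc: "\<not> zeta_pole constant_on {s. Re s > 0}"
  proof
    assume "zeta_pole constant_on {s. Re s > 0}"
    then have "zeta_pole s = zeta_pole 1" using s by (auto simp: constant_on_def)
    then show False using True zeta_pole_1 by simp
  qed
  obtain g r m where "0 < m" "0 < r" "ball s r \<subseteq> {s. Re s > 0}" "g holomorphic_on ball s r"
    "\<And>w. w \<in> ball s r \<Longrightarrow> zeta_pole w = (w - s) ^ m * g w" "\<And>w. w \<in> ball s r \<Longrightarrow> g w \<noteq> 0"
    by (rule holomorphic_factor_zero_nonconstant[OF zeta_pole_holomorphic open_Re_gt
        convex_connected[OF convex_halfspace_Re_gt] _ True nc]) (use s in auto)
  then show ?thesis using that True by blast
next
  case False
  have "continuous_on {s. Re s > 0} zeta_pole"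
    using zeta_pole_holomorphic holomorphic_on_imp_continuous_on by blast
  then have "open ({s. Re s > 0} \<inter> zeta_pole -` (- {0}))"
    by (rule continuous_open_preimage[OF _ open_Re_gt]) auto
  moreover have "s \<in> {s. Re s > 0} \<inter> zeta_pole -` (- {0})" using s False by auto
  ultimately obtain r where r: "r > 0" "ball s r \<subseteq> {s. Re s > 0} \<inter> zeta_pole -` (- {0})"
    using open_contains_ball by blast
  then have r': "ball s r \<subseteq> {s. Re s > 0}" and nz: "\<And>w. w \<in> ball s r \<Longrightarrow> zeta_pole w \<noteq> 0" by blast+
  show ?thesis
    using that[OF r(1) r' holomorphic_on_subset[OF zeta_pole_holomorphic r'] _ nz, of 0] False by simp
qed

lemma mangoldt_series_limit:
  assumes s: "Re s \<ge> 1"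
  obtains m :: nat where "((\<lambda>x. of_real x * mangoldt_series (s + of_real x)) \<longlongrightarrow> (if s = 1 then 1 else 0) - of_nat m) (at_right 0)"
    "zeta_pole s = 0 \<longleftrightarrow> m > 0"
proof -
  obtain m r g where r: "r > 0" "ball s r \<subseteq> {s. Re s > 0}" and g: "g holomorphic_on ball s r"
    and fac: "\<And>w. w \<in> ball s r \<Longrightarrow> zeta_pole w = (w - s) ^ m * g w"
    and g0: "\<And>w. w \<in> ball s r \<Longrightarrow> g w \<noteq> 0" and m: "zeta_pole s = 0 \<longleftrightarrow> m > 0"
    using zeta_pole_factor[of s] s by (metis less_le_trans zero_less_one)
  let ?R = "\<lambda>x::real. of_real x / (s + of_real x - 1) - of_nat m - of_real x * (deriv g (s + of_real x) / g (s + of_real x))"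
  have alg: "Z * (X * L) = X * c - (A * X * B + X * D)" if "A * B + D = c - Z * L" for Z X L A B D c :: complex
    using that by algebra
  have eq: "?R x = of_real x * mangoldt_series (s + of_real x)" if x: "0 < x" "x < r" for x
  proof -
    define w where "w = s + of_real x"
    have w: "w \<in> ball s r" "Re w > 1" "w \<noteq> s" "w \<noteq> 1" using x s by (auto simp: w_def dist_norm complex_eq_iff)
    have ws: "w - s = of_real x" by (simp add: w_def)
    have "(g has_field_derivative deriv g w) (at w)"
      using holomorphic_derivI[OF g _ w(1)] by simp
    then have "((\<lambda>w. (w - s) ^ m * g w) has_field_derivative
        (of_nat m * (w - s) ^ (m - 1) * g w + (w - s) ^ m * deriv g w)) (at w)"
      by (auto intro!: derivative_eq_intros)
    then have "(zeta_pole has_field_derivative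
        (of_nat m * (w - s) ^ (m - 1) * g w + (w - s) ^ m * deriv g w)) (at w)"
      by (rule has_field_derivative_transform_within_open[OF _ open_ball w(1)]) (use fac in auto)
    from DERIV_unique[OF this zeta_pole_deriv[OF w(2)]]
    have 1: "of_nat m * (w - s) ^ (m - 1) * g w + (w - s) ^ m * deriv g w = zeta_sum w - zeta_pole w * mangoldt_series w" .
    have Z: "zeta_pole w = (w - s) ^ m * g w" "zeta_pole w \<noteq> 0" using fac[OF w(1)] g0[OF w(1)] w(3) by auto
    have zs: "zeta_sum w = zeta_pole w / (w - 1)" using zeta_pole_eq[OF w(2)] w(4) by simp
    have pm: "of_nat m * (w - s) ^ (m - 1) * (w - s) = of_nat m * (w - s) ^ m" by (cases m) auto
    have "zeta_pole w * ((w - s) * mangoldt_series w)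
       = (w - s) * zeta_sum w - (of_nat m * (w - s) ^ (m - 1) * (w - s) * g w + (w - s) * ((w - s) ^ m * deriv g w))"
      by (rule alg[OF 1])
    also have "\<dots> = zeta_pole w * ((w - s) / (w - 1) - of_nat m - (w - s) * (deriv g w / g w))"
      unfolding pm zs using g0[OF w(1)] by (simp add: Z(1) field_simps)
    finally show ?thesis using Z(2) unfolding w_def by simp
  qed
  have lim_s: "((\<lambda>x::real. s + of_real x) \<longlongrightarrow> s) (at_right 0)"
    by (auto intro!: tendsto_eq_intros)
  have sb: "s \<in> ball s r" using r by simp
  have "isCont (\<lambda>w. deriv g w / g w) s"
  proof -
    have "(\<lambda>w. deriv g w / g w) holomorphic_on ball s r"
      using g g0 by (intro holomorphic_intros) auto
    then show ?thesis
      using holomorphic_on_imp_continuous_on continuous_on_eq_continuous_at[OF open_ball] sb by blast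
  qed
  then have gl: "((\<lambda>x. deriv g (s + of_real x) / g (s + of_real x)) \<longlongrightarrow> deriv g s / g s) (at_right 0)"
    by (rule isCont_tendsto_compose[OF _ lim_s])
  have "((\<lambda>x::real. of_real x :: complex) \<longlongrightarrow> 0) (at_right 0)"
    by (auto intro!: tendsto_eq_intros)
  from tendsto_mult[OF this gl]
  have l1: "((\<lambda>x. of_real x * (deriv g (s + of_real x) / g (s + of_real x))) \<longlongrightarrow> 0) (at_right 0)"
    by simp
  have l2: "((\<lambda>x::real. of_real x / (s + of_real x - 1)) \<longlongrightarrow> (if s = 1 then 1 else 0)) (at_right 0)"
  proof (cases "s = 1")
    case True
    have "eventually (\<lambda>x::real. 1 = of_real x / (s + of_real x - 1)) (at_right 0)"
      using True by (auto simp: eventually_at_filter)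
    then show ?thesis using True by (simp add: tendsto_eventually eventually_mono)
  next
    case False
    then show ?thesis by (auto intro!: tendsto_eq_intros)
  qed
  have lim: "(?R \<longlongrightarrow> (if s = 1 then 1 else 0) - of_nat m - 0) (at_right 0)"
    by (intro tendsto_diff l1 l2 tendsto_const)
  have "eventually (\<lambda>x. ?R x = of_real x * mangoldt_series (s + of_real x)) (at_right 0)"
    using eq r(1) by (auto simp: eventually_at_right_field)
  from Lim_transform_eventually[OF lim this] have "((\<lambda>x. of_real x * mangoldt_series (s + of_real x)) \<longlongrightarrow> (if s = 1 then 1 else 0) - of_nat m) (at_right 0)"
    by simp
  then show ?thesis using that m by blast
qed

lemma mangoldt_series_341:
  assumes x: "x > 1"
  shows "3 * Re (mangoldt_series (of_real x)) + 4 * Re (mangoldt_series (of_real x + \<i> * of_real t))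
     + Re (mangoldt_series (of_real x + \<i> * of_real (2 * t))) \<ge> 0"
proof -
  have Re: "(\<lambda>n. mangoldt (Suc n) * (real (Suc n) powr (- x) * cos (u * ln (real (Suc n)))))
      sums Re (mangoldt_series (of_real x + \<i> * of_real u))" for u
  proof -
    have eq: "Re (mangoldt (Suc n) * of_nat (Suc n) powr (- (of_real x + \<i> * of_real u)))
        = mangoldt (Suc n) * (real (Suc n) powr (- x) * cos (u * ln (real (Suc n))))" for n
    proof -
      have Ln: "Ln (of_nat (Suc n)) = of_real (ln (real (Suc n)))"
        using Ln_of_real[of "real (Suc n)"] by simp
      have nz: "(of_nat (Suc n) :: complex) \<noteq> 0" by (simp del: of_nat_Suc)
      have "Re (of_nat (Suc n) powr (- (of_real x + \<i> * of_real u))) = real (Suc n) powr (- x) * cos (u * ln (real (Suc n)))"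
        using nz unfolding powr_def Ln
        by (simp add: Re_exp powr_def exp_minus field_simps del: of_nat_Suc)
      then show ?thesis by (simp del: of_nat_Suc)
    qed
    have "Re (of_real x + \<i> * of_real u) > 1" using x by simp
    from sums_Re[OF mangoldt_series_sums[OF this]] show ?thesis unfolding eq .
  qed
  have "(\<lambda>n. 3 * (mangoldt (Suc n) * (real (Suc n) powr (- x) * cos (0 * ln (real (Suc n)))))
      + 4 * (mangoldt (Suc n) * (real (Suc n) powr (- x) * cos (t * ln (real (Suc n)))))
      + mangoldt (Suc n) * (real (Suc n) powr (- x) * cos (2 * t * ln (real (Suc n)))))
     sums (3 * Re (mangoldt_series (of_real x)) + 4 * Re (mangoldt_series (of_real x + \<i> * of_real t))
     + Re (mangoldt_series (of_real x + \<i> * of_real (2 * t))))"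
    using Re[of 0] by (intro sums_add sums_mult Re) simp
  moreover have "3 * (mangoldt (Suc n) * (real (Suc n) powr (- x) * cos (0 * ln (real (Suc n)))))
      + 4 * (mangoldt (Suc n) * (real (Suc n) powr (- x) * cos (t * ln (real (Suc n)))))
      + mangoldt (Suc n) * (real (Suc n) powr (- x) * cos (2 * t * ln (real (Suc n)))) \<ge> 0" for n
  proof -
    define c where "c = cos (t * ln (real (Suc n)))"
    have c2: "cos (2 * t * ln (real (Suc n))) = 2 * c ^ 2 - 1"
      unfolding c_def by (subst cos_double_cos[symmetric]) (simp add: mult_ac)
    have "3 * (mangoldt (Suc n) * (real (Suc n) powr (- x) * cos (0 * ln (real (Suc n)))))
      + 4 * (mangoldt (Suc n) * (real (Suc n) powr (- x) * cos (t * ln (real (Suc n)))))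
      + mangoldt (Suc n) * (real (Suc n) powr (- x) * cos (2 * t * ln (real (Suc n))))
      = 2 * (mangoldt (Suc n) * real (Suc n) powr (- x) * (1 + c) ^ 2)"
      unfolding c2 c_def[symmetric] by (simp add: power2_eq_square algebra_simps del: of_nat_Suc)
    also have "\<dots> \<ge> 0" by (intro mult_nonneg_nonneg mangoldt_nonneg) auto
    finally show ?thesis .
  qed
  ultimately show ?thesis by (rule sums_le[OF _ sums_zero, rotated])
qed

lemma zeta_pole_nonzero:
  assumes s: "Re s \<ge> 1"
  shows "zeta_pole s \<noteq> 0"
proof (cases "Re s > 1")
  case True
  obtain m :: nat where m: "((\<lambda>x. of_real x * mangoldt_series (s + of_real x)) \<longlongrightarrow> (if s = 1 then 1 else 0) - of_nat m) (at_right 0)"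
    "zeta_pole s = 0 \<longleftrightarrow> m > 0"
    using mangoldt_series_limit[OF s] .
  define M where "M = (\<Sum>n. norm (mangoldt (Suc n) * of_nat (Suc n) powr (- s) :: complex))"
  have bound: "norm (mangoldt_series (s + of_real x)) \<le> M" if x: "x > 0" for x
  proof -
    have sx: "Re (s + of_real x) > 1" using True x by simp
    have "norm (mangoldt_series (s + of_real x)) \<le> (\<Sum>n. norm (mangoldt (Suc n) * of_nat (Suc n) powr (- (s + of_real x)) :: complex))"
      unfolding mangoldt_series_def by (rule summable_norm[OF summable_norm_mangoldt[OF sx]])
    also have "\<dots> \<le> M" unfolding M_def
    proof (rule suminf_le[OF _ summable_norm_mangoldt[OF sx] summable_norm_mangoldt[OF True]])
      show "norm (mangoldt (Suc n) * of_nat (Suc n) powr (- (s + of_real x)) :: complex)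
        \<le> norm (mangoldt (Suc n) * of_nat (Suc n) powr (- s) :: complex)" for n
        unfolding norm_mult norm_of_nat_powr using x mangoldt_nonneg
        by (intro mult_left_mono powr_mono) auto
    qed
    finally show ?thesis .
  qed
  have lim: "((\<lambda>x::real. x * M) \<longlongrightarrow> 0) (at_right 0)"
    by (auto intro!: tendsto_eq_intros)
  have "((\<lambda>x. of_real x * mangoldt_series (s + of_real x)) \<longlongrightarrow> 0) (at_right 0)"
    by (rule Lim_null_comparison[OF _ lim])
      (auto simp: eventually_at_filter norm_mult intro!: always_eventually mult_left_mono bound)
  from tendsto_unique[OF _ m(1) this] True have "m = 0" by (auto split: if_splits)
  then show ?thesis using m(2) by simp
next
  case False
  then have s1: "Re s = 1" using s by simp
  show ?thesis
  proof (cases "s = 1")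
    case True
    then show ?thesis using zeta_pole_1 by simp
  next
    case ns: False
    define t where "t = Im s"
    have t: "t \<noteq> 0" "s = 1 + \<i> * of_real t" using ns s1 by (auto simp: t_def complex_eq_iff)
    define s2 where "s2 = 1 + \<i> * of_real (2 * t)"
    have s2: "Re s2 \<ge> 1" "s2 \<noteq> 1" using t by (auto simp: s2_def complex_eq_iff)
    obtain m where m: "((\<lambda>x. of_real x * mangoldt_series (s + of_real x)) \<longlongrightarrow> 0 - of_nat m) (at_right 0)"
      "zeta_pole s = 0 \<longleftrightarrow> m > 0"
      using mangoldt_series_limit[OF s] ns by auto
    obtain m2 where m2: "((\<lambda>x. of_real x * mangoldt_series (s2 + of_real x)) \<longlongrightarrow> 0 - of_nat m2) (at_right 0)"
      using mangoldt_series_limit[OF s2(1)] s2(2) by auto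
    obtain m1 where m1: "((\<lambda>x. of_real x * mangoldt_series (1 + of_real x)) \<longlongrightarrow> 1 - of_nat m1) (at_right 0)"
      "zeta_pole 1 = 0 \<longleftrightarrow> m1 > 0"
      using mangoldt_series_limit[of 1] by auto
    have "m1 = 0" using m1(2) zeta_pole_1 by simp
    let ?F = "\<lambda>x::real. 3 * Re (of_real x * mangoldt_series (1 + of_real x)) + 4 * Re (of_real x * mangoldt_series (s + of_real x))
       + Re (of_real x * mangoldt_series (s2 + of_real x))"
    have "(?F \<longlongrightarrow> 3 * Re (1 - of_nat m1) + 4 * Re (0 - of_nat m) + Re (0 - of_nat m2)) (at_right 0)"
      by (intro tendsto_add tendsto_mult tendsto_const tendsto_Re m m1 m2)
    moreover have "eventually (\<lambda>x. ?F x \<ge> 0) (at_right 0)"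
      unfolding eventually_at_filter
    proof (intro always_eventually allI impI)
      fix x :: real assume "x \<noteq> 0" "x \<in> {0<..}"
      then have x: "x > 0" by simp
      have "?F x = x * (3 * Re (mangoldt_series (of_real (1 + x))) + 4 * Re (mangoldt_series (of_real (1 + x) + \<i> * of_real t))
         + Re (mangoldt_series (of_real (1 + x) + \<i> * of_real (2 * t))))"
        by (simp add: t(2) s2_def algebra_simps)
      also have "\<dots> \<ge> 0" using mangoldt_series_341[of "1 + x" t] x by (intro mult_nonneg_nonneg) auto
      finally show "?F x \<ge> 0" .
    qed
    ultimately have "3 * Re (1 - of_nat m1) + 4 * Re (0 - of_nat m) + Re (0 - of_nat m2) \<ge> 0"
      by (intro tendsto_lowerbound) auto
    then have "m = 0" using \<open>m1 = 0\<close> by (cases m) auto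
    then show ?thesis using m(2) by simp
  qed
qed

subsection \<open>Chebyshev's bound\<close>

definition chebyshev_psi :: "nat \<Rightarrow> real" where
  "chebyshev_psi n = (\<Sum>m\<in>{1..n}. mangoldt m)"

lemma chebyshev_psi_nonneg: "chebyshev_psi n \<ge> 0"
  unfolding chebyshev_psi_def by (intro sum_nonneg mangoldt_nonneg)

lemma chebyshev_psi_mono: "m \<le> n \<Longrightarrow> chebyshev_psi m \<le> chebyshev_psi n"
  unfolding chebyshev_psi_def by (intro sum_mono2) (auto simp: mangoldt_nonneg)

lemma ln_fact_eq: "ln (fact n) = (\<Sum>d\<in>{1..N}. mangoldt d * real (n div d))" if "n \<le> N"
proof -
  have "ln (fact n :: real) = (\<Sum>m\<in>{1..n}. ln (real m))"
    by (subst ln_prod[symmetric]) (auto simp: fact_prod)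
  also have "\<dots> = (\<Sum>m\<in>{1..n}. \<Sum>d | d dvd m. mangoldt d)"
    using mangoldt_sum[where ?'a = real] by (intro sum.cong) auto
  also have "\<dots> = (\<Sum>m\<in>{1..n}. \<Sum>d\<in>{1..N}. if d dvd m then mangoldt d else 0)"
  proof (rule sum.cong)
    fix m assume m: "m \<in> {1..n}"
    have "1 \<le> d \<and> d \<le> N" if "d dvd m" for d
      using dvd_imp_le[OF that] dvd_pos_nat[OF _ that] m \<open>n \<le> N\<close> by auto
    then have "{d. d dvd m} = {1..N} \<inter> {d. d dvd m}" by auto
    then show "(\<Sum>d | d dvd m. mangoldt d) = (\<Sum>d\<in>{1..N}. if d dvd m then mangoldt d else (0::real))"
      by (simp add: sum.If_cases)
  qed simp
  also have "\<dots> = (\<Sum>d\<in>{1..N}. \<Sum>m\<in>{1..n}. if d dvd m then mangoldt d else 0)" by (rule sum.swap)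
  also have "\<dots> = (\<Sum>d\<in>{1..N}. mangoldt d * real (n div d))"
  proof (rule sum.cong)
    fix d assume d: "d \<in> {1..N}"
    have "{1..n} \<inter> {m. d dvd m} = (\<lambda>j. d * j) ` {1..n div d}"
    proof (intro equalityI subsetI)
      fix m assume "m \<in> {1..n} \<inter> {m. d dvd m}"
      then obtain j where "m = d * j" "1 \<le> m" "m \<le> n" by auto
      then show "m \<in> (\<lambda>j. d * j) ` {1..n div d}"
        using d by (auto simp: image_iff less_eq_div_iff_mult_less_eq mult.commute Suc_le_eq)
    next
      fix m assume "m \<in> (\<lambda>j. d * j) ` {1..n div d}"
      then show "m \<in> {1..n} \<inter> {m. d dvd m}"
        using d by (auto simp: less_eq_div_iff_mult_less_eq mult.commute Suc_le_eq)
    qed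
    then have "card ({1..n} \<inter> {m. d dvd m}) = n div d"
      using d by (simp add: card_image inj_on_def)
    then show "(\<Sum>m\<in>{1..n}. if d dvd m then mangoldt d else 0) = mangoldt d * real (n div d)"
      by (simp add: sum.If_cases)
  qed simp
  finally show ?thesis .
qed

lemma chebyshev_psi_double: "chebyshev_psi (2 * n) - chebyshev_psi n \<le> 2 * real n"
proof -
  have "chebyshev_psi (2 * n) - chebyshev_psi n = (\<Sum>d\<in>{1..2 * n}. if d > n then mangoldt d else 0)"
  proof -
    have eq: "{1..2 * n} \<inter> {d. d > n} = {1..2 * n} - {1..n}" by auto
    have "(\<Sum>d\<in>{1..2 * n} - {1..n}. mangoldt d :: real) = chebyshev_psi (2 * n) - chebyshev_psi n"
      unfolding chebyshev_psi_def by (rule sum_diff) auto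
    then show ?thesis by (simp add: sum.If_cases eq[simplified])
  qed
  also have "\<dots> \<le> (\<Sum>d\<in>{1..2 * n}. mangoldt d * (real (2 * n div d) - 2 * real (n div d)))"
  proof (rule sum_mono)
    fix d assume d: "d \<in> {1..2 * n}"
    have "2 * (n div d) * d \<le> 2 * n" using div_times_less_eq_dividend[of n d] by linarith
    then have "2 * (n div d) \<le> 2 * n div d" using d by (simp add: less_eq_div_iff_mult_less_eq)
    then have nn: "real (2 * n div d) - 2 * real (n div d) \<ge> 0" by linarith
    show "(if d > n then mangoldt d else 0) \<le> mangoldt d * (real (2 * n div d) - 2 * real (n div d))"
    proof (cases "d > n")
      case True
      then have "n div d = 0" by simp
      moreover have "1 \<le> 2 * n div d" using d by (simp add: less_eq_div_iff_mult_less_eq)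
      ultimately show ?thesis using True mangoldt_nonneg[of d] mult_left_mono[of 1 "real (2 * n div d)" "mangoldt d"] by simp
    next
      case False
      then show ?thesis using nn mangoldt_nonneg[of d] by simp
    qed
  qed
  also have "\<dots> = ln (fact (2 * n)) - 2 * ln (fact n)"
    using ln_fact_eq[of "2 * n" "2 * n"] ln_fact_eq[of n "2 * n"]
    by (simp add: algebra_simps sum_subtractf sum_distrib_left)
  also have "\<dots> = ln (real ((2 * n) choose n))"
  proof -
    have "real ((2 * n) choose n) = fact (2 * n) / (fact n * fact n)"
      using binomial_fact[of n "2 * n", where ?'a = real] by (simp add: mult_2)
    then show ?thesis by (simp add: ln_div ln_mult)
  qed
  also have "\<dots> \<le> ln (2 ^ (2 * n))"
  proof (rule ln_mono)
    have "real ((2 * n) choose n) \<le> real (2 ^ (2 * n))" using binomial_le_pow2[of "2 * n" n] by (simp only: of_nat_le_iff)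
    then show "real ((2 * n) choose n) \<le> 2 ^ (2 * n)" by simp
  qed simp
  also have "\<dots> = real (2 * n) * ln 2" by (simp add: ln_realpow)
  also have "\<dots> \<le> real (2 * n) * 1" using ln_2_less_1 by (intro mult_left_mono) auto
  finally show ?thesis by simp
qed

lemma chebyshev_psi_le: "chebyshev_psi n \<le> 4 * real n"
proof (cases "n = 0")
  case False
  have pow: "chebyshev_psi (2 ^ j) \<le> 2 * 2 ^ j" for j
  proof (induction j)
    case (Suc j)
    then show ?case using chebyshev_psi_double[of "2 ^ j"] by simp
  qed (simp add: chebyshev_psi_def)
  obtain j where j: "2 ^ j \<le> n" "n < 2 ^ (j + 1)" using ex_power_ivl1[of 2 n] False by auto
  have "chebyshev_psi n \<le> chebyshev_psi (2 ^ (j + 1))" using j by (intro chebyshev_psi_mono) auto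
  also have "\<dots> \<le> 2 * 2 ^ (j + 1)" by (rule pow)
  also have "\<dots> = 4 * real (2 ^ j)" by simp
  also have "\<dots> \<le> 4 * real n" using j(1) by (simp only: of_nat_le_iff mult_le_cancel_left_pos zero_less_numeral)
  finally show ?thesis .
qed (simp add: chebyshev_psi_def)

subsection \<open>Newman's Tauberian theorem\<close>

lemma powr_diff_MVT:
  fixes a u :: real
  assumes "a > 0"
  obtains \<xi> where "a < \<xi>" "\<xi> < a + 1" "(a + 1) powr u - a powr u = u * \<xi> powr (u - 1)"
proof -
  have "\<exists>\<xi>>a. \<xi> < a + 1 \<and> (a + 1) powr u - a powr u = (a + 1 - a) * (u * \<xi> powr (u - 1))"
    by (rule MVT2) (use assms in \<open>auto intro!: derivative_eq_intros\<close>)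
  then show ?thesis using that by auto
qed

lemma sum_powr_tail_le:
  assumes x: "x > 0" and N: "N \<ge> 1"
  shows "(\<Sum>n\<in>{N<..M}. real n powr (- 1 - x)) \<le> real N powr (- x) / x"
proof (cases "N \<le> M")
  case True
  have "(\<Sum>n\<in>{N<..M}. real n powr (- 1 - x)) \<le> (real N powr (- x) - real M powr (- x)) / x"
    using True
  proof (induction M rule: dec_induct)
    case (step M)
    obtain \<xi> where \<xi>: "real M < \<xi>" "\<xi> < real M + 1" "(real M + 1) powr (- x) - real M powr (- x) = - x * \<xi> powr (- x - 1)"
      using powr_diff_MVT[of "real M" "- x"] step N by auto
    have "real (Suc M) powr (- 1 - x) \<le> \<xi> powr (- 1 - x)"
      using \<xi> x step N by (intro powr_mono2') auto
    then have "x * real (Suc M) powr (- 1 - x) \<le> x * \<xi> powr (- 1 - x)" using x by simp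
    also have "\<dots> = real M powr (- x) - real (Suc M) powr (- x)"
    proof -
      have "- 1 - x = - x - 1" by simp
      then show ?thesis using \<xi>(3) by (simp only: of_nat_Suc) (simp add: add.commute)
    qed
    finally have "x * real (Suc M) powr (- 1 - x) \<le> real M powr (- x) - real (Suc M) powr (- x)" .
    then have "real (Suc M) powr (- 1 - x) \<le> (real M powr (- x) - real (Suc M) powr (- x)) / x"
      using x by (simp add: field_simps)
    moreover have "{N<..Suc M} = insert (Suc M) {N<..M}" using step by auto
    ultimately show ?case using step.IH by (simp add: diff_divide_distrib)
  qed simp
  also have "\<dots> \<le> real N powr (- x) / x" using x by (simp add: divide_right_mono)
  finally show ?thesis .
qed (use x in simp)

lemma sum_powr_head_le:
  assumes u: "u > 0" and N: "N \<ge> 1"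
  shows "(\<Sum>n\<in>{1..N}. real n powr (u - 1)) \<le> real N powr u / u + real N powr (u - 1)"
proof (cases "u \<ge> 1")
  case True
  show ?thesis using N
  proof (induction N rule: dec_induct)
    case (step N)
    obtain \<xi> where \<xi>: "real N < \<xi>" "\<xi> < real N + 1" "(real N + 1) powr u - real N powr u = u * \<xi> powr (u - 1)"
      using powr_diff_MVT[of "real N" u] step by auto
    have "real N powr (u - 1) \<le> \<xi> powr (u - 1)" using \<xi> True by (intro powr_mono2) auto
    then have "u * real N powr (u - 1) \<le> real (Suc N) powr u - real N powr u" using \<xi>(3) u by (simp add: add.commute)
    then have "real N powr (u - 1) \<le> (real (Suc N) powr u - real N powr u) / u"
      using u by (simp add: field_simps)
    then show ?case using step.IH by (simp add: diff_divide_distrib)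
  qed (use u in simp)
next
  case False
  have "(\<Sum>n\<in>{1..N}. real n powr (u - 1)) \<le> real N powr u / u" using N
  proof (induction N rule: dec_induct)
    case base
    then show ?case using u False by simp
  next
    case (step N)
    obtain \<xi> where \<xi>: "real N < \<xi>" "\<xi> < real N + 1" "(real N + 1) powr u - real N powr u = u * \<xi> powr (u - 1)"
      using powr_diff_MVT[of "real N" u] step by auto
    have "real (Suc N) powr (u - 1) \<le> \<xi> powr (u - 1)" using \<xi> False step by (intro powr_mono2') auto
    then have "u * real (Suc N) powr (u - 1) \<le> real (Suc N) powr u - real N powr u" using \<xi>(3) u by (simp add: add.commute)
    then have "real (Suc N) powr (u - 1) \<le> (real (Suc N) powr u - real N powr u) / u"
      using u by (simp add: field_simps)
    then show ?case using step.IH by (simp add: diff_divide_distrib)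
  qed
  then show ?thesis by (simp add: add_increasing2)
qed

lemma has_contour_integral_inverse_part_circlepath:
  assumes "R > 0"
  shows "((\<lambda>z. 1 / z) has_contour_integral \<i> * of_real (t - s)) (part_circlepath 0 R s t)"
proof -
  have "((\<lambda>x. \<i> * of_real (t - s)) has_integral \<i> * of_real (t - s)) {0..1::real}"
    using has_integral_const_real[of "\<i> * of_real (t - s)" 0 1] by simp
  then show ?thesis
    unfolding has_contour_integral_def
  proof (rule has_integral_eq[rotated])
    fix x :: real assume "x \<in> {0..1}"
    then have vd: "vector_derivative (part_circlepath 0 R s t) (at x within {0..1})
        = \<i> * R * (of_real t - of_real s) * exp (\<i> * linepath s t x)"
      by (intro vector_derivative_part_circlepath01) auto
    show "\<i> * of_real (t - s) = 1 / part_circlepath 0 R s t x * vector_derivative (part_circlepath 0 R s t) (at x within {0..1})"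
      unfolding vd using assms by (simp add: part_circlepath_def)
  qed
qed

lemma newman_kernel:
  fixes R :: real
  assumes "norm z = R" "R > 0"
  shows "norm (1 / z + z / of_real R ^ 2) = 2 * \<bar>Re z\<bar> / R ^ 2"
proof -
  have "z \<noteq> 0" using assms by auto
  have "1 / z = cnj z / of_real R ^ 2"
    using complex_div_cnj[of 1 z] assms by simp
  then have "1 / z + z / of_real R ^ 2 = of_real (2 * Re z / R ^ 2)"
    by (simp add: add_divide_distrib[symmetric] complex_add_cnj add.commute)
  then show ?thesis using assms by (simp only: norm_of_real abs_divide abs_mult) simp
qed

lemma part_circlepath_right_half:
  assumes "R \<ge> 0" "z \<in> path_image (part_circlepath 0 R (- pi / 2) (pi / 2))"
  shows "norm z = R" "Re z \<ge> 0"
proof -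
  obtain x where x: "z = R * exp (\<i> * of_real x)" "- pi / 2 \<le> x" "x \<le> pi / 2"
    using assms(2) by (subst (asm) path_image_part_circlepath) auto
  show "norm z = R" using assms(1) x by (simp add: norm_mult)
  have "Re z = R * cos x" using x by (simp flip: cis_conv_exp)
  moreover have "cos x \<ge> 0" using x by (intro cos_ge_zero) auto
  ultimately show "Re z \<ge> 0" using mult_nonneg_nonneg[OF assms(1), of "cos x"] by linarith
qed

lemma part_circlepath_left_half:
  assumes "R \<ge> 0" "z \<in> path_image (part_circlepath 0 R (pi / 2) (3 * pi / 2))"
  shows "norm z = R" "Re z \<le> 0"
proof -
  obtain x where x: "z = R * exp (\<i> * of_real x)" "pi / 2 \<le> x" "x \<le> 3 * pi / 2"
    using assms(2) by (subst (asm) path_image_part_circlepath) auto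
  show "norm z = R" using assms(1) x by (simp add: norm_mult)
  have "Re z = - (R * cos (x - pi))" using x by (simp add: cos_diff flip: cis_conv_exp)
  moreover have "cos (x - pi) \<ge> 0" using x by (intro cos_ge_zero) auto
  ultimately show "Re z \<le> 0" using mult_nonneg_nonneg[OF assms(1), of "cos (x - pi)"] by linarith
qed

text \<open>
  The partial sum \<open>G N\<close> is compared with \<open>g\<close> on the right half of the circle \<open>|z| = R\<close> and, being entire,
  integrated by itself over the left half; both contribute \<open>O(B / R)\<close>. What remains is \<open>g\<close> on the
  imaginary axis, where integration by parts against \<open>N\<^sup>z\<close> gives \<open>O(1 / ln N)\<close>; no shift of the contour
  is needed because \<open>g 0 = 0\<close> removes the pole.
\<close>

lemma newman_aux:
  fixes b :: "nat \<Rightarrow> complex"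
  assumes b: "\<And>n. norm (b n) \<le> B" and U: "open U" "{z. Re z \<ge> 0} \<subseteq> U" and g: "g holomorphic_on U"
    and sums: "\<And>z. Re z > 0 \<Longrightarrow> (\<lambda>n. b (Suc n) * of_nat (Suc n) powr (- 1 - z)) sums g z"
    and g0: "g 0 = 0"
  shows "(\<lambda>N. \<Sum>n\<in>{1..N}. b n / of_nat n) \<longlonglongrightarrow> 0"
proof -
  have B: "B \<ge> 0" using order_trans[OF norm_ge_zero b] .
  define G where "G N z = (\<Sum>n\<in>{1..N}. b n * of_nat n powr (- 1 - z))" for N z
  have G0: "G N 0 = (\<Sum>n\<in>{1..N}. b n / of_nat n)" for N
    unfolding G_def by (intro sum.cong) (auto simp: powr_minus field_simps)
  have main: "\<exists>C. \<forall>N\<ge>2. norm (G N 0) \<le> 2 * B / R + B / N + C / ln (real N)" if R: "R > 0" for R :: real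
  proof -
    let ?Cp = "part_circlepath 0 R (- pi / 2) (pi / 2)" and ?Cm = "part_circlepath 0 R (pi / 2) (3 * pi / 2)"
    let ?L = "linepath (\<i> * of_real R) (- \<i> * of_real R)"
    define k where "k z = 1 / z + z / of_real R ^ 2" for z :: complex
    have ends: "pathstart ?Cp = - \<i> * of_real R" "pathfinish ?Cp = \<i> * of_real R"
      "pathstart ?Cm = \<i> * of_real R" "pathfinish ?Cm = - \<i> * of_real R"
    proof -
      have c3: "cos (3 * pi / 2) = 0" "sin (3 * pi / 2) = - 1"
        by (simp_all only: times_divide_eq_left[symmetric] cos_3over2_pi sin_3over2_pi)
      have e: "exp (\<i> * of_real (pi / 2)) = \<i>" "exp (\<i> * of_real (- pi / 2)) = - \<i>" "exp (\<i> * of_real (3 * pi / 2)) = - \<i>"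
        unfolding cis_conv_exp[symmetric] by (simp_all add: complex_eq_iff c3)
      show "pathstart ?Cp = - \<i> * of_real R" "pathfinish ?Cp = \<i> * of_real R"
        "pathstart ?Cm = \<i> * of_real R" "pathfinish ?Cm = - \<i> * of_real R"
        using e by (simp_all add: pathstart_part_circlepath pathfinish_part_circlepath mult.commute)
    qed
    define q where "q z = (if z = 0 then deriv g 0 else (g z - g 0) / (z - 0)) + g z * z / of_real R ^ 2" for z
    have q: "q holomorphic_on U"
      unfolding q_def by (intro holomorphic_intros pole_lemma_open g U) simp
    have qk: "q z = g z * k z" if "z \<noteq> 0" for z
      using that g0 by (simp add: q_def k_def algebra_simps)
    have LU: "closed_segment (\<i> * of_real R) (- \<i> * of_real R) \<subseteq> {z. Re z = 0}"
      by (auto simp: closed_segment_def)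
    then have LU': "closed_segment (\<i> * of_real R) (- \<i> * of_real R) \<subseteq> U" using U(2) by force
    have q': "deriv q holomorphic_on U" using q U(1) by (rule holomorphic_deriv)
    have "bounded (q ` closed_segment (\<i> * of_real R) (- \<i> * of_real R))"
      by (intro compact_imp_bounded compact_continuous_image continuous_on_subset[OF holomorphic_on_imp_continuous_on[OF q] LU']) auto
    then obtain M1 where M1: "\<And>z. z \<in> closed_segment (\<i> * of_real R) (- \<i> * of_real R) \<Longrightarrow> norm (q z) \<le> M1"
      by (auto simp: bounded_iff)
    have "bounded (deriv q ` closed_segment (\<i> * of_real R) (- \<i> * of_real R))"
      by (intro compact_imp_bounded compact_continuous_image continuous_on_subset[OF holomorphic_on_imp_continuous_on[OF q'] LU']) auto
    then obtain M2 where M2: "\<And>z. z \<in> closed_segment (\<i> * of_real R) (- \<i> * of_real R) \<Longrightarrow> norm (deriv q z) \<le> M2"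
      by (auto simp: bounded_iff)
    have M12: "M1 \<ge> 0" "M2 \<ge> 0"
      using order_trans[OF norm_ge_zero M1[of "\<i> * of_real R"]] order_trans[OF norm_ge_zero M2[of "\<i> * of_real R"]] by auto
    have "norm (G N 0) \<le> 2 * B / R + B / N + (2 * M1 + M2 * (2 * R)) / ln (real N)" if N: "N \<ge> 2" for N
    proof -
      define e where "e z = (of_nat N powr z :: complex)" for z
      have lnN: "ln (real N) > 0" using N by simp
      have ne: "norm (e z) = real N powr Re z" for z unfolding e_def by (rule norm_of_nat_powr)
      have e_hol: "e holomorphic_on S" for S unfolding e_def by (intro holomorphic_intros)
      have e_der: "(e has_field_derivative of_real (ln (real N)) * e z) (at z)" for z
      proof -
        have "Ln (of_nat N) = of_real (ln (real N))" using Ln_of_real[of "real N"] N by simp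
        then show ?thesis unfolding e_def using has_field_derivative_powr_right[of "of_nat N" z] N by simp
      qed
      have G_hol: "G N holomorphic_on S" for S
        unfolding G_def by (intro holomorphic_intros)
      have kc: "continuous_on (- {0}) k" unfolding k_def using R by (intro continuous_intros) auto
      have Cp_sub: "path_image ?Cp \<subseteq> {z. Re z \<ge> 0} - {0}" "path_image ?Cp \<subseteq> - {0}" "path_image ?Cp \<subseteq> U"
        using part_circlepath_right_half[of R] R U(2) by force+
      have Cm_sub: "path_image ?Cm \<subseteq> - {0}" using part_circlepath_left_half[of R] R by force
      have cont: "continuous_on S (G N)" "continuous_on S e" for S
        by (intro holomorphic_on_imp_continuous_on G_hol e_hol)+
      have int_G: "(\<lambda>z. G N z * e z * k z) contour_integrable_on ?Cp" "(\<lambda>z. G N z * e z * k z) contour_integrable_on ?Cm"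
        by (intro contour_integrable_continuous_part_circlepath continuous_on_mult cont
            continuous_on_subset[OF kc] Cp_sub(2) Cm_sub)+
      have int_g: "(\<lambda>z. g z * e z * k z) contour_integrable_on ?Cp"
        by (intro contour_integrable_continuous_part_circlepath continuous_on_mult cont continuous_on_subset[OF kc]
            continuous_on_subset[OF holomorphic_on_imp_continuous_on[OF g]] Cp_sub)
      let ?I = contour_integral
      have 1: "?I ?Cp (\<lambda>z. G N z * e z * k z) + ?I ?Cm (\<lambda>z. G N z * e z * k z) = 2 * of_real pi * \<i> * G N 0"
      proof -
        define F where "F z = G N z * e z" for z
        have F: "F holomorphic_on UNIV" unfolding F_def by (intro holomorphic_intros G_hol e_hol)
        have F0: "F 0 = G N 0" using N by (simp add: F_def e_def)
        define h where "h z = (if z = 0 then deriv F 0 else (F z - F 0) / (z - 0)) + F z * z / of_real R ^ 2" for z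
        have h: "h holomorphic_on UNIV" unfolding h_def by (intro holomorphic_intros pole_lemma_open F) auto
        have "(h has_contour_integral 0) (?Cp +++ ?Cm)"
          by (rule Cauchy_theorem_convex_simple[OF h]) (use ends in auto)
        moreover have "(h has_contour_integral ?I ?Cp h + ?I ?Cm h) (?Cp +++ ?Cm)"
          by (intro has_contour_integral_join has_contour_integral_integral)
            (auto intro!: contour_integrable_continuous_part_circlepath
              continuous_on_subset[OF holomorphic_on_imp_continuous_on[OF h]])
        ultimately have h0: "?I ?Cp h + ?I ?Cm h = 0" by (rule has_contour_integral_unique[symmetric])
        have i1: "((\<lambda>z. F 0 * (1 / z) + h z) has_contour_integral F 0 * (\<i> * of_real (pi / 2 - (- pi / 2))) + ?I ?Cp h) ?Cp"
          by (intro has_contour_integral_add has_contour_integral_lmul has_contour_integral_inverse_part_circlepath R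
              has_contour_integral_integral contour_integrable_continuous_part_circlepath
              continuous_on_subset[OF holomorphic_on_imp_continuous_on[OF h]]) auto
        have i2: "((\<lambda>z. F 0 * (1 / z) + h z) has_contour_integral F 0 * (\<i> * of_real (3 * pi / 2 - pi / 2)) + ?I ?Cm h) ?Cm"
          by (intro has_contour_integral_add has_contour_integral_lmul has_contour_integral_inverse_part_circlepath R
              has_contour_integral_integral contour_integrable_continuous_part_circlepath
              continuous_on_subset[OF holomorphic_on_imp_continuous_on[OF h]]) auto
        have eq: "F 0 * (1 / z) + h z = G N z * e z * k z" if "z \<noteq> 0" for z
          unfolding F_def[of z, symmetric] using that by (simp add: h_def k_def field_simps)
        have "?I ?Cp (\<lambda>z. G N z * e z * k z) = F 0 * (\<i> * of_real (pi / 2 - (- pi / 2))) + ?I ?Cp h"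
          by (rule contour_integral_unique, rule has_contour_integral_eq[OF i1]) (use eq Cp_sub in blast)
        moreover have "?I ?Cm (\<lambda>z. G N z * e z * k z) = F 0 * (\<i> * of_real (3 * pi / 2 - pi / 2)) + ?I ?Cm h"
          by (rule contour_integral_unique, rule has_contour_integral_eq[OF i2]) (use eq Cm_sub in blast)
        ultimately show ?thesis using h0 F0 by (simp add: algebra_simps)
      qed
      have 2: "?I ?Cp (\<lambda>z. g z * e z * k z) = - ?I ?L (\<lambda>z. e z * q z)"
      proof -
        have eqh: "(\<lambda>z. e z * q z) holomorphic_on U" by (intro holomorphic_intros e_hol q)
        have c: "continuous_on U (\<lambda>z. e z * q z)" using eqh by (rule holomorphic_on_imp_continuous_on)
        have "((\<lambda>z. e z * q z) has_contour_integral 0) (?Cp +++ ?L)"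
        proof (rule Cauchy_theorem_convex[where S = "{z. Re z \<ge> 0}" and K = "{}"])
          show "continuous_on {z. Re z \<ge> 0} (\<lambda>z. e z * q z)" by (rule continuous_on_subset[OF c U(2)])
          show "convex {z. Re z \<ge> 0}" by (rule convex_halfspace_Re_ge)
          show "(\<lambda>z. e z * q z) field_differentiable at x" if "x \<in> interior {z. Re z \<ge> 0} - {}" for x
            using that U interior_subset holomorphic_on_imp_differentiable_at[OF eqh U(1)] by blast
          show "path_image (?Cp +++ ?L) \<subseteq> {z. Re z \<ge> 0}"
            using Cp_sub(1) LU by (intro subset_path_image_join) auto
        qed (use ends in auto)
        moreover have "((\<lambda>z. e z * q z) has_contour_integral ?I ?Cp (\<lambda>z. e z * q z) + ?I ?L (\<lambda>z. e z * q z)) (?Cp +++ ?L)"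
          using Cp_sub LU'
          by (intro has_contour_integral_join has_contour_integral_integral)
            (auto intro!: contour_integrable_continuous_part_circlepath contour_integrable_continuous_linepath
              continuous_on_subset[OF c])
        ultimately have "?I ?Cp (\<lambda>z. e z * q z) + ?I ?L (\<lambda>z. e z * q z) = 0"
          by (rule has_contour_integral_unique[symmetric])
        moreover have "?I ?Cp (\<lambda>z. g z * e z * k z) = ?I ?Cp (\<lambda>z. e z * q z)"
        proof (rule contour_integral_eq)
          fix z assume "z \<in> path_image ?Cp"
          then have "z \<noteq> 0" using Cp_sub(2) by blast
          then show "g z * e z * k z = e z * q z" by (simp add: qk)
        qed
        ultimately show ?thesis by (simp add: eq_neg_iff_add_eq_0)
      qed
      have b1: "norm (?I ?Cp (\<lambda>z. g z * e z * k z) - ?I ?Cp (\<lambda>z. G N z * e z * k z)) \<le> 2 * B / R ^ 2 * R * (pi / 2 - (- pi / 2))"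
      proof (rule has_contour_integral_bound_part_circlepath)
        show "((\<lambda>z. g z * e z * k z - G N z * e z * k z) has_contour_integral
           ?I ?Cp (\<lambda>z. g z * e z * k z) - ?I ?Cp (\<lambda>z. G N z * e z * k z)) ?Cp"
          by (intro has_contour_integral_diff has_contour_integral_integral int_g int_G)
        fix z assume z: "z \<in> path_image ?Cp"
        have zR: "norm z = R" "Re z \<ge> 0" using part_circlepath_right_half[OF _ z] R by auto
        have "norm (g z - G N z) * norm (e z) * norm (k z) \<le> 2 * B / R ^ 2"
        proof (cases "Re z = 0")
          case True
          then have "norm (k z) = 0" using newman_kernel[OF zR(1) R] by (simp add: k_def)
          then show ?thesis using B by simp
        next
          case False
          define x where "x = Re z"
          have x: "x > 0" using False zR by (simp add: x_def)
          have lim: "(\<lambda>M. norm ((\<Sum>n<M. b (Suc n) * of_nat (Suc n) powr (- 1 - z)) - G N z)) \<longlonglongrightarrow> norm (g z - G N z)"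
            using sums[of z] x unfolding sums_def x_def by (intro tendsto_intros) auto
          have "norm ((\<Sum>n<M. b (Suc n) * of_nat (Suc n) powr (- 1 - z)) - G N z) \<le> B * (real N powr (- x) / x)" if M: "M \<ge> N" for M
          proof -
            have "(\<Sum>n<M. b (Suc n) * of_nat (Suc n) powr (- 1 - z)) = G M z"
              unfolding G_def by (rule sum.reindex_bij_witness[of _ "\<lambda>n. n - 1" Suc]) auto
            also have "G M z - G N z = (\<Sum>n\<in>{1..M} - {1..N}. b n * of_nat n powr (- 1 - z))"
              unfolding G_def using M by (intro sum_diff[symmetric]) auto
            also have "{1..M} - {1..N} = {N<..M}" using N by auto
            finally have "norm ((\<Sum>n<M. b (Suc n) * of_nat (Suc n) powr (- 1 - z)) - G N z)
                = norm (\<Sum>n\<in>{N<..M}. b n * of_nat n powr (- 1 - z))" by simp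
            also have "\<dots> \<le> (\<Sum>n\<in>{N<..M}. B * real n powr (- 1 - x))"
              using b by (intro sum_norm_le) (auto simp: norm_mult norm_of_nat_powr x_def mult_right_mono)
            also have "\<dots> \<le> B * (real N powr (- x) / x)"
              unfolding sum_distrib_left[symmetric] using sum_powr_tail_le[OF x, of N M] N B by (intro mult_left_mono) auto
            finally show ?thesis .
          qed
          then have "norm (g z - G N z) \<le> B * (real N powr (- x) / x)"
            by (intro LIMSEQ_le_const2[OF lim]) auto
          then have "norm (g z - G N z) * norm (e z) * norm (k z) \<le> B * (real N powr (- x) / x) * (real N powr x) * (2 * x / R ^ 2)"
            using newman_kernel[OF zR(1) R] x B by (intro mult_mono) (auto simp: ne x_def k_def)
          also have "\<dots> = 2 * B / R ^ 2 * (real N powr (- x) * real N powr x)" using x by simp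
          also have "real N powr (- x) * real N powr x = 1" using N by (simp flip: powr_add)
          finally show ?thesis by simp
        qed
        then show "norm (g z * e z * k z - G N z * e z * k z) \<le> 2 * B / R ^ 2"
          by (simp add: left_diff_distrib[symmetric] norm_mult)
      qed (use B R in auto)
      have b2: "norm (?I ?Cm (\<lambda>z. G N z * e z * k z)) \<le> 2 * B / R ^ 2 * (1 + R / N) * R * (3 * pi / 2 - pi / 2)"
      proof (rule has_contour_integral_bound_part_circlepath[OF has_contour_integral_integral[OF int_G(2)]])
        fix z assume z: "z \<in> path_image ?Cm"
        have zR: "norm z = R" "Re z \<le> 0" using part_circlepath_left_half[OF _ z] R by auto
        have "norm (G N z) * norm (e z) * norm (k z) \<le> 2 * B / R ^ 2 * (1 + R / N)"
        proof (cases "Re z = 0")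
          case True
          then have "norm (k z) = 0" using newman_kernel[OF zR(1) R] by (simp add: k_def)
          then show ?thesis using B R by simp
        next
          case False
          define u where "u = - Re z"
          have u: "u > 0" "u \<le> R" using False zR abs_Re_le_cmod[of z] by (auto simp: u_def)
          have "norm (G N z) \<le> (\<Sum>n\<in>{1..N}. B * real n powr (u - 1))"
          proof -
            have "Re (- 1 - z) = u - 1" by (simp add: u_def)
            then show ?thesis
              unfolding G_def using b by (intro sum_norm_le) (simp only: norm_mult norm_of_nat_powr mult_right_mono powr_ge_zero)
          qed
          also have "\<dots> \<le> B * (real N powr u / u + real N powr (u - 1))"
            unfolding sum_distrib_left[symmetric] using sum_powr_head_le[OF u(1), of N] N B by (intro mult_left_mono) auto
          finally have le: "norm (G N z) \<le> B * (real N powr u / u + real N powr (u - 1))" .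
          have kz: "norm (k z) = 2 * u / R ^ 2"
            using newman_kernel[OF zR(1) R] zR(2) by (simp add: u_def k_def abs_of_nonpos)
          have ez: "norm (e z) = real N powr (- u)" by (simp add: ne u_def)
          have "norm (G N z) * norm (e z) * norm (k z) \<le> B * (real N powr u / u + real N powr (u - 1)) * real N powr (- u) * (2 * u / R ^ 2)"
            unfolding kz ez using u by (intro mult_right_mono[OF mult_right_mono[OF le]]) auto
          also have "\<dots> = 2 * B / R ^ 2 * ((real N powr u * real N powr (- u)) + u * (real N powr (u - 1) * real N powr (- u)))"
            using u by (simp add: field_simps)
          also have "real N powr u * real N powr (- u) = 1" using N by (simp flip: powr_add)
          also have "real N powr (u - 1) * real N powr (- u) = 1 / N" using N by (simp flip: powr_add)
          also have "2 * B / R ^ 2 * (1 + u * (1 / N)) \<le> 2 * B / R ^ 2 * (1 + R / N)"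
            using B u by (intro mult_left_mono add_left_mono) (auto simp: divide_right_mono)
          finally show ?thesis .
        qed
        then show "norm (G N z * e z * k z) \<le> 2 * B / R ^ 2 * (1 + R / N)" by (simp add: norm_mult)
      qed (use B R in auto)
      have b3: "norm (?I ?L (\<lambda>z. e z * q z)) \<le> (2 * M1 + M2 * (2 * R)) / ln (real N)"
      proof -
        define \<Lambda> where "\<Lambda> = complex_of_real (ln (real N))"
        have \<Lambda>: "\<Lambda> \<noteq> 0" "norm \<Lambda> = ln (real N)" using lnN by (auto simp: \<Lambda>_def)
        have der: "((\<lambda>z. e z * q z / \<Lambda>) has_field_derivative e z * q z + e z * deriv q z / \<Lambda>) (at z within U)" if z: "z \<in> U" for z
        proof -
          have "(q has_field_derivative deriv q z) (at z)" using holomorphic_derivI[OF q U(1) z] .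
          from DERIV_cdivide[OF DERIV_mult[OF e_der this], of \<Lambda>]
          have "((\<lambda>z. e z * q z / \<Lambda>) has_field_derivative e z * q z + e z * deriv q z / \<Lambda>) (at z)"
            using \<Lambda>(1) by (simp add: \<Lambda>_def[symmetric] field_simps)
          then show ?thesis by (rule has_field_derivative_at_within)
        qed
        have p: "((\<lambda>z. e z * q z + e z * deriv q z / \<Lambda>) has_contour_integral
            (e (- \<i> * of_real R) * q (- \<i> * of_real R) / \<Lambda> - e (\<i> * of_real R) * q (\<i> * of_real R) / \<Lambda>)) ?L"
          using contour_integral_primitive[OF der, of ?L] LU' by simp
        have c: "(\<lambda>z. e z * deriv q z / \<Lambda>) contour_integrable_on ?L"
          using LU' \<Lambda> by (intro contour_integrable_continuous_linepath continuous_intros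
            holomorphic_on_imp_continuous_on[OF e_hol] continuous_on_subset[OF holomorphic_on_imp_continuous_on[OF q']]) auto
        have "((\<lambda>z. e z * q z + e z * deriv q z / \<Lambda> - e z * deriv q z / \<Lambda>) has_contour_integral
            (e (- \<i> * of_real R) * q (- \<i> * of_real R) / \<Lambda> - e (\<i> * of_real R) * q (\<i> * of_real R) / \<Lambda>)
             - ?I ?L (\<lambda>z. e z * deriv q z / \<Lambda>)) ?L"
          by (rule has_contour_integral_diff[OF p has_contour_integral_integral[OF c]])
        then have eq: "?I ?L (\<lambda>z. e z * q z) = (e (- \<i> * of_real R) * q (- \<i> * of_real R) / \<Lambda> - e (\<i> * of_real R) * q (\<i> * of_real R) / \<Lambda>)
             - ?I ?L (\<lambda>z. e z * deriv q z / \<Lambda>)"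
          using contour_integral_unique by force
        have ne1: "norm (e z) = 1" if "z \<in> closed_segment (\<i> * of_real R) (- \<i> * of_real R)" for z
          using LU that N by (auto simp: ne)
        have t1: "norm (e z * q z / \<Lambda>) \<le> M1 / ln (real N)" if "z \<in> closed_segment (\<i> * of_real R) (- \<i> * of_real R)" for z
          using ne1[OF that] M1[OF that] lnN by (simp add: norm_mult norm_divide \<Lambda> divide_right_mono)
        have "norm (?I ?L (\<lambda>z. e z * deriv q z / \<Lambda>)) \<le> M2 / ln (real N) * norm (- \<i> * of_real R - \<i> * of_real R)"
        proof (rule has_contour_integral_bound_linepath[OF has_contour_integral_integral[OF c]])
          show "norm (e z * deriv q z / \<Lambda>) \<le> M2 / ln (real N)" if "z \<in> closed_segment (\<i> * of_real R) (- \<i> * of_real R)" for z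
            using ne1[OF that] M2[OF that] lnN by (simp add: norm_mult norm_divide \<Lambda> divide_right_mono)
        qed (use M12 lnN in simp)
        also have "norm (- \<i> * of_real R - \<i> * of_real R) = 2 * R"
        proof -
          have "- \<i> * of_real R - \<i> * of_real R = - (\<i> * of_real (2 * R))" by simp
          then show ?thesis using R by (simp only: norm_minus_cancel norm_mult norm_ii norm_of_real)
        qed
        finally have t2: "norm (?I ?L (\<lambda>z. e z * deriv q z / \<Lambda>)) \<le> M2 / ln (real N) * (2 * R)" .
        have "norm (?I ?L (\<lambda>z. e z * q z)) \<le> M1 / ln (real N) + M1 / ln (real N) + M2 / ln (real N) * (2 * R)"
          unfolding eq
          by (intro order_trans[OF norm_triangle_ineq4] add_mono t1 t2) auto
        then show ?thesis by (simp add: add_divide_distrib)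
      qed
      have "2 * of_real pi * \<i> * G N 0 = - ?I ?L (\<lambda>z. e z * q z)
         - (?I ?Cp (\<lambda>z. g z * e z * k z) - ?I ?Cp (\<lambda>z. G N z * e z * k z)) + ?I ?Cm (\<lambda>z. G N z * e z * k z)"
        using 1 2 by simp
      then have "norm (2 * of_real pi * \<i> * G N 0) \<le> norm (?I ?L (\<lambda>z. e z * q z))
         + norm (?I ?Cp (\<lambda>z. g z * e z * k z) - ?I ?Cp (\<lambda>z. G N z * e z * k z)) + norm (?I ?Cm (\<lambda>z. G N z * e z * k z))"
        using norm_triangle_ineq norm_triangle_ineq4 by (smt (verit) norm_minus_cancel)
      also have "\<dots> \<le> (2 * M1 + M2 * (2 * R)) / ln (real N) + 2 * B / R ^ 2 * R * (pi / 2 - (- pi / 2))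
         + 2 * B / R ^ 2 * (1 + R / N) * R * (3 * pi / 2 - pi / 2)"
        by (intro add_mono b1 b2 b3)
      also have "2 * B / R ^ 2 * R * (pi / 2 - (- pi / 2)) = 2 * pi * (B / R)" using R by (simp add: power2_eq_square)
      also have "2 * B / R ^ 2 * (1 + R / N) * R * (3 * pi / 2 - pi / 2) = 2 * pi * (B / R + B / N)"
        using R N by (simp add: power2_eq_square field_simps)
      finally have "2 * pi * norm (G N 0) \<le> (2 * M1 + M2 * (2 * R)) / ln (real N) + 2 * pi * (2 * B / R + B / N)"
        by (simp add: norm_mult algebra_simps)
      moreover have "(2 * M1 + M2 * (2 * R)) / ln (real N) \<le> 2 * pi * ((2 * M1 + M2 * (2 * R)) / ln (real N))"
      proof -
        have "(2 * M1 + M2 * (2 * R)) / ln (real N) \<ge> 0" using M12 lnN R by (intro divide_nonneg_nonneg add_nonneg_nonneg) auto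
        then have "1 * ((2 * M1 + M2 * (2 * R)) / ln (real N)) \<le> (2 * pi) * ((2 * M1 + M2 * (2 * R)) / ln (real N))"
          using pi_ge_two by (intro mult_right_mono) auto
        then show ?thesis by simp
      qed
      ultimately have "2 * pi * norm (G N 0) \<le> 2 * pi * (2 * B / R + B / N + (2 * M1 + M2 * (2 * R)) / ln (real N))"
        by (simp add: algebra_simps)
      then show ?thesis by (simp only: mult_le_cancel_left_pos pi_gt_zero mult_pos_pos zero_less_numeral)
    qed
    then show ?thesis by blast
  qed
  have "(\<lambda>N. G N 0) \<longlonglongrightarrow> 0"
  proof (rule tendstoI)
    fix \<epsilon> :: real assume \<epsilon>: "\<epsilon> > 0"
    define R where "R = 4 * (B + 1) / \<epsilon>"
    have R: "R > 0" using \<epsilon> B by (simp add: R_def)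
    have BR: "2 * B / R < \<epsilon> / 2 + 0" using \<epsilon> B by (simp add: R_def field_simps)
    obtain C where C: "\<And>N. N \<ge> 2 \<Longrightarrow> norm (G N 0) \<le> 2 * B / R + B / N + C / ln (real N)"
      using main[OF R] by blast
    have "(\<lambda>N. 2 * B / R + B / real N + C / ln (real N)) \<longlonglongrightarrow> 2 * B / R + 0 + 0"
      by (intro tendsto_add tendsto_const) real_asymp+
    then have "eventually (\<lambda>N. 2 * B / R + B / real N + C / ln (real N) < \<epsilon>) sequentially"
      by (rule order_tendstoD) (use BR \<epsilon> in simp)
    then show "eventually (\<lambda>N. dist (G N 0) 0 < \<epsilon>) sequentially"
      using eventually_ge_at_top[of 2] by eventually_elim (use C in \<open>fastforce simp: dist_norm\<close>)
  qed
  then show ?thesis by (simp add: G0)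
qed

theorem newman:
  fixes b :: "nat \<Rightarrow> complex"
  assumes b: "\<And>n. norm (b n) \<le> B" and U: "open U" "{z. Re z \<ge> 0} \<subseteq> U" and g: "g holomorphic_on U"
    and sums: "\<And>z. Re z > 0 \<Longrightarrow> (\<lambda>n. b (Suc n) * of_nat (Suc n) powr (- 1 - z)) sums g z"
  shows "(\<lambda>N. \<Sum>n\<in>{1..N}. b n / of_nat n) \<longlonglongrightarrow> g 0"
proof -
  define b' where "b' n = b n - (if n = 1 then g 0 else 0)" for n
  have "(\<lambda>N. \<Sum>n\<in>{1..N}. b' n / of_nat n) \<longlonglongrightarrow> 0"
  proof (rule newman_aux[OF _ U, of b' "B + norm (g 0)" "\<lambda>z. g z - g 0"])
    show "norm (b' n) \<le> B + norm (g 0)" for n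
      unfolding b'_def using order_trans[OF norm_triangle_ineq4 add_mono[OF b[of n] order_refl]] b[of n]
      by (auto intro: order_trans)
    show "(\<lambda>z. g z - g 0) holomorphic_on U" by (intro holomorphic_intros g)
    fix z :: complex assume "Re z > 0"
    from sums_diff[OF sums[OF this] sums_single[of 0 "\<lambda>_. g 0"]]
    have "(\<lambda>n. b (Suc n) * of_nat (Suc n) powr (- 1 - z) - (if n = 0 then g 0 else 0)) sums (g z - g 0)" .
    moreover have "b' (Suc n) * of_nat (Suc n) powr (- 1 - z) = b (Suc n) * of_nat (Suc n) powr (- 1 - z) - (if n = 0 then g 0 else 0)" for n
      by (auto simp: b'_def)
    ultimately show "(\<lambda>n. b' (Suc n) * of_nat (Suc n) powr (- 1 - z)) sums (g z - g 0)" by simp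
  qed simp
  from tendsto_add[OF this tendsto_const[of "g 0"]]
  have lim: "(\<lambda>N. (\<Sum>n\<in>{1..N}. b' n / of_nat n) + g 0) \<longlonglongrightarrow> g 0" by simp
  have "eventually (\<lambda>N. (\<Sum>n\<in>{1..N}. b' n / of_nat n) + g 0 = (\<Sum>n\<in>{1..N}. b n / of_nat n)) sequentially"
    using eventually_ge_at_top[of 1]
  proof eventually_elim
    case (elim N)
    have "(\<Sum>n\<in>{1..N}. b' n / of_nat n) = (\<Sum>n\<in>{1..N}. b n / of_nat n - (if n = 1 then g 0 else 0))"
      by (intro sum.cong) (auto simp: b'_def diff_divide_distrib)
    also have "\<dots> = (\<Sum>n\<in>{1..N}. b n / of_nat n) - g 0" using elim by (simp add: sum_subtractf)
    finally show ?case by simp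
  qed
  from Lim_transform_eventually[OF lim this] show ?thesis .
qed

subsection \<open>Convergence of the Chebyshev error sum\<close>

definition psi_error :: "nat \<Rightarrow> real" where
  "psi_error n = chebyshev_psi n - real n"

lemma psi_error_bound: "\<bar>psi_error n\<bar> \<le> 4 * real n"
  using chebyshev_psi_nonneg[of n] chebyshev_psi_le[of n] by (simp add: psi_error_def)

lemma psi_error_Suc: "psi_error (Suc n) = psi_error n + mangoldt (Suc n) - 1"
  by (simp add: psi_error_def chebyshev_psi_def)

lemma psi_error_abel_sums:
  assumes s: "Re s > 1"
  shows "(\<lambda>n. of_real (psi_error (Suc n)) * (of_nat (Suc n) powr (- s) - of_nat (Suc (Suc n)) powr (- s)))
    sums (mangoldt_series s - zeta_sum s)"
proof -
  let ?t = "\<lambda>n. of_nat (Suc n) powr (- s) :: complex"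
  have part: "(\<Sum>n<N. of_real (psi_error (Suc n)) * (?t n - ?t (Suc n)))
     = (\<Sum>n<N. mangoldt (Suc n) * ?t n - ?t n) - of_real (psi_error N) * ?t N" for N
  proof (induction N)
    case 0
    then show ?case by (simp add: psi_error_def chebyshev_psi_def)
  next
    case (Suc N)
    then show ?case by (simp add: psi_error_Suc algebra_simps del: of_nat_Suc)
  qed
  have "(\<lambda>N. of_real (psi_error N) * ?t N) \<longlonglongrightarrow> 0"
  proof (rule Lim_null_comparison)
    show "eventually (\<lambda>N. norm (of_real (psi_error N) * ?t N) \<le> 4 * real (Suc N) powr (1 - Re s)) sequentially"
    proof (intro always_eventually allI)
      fix N
      have "norm (of_real (psi_error N) * ?t N) \<le> (4 * real (Suc N)) * real (Suc N) powr (- Re s)"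
        unfolding norm_mult norm_of_nat_powr using psi_error_bound[of N]
        by (intro mult_mono) auto
      also have "\<dots> = 4 * (real (Suc N) powr 1 * real (Suc N) powr (- Re s))" by simp
      also have "real (Suc N) powr 1 * real (Suc N) powr (- Re s) = real (Suc N) powr (1 - Re s)"
        unfolding powr_add[symmetric] by simp
      finally show "norm (of_real (psi_error N) * ?t N) \<le> 4 * real (Suc N) powr (1 - Re s)" .
    qed
    have "1 - Re s < 0" using s by simp
    then show "(\<lambda>N. 4 * real (Suc N) powr (1 - Re s)) \<longlonglongrightarrow> 0" by real_asymp
  qed
  moreover have "(\<lambda>N. \<Sum>n<N. mangoldt (Suc n) * ?t n - ?t n) \<longlonglongrightarrow> mangoldt_series s - zeta_sum s"
    using sums_diff[OF mangoldt_series_sums[OF s] zeta_sum_sums[OF s]] unfolding sums_def .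
  ultimately have "(\<lambda>N. (\<Sum>n<N. mangoldt (Suc n) * ?t n - ?t n) - of_real (psi_error N) * ?t N)
     \<longlonglongrightarrow> mangoldt_series s - zeta_sum s - 0" by (intro tendsto_diff)
  then show ?thesis unfolding sums_def part by simp
qed

lemma psi_error_continuation:
  obtains U g where "open U" "{z. Re z \<ge> 0} \<subseteq> U" "g holomorphic_on U"
    "\<And>z. Re z > 0 \<Longrightarrow>
       (\<lambda>n. of_real (psi_error (Suc n) / real (Suc n)) * of_nat (Suc n) powr (- 1 - z)) sums g z"
proof -
  define V where "V = {s. Re s > 0 \<and> zeta_pole s \<noteq> 0}"
  have V: "open V"
  proof -
    have "open ({s. Re s > 0} \<inter> zeta_pole -` (- {0}))"
      using zeta_pole_holomorphic holomorphic_on_imp_continuous_on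
      by (intro continuous_open_preimage open_Re_gt) auto
    also have "{s. Re s > 0} \<inter> zeta_pole -` (- {0}) = V" by (auto simp: V_def)
    finally show ?thesis .
  qed
  have Vsub: "V \<subseteq> {s. Re s > 0}" by (auto simp: V_def)
  define \<beta> where "\<beta> n = complex_of_real (psi_error n)" for n
  define E where "E s = (\<Sum>n. \<beta> (Suc n) * zeta_term (Suc n) s)" for s
  have \<beta>: "norm (\<beta> n) \<le> 4 * real n powr 1" if "n > 0" for n
    using psi_error_bound[of n] by (simp add: \<beta>_def)
  have E_hol: "E holomorphic_on {s. Re s > 1}"
    unfolding E_def using zeta_term_series(1)[OF _ \<beta>] by simp
  have E_summable: "summable (\<lambda>n. \<beta> (Suc n) * zeta_term (Suc n) s)" if "Re s > 1" for s
    using zeta_term_series(2)[OF _ \<beta>] that by simp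
  define q where "q s = (if s = 1 then deriv zeta_pole 1 else (zeta_pole s - zeta_pole 1) / (s - 1))" for s
  have q_hol: "q holomorphic_on {s. Re s > 0}"
    unfolding q_def by (rule pole_lemma_open[OF zeta_pole_holomorphic open_Re_gt])
  define F where "F s = - (deriv zeta_pole s / zeta_pole s) - q s" for s
  have dz: "deriv zeta_pole holomorphic_on {s. Re s > 0}"
    by (rule holomorphic_deriv[OF zeta_pole_holomorphic open_Re_gt])
  have F_hol: "F holomorphic_on V"
    unfolding F_def
    by (intro holomorphic_intros holomorphic_on_subset[OF dz Vsub] holomorphic_on_subset[OF zeta_pole_holomorphic Vsub]
        holomorphic_on_subset[OF q_hol Vsub]) (auto simp: V_def)
  have F_eq: "F s = mangoldt_series s - zeta_sum s" if s: "Re s > 1" for s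
  proof -
    have d: "deriv zeta_pole s = zeta_sum s - zeta_pole s * mangoldt_series s"
      using zeta_pole_deriv[OF s] by (rule DERIV_imp_deriv)
    have Z: "zeta_pole s \<noteq> 0" using zeta_pole_nonzero[of s] s by simp
    have s1: "s \<noteq> 1" using s by auto
    have zs: "zeta_sum s = zeta_pole s / (s - 1)" using zeta_pole_eq[OF s] s1 by simp
    have "deriv zeta_pole s / zeta_pole s = 1 / (s - 1) - mangoldt_series s"
      using Z by (simp add: d zs diff_divide_distrib)
    moreover have "q s = zeta_sum s - 1 / (s - 1)"
      using s1 by (simp add: q_def zeta_pole_1 zs diff_divide_distrib)
    ultimately show ?thesis by (simp add: F_def)
  qed
  define G where "G z = (F (1 + z) + E (2 + z)) / (1 + z)" for z
  define U where "U = (\<lambda>z. 1 + z) -` V"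
  have "open U"
    unfolding U_def by (intro open_vimage V continuous_intros)
  moreover have "{z. Re z \<ge> 0} \<subseteq> U"
    using zeta_pole_nonzero by (auto simp: U_def V_def)
  moreover have "G holomorphic_on U"
  proof -
    have 1: "(\<lambda>z. F (1 + z)) holomorphic_on U"
    proof -
      have "(\<lambda>z. 1 + z) holomorphic_on U" by (intro holomorphic_intros)
      from holomorphic_on_compose_gen[OF this F_hol] show ?thesis by (simp add: o_def U_def image_subset_iff)
    qed
    have 2: "(\<lambda>z. E (2 + z)) holomorphic_on U"
    proof -
      have "(\<lambda>z. 2 + z) holomorphic_on U" by (intro holomorphic_intros)
      from holomorphic_on_compose_gen[OF this E_hol] show ?thesis
        by (force simp: o_def U_def V_def image_subset_iff)
    qed
    show ?thesis unfolding G_def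
      by (intro holomorphic_intros 1 2) (auto simp: U_def V_def complex_eq_iff)
  qed
  moreover have "(\<lambda>n. of_real (psi_error (Suc n) / real (Suc n)) * of_nat (Suc n) powr (- 1 - z)) sums G z"
    if z: "Re z > 0" for z
  proof -
    have s: "Re (1 + z) > 1" "Re (2 + z) > 1" "1 + z \<noteq> 0" using z by (auto simp: complex_eq_iff)
    have "(\<lambda>n. \<beta> (Suc n) * zeta_term (Suc n) (2 + z)) sums E (2 + z)"
      unfolding E_def by (rule summable_sums[OF E_summable[OF s(2)]])
    from sums_divide[OF sums_add[OF psi_error_abel_sums[OF s(1)] this], of "1 + z"]
    have "(\<lambda>n. (of_real (psi_error (Suc n)) * (of_nat (Suc n) powr (- (1 + z)) - of_nat (Suc (Suc n)) powr (- (1 + z)))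
        + \<beta> (Suc n) * zeta_term (Suc n) (2 + z)) / (1 + z)) sums G z"
      unfolding G_def F_eq[OF s(1)] .
    moreover have "(of_real (psi_error (Suc n)) * (of_nat (Suc n) powr (- (1 + z)) - of_nat (Suc (Suc n)) powr (- (1 + z)))
        + \<beta> (Suc n) * zeta_term (Suc n) (2 + z)) / (1 + z)
       = of_real (psi_error (Suc n) / real (Suc n)) * of_nat (Suc n) powr (- 1 - z)" for n
    proof -
      define N where "N = (of_nat (Suc n) :: complex)"
      have N0: "N \<noteq> 0" unfolding N_def by (simp del: of_nat_Suc)
      have e: "1 - (2 + z) = - (1 + z)" "- 1 - z = - (1 + z)" by simp_all
      have T: "zeta_term (Suc n) (2 + z) = (1 + z) * N powr (- (2 + z)) - N powr (- (1 + z)) + of_nat (Suc (Suc n)) powr (- (1 + z))"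
        unfolding zeta_term_def e N_def by (simp del: of_nat_Suc)
      have "N powr (- (2 + z)) = N powr (- (1 + z) - 1)" by (simp add: algebra_simps)
      also have "\<dots> = N powr (- (1 + z)) / N" by (subst powr_diff) (use N0 in simp)
      finally have p: "N powr (- (2 + z)) = N powr (- (1 + z)) / N" .
      have "(of_real (psi_error (Suc n)) * (N powr (- (1 + z)) - of_nat (Suc (Suc n)) powr (- (1 + z)))
        + \<beta> (Suc n) * zeta_term (Suc n) (2 + z)) = (1 + z) * (of_real (psi_error (Suc n)) / N * N powr (- (1 + z)))"
        unfolding T p \<beta>_def by (simp add: algebra_simps)
      then show ?thesis using s(3) unfolding e(2) N_def[symmetric] by (simp add: N_def)
    qed
    ultimately show ?thesis by simp
  qed
  ultimately show ?thesis using that by blast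
qed

lemma psi_error_sum_convergent: "convergent (\<lambda>N. \<Sum>n\<in>{1..N}. psi_error n / real n ^ 2)"
proof -
  obtain U g where U: "open U" "{z. Re z \<ge> 0} \<subseteq> U" "g holomorphic_on U"
    "\<And>z. Re z > 0 \<Longrightarrow>
       (\<lambda>n. of_real (psi_error (Suc n) / real (Suc n)) * of_nat (Suc n) powr (- 1 - z)) sums g z"
    using psi_error_continuation by blast
  have "norm (complex_of_real (psi_error n / real n)) \<le> 4" for n
  proof -
    have "\<bar>psi_error n / real n\<bar> \<le> 4"
      using psi_error_bound[of n] by (cases "n = 0") (auto simp: field_simps)
    then show ?thesis by (simp only: norm_of_real)
  qed
  from newman[of "\<lambda>n. complex_of_real (psi_error n / real n)", OF this U]
  have "(\<lambda>N. Re (\<Sum>n\<in>{1..N}. complex_of_real (psi_error n / real n) / of_nat n)) \<longlonglongrightarrow> Re (g 0)"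
    by (rule tendsto_Re)
  moreover have "Re (\<Sum>n\<in>{1..N}. complex_of_real (psi_error n / real n) / of_nat n)
      = (\<Sum>n\<in>{1..N}. psi_error n / real n ^ 2)" for N
    by (simp add: power2_eq_square)
  ultimately show ?thesis by (auto simp: convergent_def)
qed

subsection \<open>Prime gaps\<close>

lemma sum_mangoldt_nonprime_le:
  fixes X :: nat
  assumes X: "X \<ge> 1"
  shows "(\<Sum>m | m \<in> {1..X} \<and> \<not> prime m. mangoldt m) \<le> sqrt X * (log 2 X + 1) * ln X"
proof -
  define S where "S = {m. m \<in> {1..X} \<and> \<not> prime m \<and> mangoldt m \<noteq> (0::real)}"
  define a j where "a = nat \<lfloor>sqrt X\<rfloor>" and "j = nat \<lfloor>log 2 X\<rfloor>"
  have "S \<subseteq> (\<lambda>(p, i). p ^ i) ` ({1..a} \<times> {..j})"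
  proof
    fix m assume m: "m \<in> S"
    then have "primepow m" by (auto simp: S_def mangoldt_def split: if_splits)
    then obtain p i where p: "prime p" "i > 0" "m = p ^ i" by (auto simp: primepow_def)
    have i2: "i \<ge> 2" using p m by (cases "i = 1") (auto simp: S_def)
    have p2: "p \<ge> 2" using p(1) by (rule prime_ge_2_nat)
    have mX: "m \<le> X" using m by (simp add: S_def)
    have "p ^ 2 \<le> p ^ i" using i2 p2 by (intro power_increasing) auto
    then have "p ^ 2 \<le> X" using p mX by linarith
    then have "real (p ^ 2) \<le> real X" by (simp only: of_nat_le_iff)
    then have "real p ^ 2 \<le> X" by simp
    then have "real p \<le> sqrt X" by (rule real_le_rsqrt)
    then have "p \<le> a" unfolding a_def by (simp add: le_nat_iff le_floor_iff)
    have "2 ^ i \<le> p ^ i" using p2 by (intro power_mono) auto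
    then have "2 ^ i \<le> X" using p(3) mX by linarith
    then have "real (2 ^ i) \<le> real X" by (simp only: of_nat_le_iff)
    then have "(2::real) ^ i \<le> X" by simp
    then have "real i \<le> log 2 X" using X by (simp add: le_log_iff powr_realpow)
    then have "i \<le> j" unfolding j_def by (simp add: le_nat_iff le_floor_iff)
    then show "m \<in> (\<lambda>(p, i). p ^ i) ` ({1..a} \<times> {..j})" using \<open>p \<le> a\<close> p2 p(3) by force
  qed
  then have "card S \<le> card ({1..a} \<times> {..j})"
    by (rule surj_card_le[rotated]) simp
  then have "card S \<le> a * (j + 1)" by (simp add: card_cartesian_product)
  then have "real (card S) \<le> real (a * (j + 1))" by (simp only: of_nat_le_iff)
  also have "\<dots> \<le> sqrt X * (log 2 X + 1)"
    unfolding of_nat_mult using X by (intro mult_mono) (auto simp: a_def j_def of_nat_nat)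
  finally have card: "real (card S) \<le> sqrt X * (log 2 X + 1)" .
  have "(\<Sum>m | m \<in> {1..X} \<and> \<not> prime m. mangoldt m :: real) = (\<Sum>m\<in>S. mangoldt m)"
    by (rule sum.mono_neutral_right) (auto simp: S_def)
  also have "\<dots> \<le> card S * ln X"
  proof (rule sum_bounded_above)
    fix m assume "m \<in> S"
    then have "0 < m" "m \<le> X" by (auto simp: S_def)
    then have "mangoldt m \<le> ln m" "ln m \<le> ln X" by (auto intro: mangoldt_le)
    then show "mangoldt m \<le> ln X" by (rule order_trans)
  qed
  also have "\<dots> \<le> sqrt X * (log 2 X + 1) * ln X"
    using card X by (intro mult_right_mono) auto
  finally show ?thesis .
qed

lemma nat_floor_bounds:
  fixes x :: real
  assumes "x \<ge> 0"
  shows "real (nat \<lfloor>x\<rfloor>) \<le> x" "real (nat \<lfloor>x\<rfloor>) > x - 1"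
proof -
  have "real (nat \<lfloor>x\<rfloor>) = of_int \<lfloor>x\<rfloor>" using assms by simp
  then show "real (nat \<lfloor>x\<rfloor>) \<le> x" "real (nat \<lfloor>x\<rfloor>) > x - 1" by linarith+
qed

theorem exists_prime_in_short_interval:
  fixes \<epsilon> :: real
  assumes "\<epsilon> > 0"
  shows "eventually (\<lambda>N. \<exists>p. prime p \<and> N < p \<and> real p \<le> (1 + \<epsilon>) * real N) sequentially"
proof -
  have main: "eventually (\<lambda>N. \<exists>p. prime p \<and> N < p \<and> real p \<le> (1 + \<epsilon>) * real N) sequentially"
    if \<epsilon>: "0 < \<epsilon>" "\<epsilon> \<le> 1" for \<epsilon> :: real
  proof -
    define S where "S N = (\<Sum>n\<in>{1..N}. psi_error n / real n ^ 2)" for N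
    define \<eta> where "\<eta> = \<epsilon> ^ 2 / 300"
    have \<eta>: "\<eta> > 0" using \<epsilon> by (simp add: \<eta>_def)
    have "Cauchy S" using psi_error_sum_convergent convergent_Cauchy unfolding S_def by blast
    then obtain n0 where n0: "\<And>m n. m \<ge> n0 \<Longrightarrow> n \<ge> n0 \<Longrightarrow> \<bar>S m - S n\<bar> < \<eta>"
      using \<eta> unfolding Cauchy_def dist_real_def by meson
    have ev1: "eventually (\<lambda>N::nat. sqrt (2 * real N) * (log 2 (2 * real N) + 1) * ln (2 * real N) \<le> \<epsilon> / 16 * real N) sequentially"
      using \<epsilon> by real_asymp
    have ev2: "eventually (\<lambda>N::nat. \<epsilon> * real N / 8 \<ge> 1) sequentially" using \<epsilon> by real_asymp
    show ?thesis
      using ev1 ev2 eventually_ge_at_top[of "max 1 n0"]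
    proof eventually_elim
      case (elim N)
      have N: "N \<ge> 1" "N \<ge> n0" using elim by auto
      have Sdiff: "S b - S a = (\<Sum>n\<in>{a<..b}. psi_error n / real n ^ 2)" if "a \<le> b" for a b
      proof -
        have "{1..b} - {1..a} = {a<..b}" by auto
        then show ?thesis
          using sum_diff[of "{1..b}" "{1..a}" "\<lambda>n. psi_error n / real n ^ 2"] that by (simp add: S_def)
      qed
      show ?case
      proof (rule ccontr)
        assume "\<not> ?case"
        then have np: "\<not> prime p" if "N < p" "real p \<le> (1 + \<epsilon>) * real N" for p using that by blast
        have psi: "chebyshev_psi n \<le> chebyshev_psi N + \<epsilon> / 16 * N" if n: "N \<le> n" "real n \<le> (1 + \<epsilon>) * real N" for n
        proof -
          have "(1 + \<epsilon>) * real N \<le> 2 * real N" using \<epsilon> by (intro mult_right_mono) auto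
          then have n2: "n \<le> 2 * N" using n by linarith
          have "chebyshev_psi n = chebyshev_psi N + (\<Sum>m\<in>{N<..n}. mangoldt m)"
          proof -
            have "{1..n} - {1..N} = {N<..n}" by auto
            then show ?thesis
              using sum_diff[of "{1..n}" "{1..N}" "mangoldt :: nat \<Rightarrow> real"] n(1) by (simp add: chebyshev_psi_def)
          qed
          also have "(\<Sum>m\<in>{N<..n}. mangoldt m :: real) \<le> (\<Sum>m | m \<in> {1..2 * N} \<and> \<not> prime m. mangoldt m)"
          proof (rule sum_mono2)
            show "{N<..n} \<subseteq> {m. m \<in> {1..2 * N} \<and> \<not> prime m}"
            proof
              fix m assume m: "m \<in> {N<..n}"
              then have "real m \<le> (1 + \<epsilon>) * real N" using n(2) by auto
              then show "m \<in> {m. m \<in> {1..2 * N} \<and> \<not> prime m}" using m n2 np[of m] by auto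
            qed
          qed (auto simp: mangoldt_nonneg)
          also have "\<dots> \<le> sqrt (real (2 * N)) * (log 2 (real (2 * N)) + 1) * ln (real (2 * N))"
            by (rule sum_mangoldt_nonprime_le) (use N in simp)
          also have "\<dots> \<le> \<epsilon> / 16 * N" using elim(1) by simp
          finally show ?thesis by simp
        qed
        show False
        proof (cases "chebyshev_psi N \<ge> (1 + \<epsilon> / 2) * N")
          case True
          define b where "b = nat \<lfloor>(1 + \<epsilon> / 4) * real N\<rfloor>"
          have b: "real b \<le> (1 + \<epsilon> / 4) * real N" "real b \<ge> (1 + \<epsilon> / 4) * real N - 1"
            using nat_floor_bounds[of "(1 + \<epsilon> / 4) * real N"] \<epsilon> unfolding b_def by auto
          have Nb: "N \<le> b" "real b - real N \<ge> \<epsilon> * real N / 8"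
          proof -
            have "(1 + \<epsilon> / 4) * real N = real N + 2 * (\<epsilon> * real N / 8)" by (simp add: field_simps)
            then show "real b - real N \<ge> \<epsilon> * real N / 8" using b(2) elim(2) by linarith
            then have "real N \<le> real b" using elim(2) by linarith
            then show "N \<le> b" by (simp only: of_nat_le_iff)
          qed
          have "real (card {N<..b}) * (\<epsilon> / 4 * N / (2 * N) ^ 2) \<le> (\<Sum>n\<in>{N<..b}. psi_error n / real n ^ 2)"
          proof (rule sum_bounded_below)
            fix n assume n: "n \<in> {N<..b}"
            then have nb: "real n \<le> (1 + \<epsilon> / 4) * real N" using b by auto
            have "(1 + \<epsilon> / 4) * real N \<le> 2 * real N" using \<epsilon> by (intro mult_right_mono) auto
            then have n2: "real n \<le> 2 * real N" using nb by linarith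
            have "chebyshev_psi n \<ge> chebyshev_psi N" using n by (intro chebyshev_psi_mono) auto
            then have pe: "psi_error n \<ge> \<epsilon> / 4 * N" using True nb by (simp add: psi_error_def algebra_simps)
            have p0: "psi_error n \<ge> 0" by (rule order_trans[OF _ pe]) (use \<epsilon> in simp)
            have "real n ^ 2 \<le> (2 * real N) ^ 2" using n2 by (intro power_mono) auto
            then show "\<epsilon> / 4 * N / (2 * N) ^ 2 \<le> psi_error n / real n ^ 2"
              using n by (intro frac_le[OF p0 pe]) auto
          qed
          also have "\<dots> = S b - S N" using Sdiff[OF Nb(1)] by simp
          also have "\<dots> < \<eta>" using n0[of b N] N Nb by auto
          finally have "real (card {N<..b}) * (\<epsilon> / 4 * N / (2 * N) ^ 2) < \<eta>" .
          moreover have "\<epsilon> * N / 8 * (\<epsilon> / 4 * N / (2 * N) ^ 2) \<le> real (card {N<..b}) * (\<epsilon> / 4 * N / (2 * N) ^ 2)"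
            using Nb \<epsilon> by (intro mult_right_mono) auto
          moreover have "\<epsilon> * N / 8 * (\<epsilon> / 4 * N / (2 * N) ^ 2) = \<epsilon> ^ 2 / 128" using N by (simp add: power2_eq_square field_simps)
          moreover have "\<eta> \<le> \<epsilon> ^ 2 / 128" by (simp add: \<eta>_def)
          ultimately show False by linarith
        next
          case False
          define a b where "a = nat \<lfloor>(1 + 3 * \<epsilon> / 4) * real N\<rfloor>" and "b = nat \<lfloor>(1 + \<epsilon>) * real N\<rfloor>"
          have b: "real b \<le> (1 + \<epsilon>) * real N" "real b \<ge> (1 + \<epsilon>) * real N - 1"
            using nat_floor_bounds[of "(1 + \<epsilon>) * real N"] \<epsilon> unfolding b_def by auto
          have a: "real a \<le> (1 + 3 * \<epsilon> / 4) * real N" "real a > (1 + 3 * \<epsilon> / 4) * real N - 1"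
            using nat_floor_bounds[of "(1 + 3 * \<epsilon> / 4) * real N"] \<epsilon> unfolding a_def by auto
          have "real N \<le> (1 + 3 * \<epsilon> / 4) * real N" using \<epsilon> by (simp add: algebra_simps)
          then have Na: "N \<le> a" unfolding a_def by (simp add: le_nat_iff le_floor_iff)
          have ab: "a \<le> b" "real b - real a \<ge> \<epsilon> * real N / 8"
          proof -
            have "(1 + \<epsilon>) * real N = (1 + 3 * \<epsilon> / 4) * real N + 2 * (\<epsilon> * real N / 8)" by (simp add: field_simps)
            then show "real b - real a \<ge> \<epsilon> * real N / 8" using a(1) b(2) elim(2) by linarith
            then have "real a \<le> real b" using elim(2) by linarith
            then show "a \<le> b" by (simp only: of_nat_le_iff)
          qed
          have "(\<Sum>n\<in>{a<..b}. psi_error n / real n ^ 2) \<le> real (card {a<..b}) * (- (\<epsilon> / 8 * N / (2 * N) ^ 2))"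
          proof (rule sum_bounded_above)
            fix n assume n: "n \<in> {a<..b}"
            then have "real n \<ge> real a + 1" "real n \<le> real b" by auto
            then have nab: "real n > (1 + 3 * \<epsilon> / 4) * real N" "real n \<le> (1 + \<epsilon>) * real N" using a b by linarith+
            have "(1 + \<epsilon>) * real N \<le> 2 * real N" using \<epsilon> by (intro mult_right_mono) auto
            then have n2: "real n \<le> 2 * real N" using nab by linarith
            have "\<epsilon> * real N > 0" using \<epsilon> N by simp
            moreover have "chebyshev_psi n \<le> chebyshev_psi N + \<epsilon> / 16 * N" using n Na nab by (intro psi) auto
            ultimately have pe: "- psi_error n \<ge> \<epsilon> / 8 * N" using False nab(1) by (simp add: psi_error_def algebra_simps)
            have p0: "- psi_error n \<ge> 0" by (rule order_trans[OF _ pe]) (use \<epsilon> in simp)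
            have "real n ^ 2 \<le> (2 * real N) ^ 2" using n2 by (intro power_mono) auto
            then have "\<epsilon> / 8 * N / (2 * N) ^ 2 \<le> (- psi_error n) / real n ^ 2"
              using n by (intro frac_le[OF p0 pe]) auto
            then show "psi_error n / real n ^ 2 \<le> - (\<epsilon> / 8 * N / (2 * N) ^ 2)" by simp
          qed
          moreover have "(\<Sum>n\<in>{a<..b}. psi_error n / real n ^ 2) = S b - S a" using Sdiff[OF ab(1)] by simp
          moreover have "S b - S a > - \<eta>" using n0[of b a] N Na ab by auto
          ultimately have "real (card {a<..b}) * (\<epsilon> / 8 * N / (2 * N) ^ 2) < \<eta>" by simp
          moreover have "\<epsilon> * N / 8 * (\<epsilon> / 8 * N / (2 * N) ^ 2) \<le> real (card {a<..b}) * (\<epsilon> / 8 * N / (2 * N) ^ 2)"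
            using ab \<epsilon> by (intro mult_right_mono) auto
          moreover have "\<epsilon> * N / 8 * (\<epsilon> / 8 * N / (2 * N) ^ 2) = \<epsilon> ^ 2 / 256" using N by (simp add: power2_eq_square field_simps)
          moreover have "\<eta> \<le> \<epsilon> ^ 2 / 256" by (simp add: \<eta>_def)
          ultimately show False by linarith
        qed
      qed
    qed
  qed
  from main[of "min \<epsilon> 1"] assms
  have "eventually (\<lambda>N. \<exists>p. prime p \<and> N < p \<and> real p \<le> (1 + min \<epsilon> 1) * real N) sequentially" by simp
  then show ?thesis
  proof eventually_elim
    case (elim N)
    then obtain p where p: "prime p" "N < p" "real p \<le> (1 + min \<epsilon> 1) * real N" by blast
    have "(1 + min \<epsilon> 1) * real N \<le> (1 + \<epsilon>) * real N" by (intro mult_right_mono) auto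
    then show ?case using p by (intro exI[of _ p]) auto
  qed
qed

section \<open>The main theorem\<close>

lemma largest_bipartite_subgraph:
  assumes "simple_graph G"
  obtains H where "is_subgraph H G" "is_bipartite H"
    "\<And>H'. is_subgraph H' G \<Longrightarrow> is_bipartite H' \<Longrightarrow> num_edges H' \<le> num_edges H"
proof -
  let ?P = "\<lambda>H. is_subgraph H G \<and> is_bipartite H"
  have "?P (cut_graph G {})" using cut_graph[OF assms] by simp
  moreover have "\<forall>H. ?P H \<longrightarrow> num_edges H < Suc (num_edges G)"
    using simple_graph_finite_edges[OF assms]
    by (auto simp: is_subgraph_def num_edges_def less_Suc_eq_le intro: card_mono)
  ultimately obtain H where "?P H" "\<And>H'. ?P H' \<Longrightarrow> num_edges H' \<le> num_edges H"
    using ex_has_greatest_nat[of ?P "cut_graph G {}" num_edges "Suc (num_edges G)"] by blast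
  then show ?thesis using that by blast
qed

lemma average_degree_le:
  fixes \<epsilon> :: real
  assumes l: "2 \<le> l" and k: "odd k" "k > 2 * l" and \<epsilon>: "\<epsilon> > 0"
  obtains n\<^sub>0 where "\<And>G :: 'a sgraph. \<lbrakk>simple_graph G; family_free (even_cycles l \<union> {cycle_graph k}) G;
      num_verts G \<ge> n\<^sub>0\<rbrakk> \<Longrightarrow> average_degree G \<le> (1 + \<epsilon>) * (real (num_verts G) / 2) powr (1 / l)"
proof -
  from bipartite_subgraph[OF l k, of "\<epsilon> / 4"] \<epsilon> obtain n0 where
    n0: "\<And>G :: 'a sgraph. \<lbrakk>simple_graph G; family_free (even_cycles l \<union> {cycle_graph k}) G; num_verts G \<ge> n0\<rbrakk> \<Longrightarrow>
      \<exists>H. is_subgraph H G \<and> is_bipartite H \<and>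
        average_degree G ^ (l + 1) - \<epsilon> / 4 * real (num_verts G) powr (1 + 1 / l) \<le> num_edges H"
    by auto
  show ?thesis
  proof (rule that[of "max 1 n0"])
    fix G :: "'a sgraph"
    assume G: "simple_graph G" "family_free (even_cycles l \<union> {cycle_graph k}) G" "num_verts G \<ge> max 1 n0"
    define n d N M where "n = real (num_verts G)" and "d = average_degree G" and "N = n powr (1 / l)"
      and "M = (n / 2) powr (1 / l)"
    have n: "n \<ge> 1" using G(3) by (simp add: n_def)
    have pos: "N > 0" "M > 0" using n by (simp_all add: N_def M_def)
    have Ml: "M ^ l = n / 2" using n l by (simp add: M_def powr_power)
    have MN: "N / 2 \<le> M"
    proof -
      have "2 powr (1 / l) \<le> (2::real) powr 1" using l by (intro powr_mono) auto
      then have "N / 2 \<le> N / 2 powr (1 / l)" using pos by (intro divide_left_mono) auto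
      also have "\<dots> = M" using n by (simp add: M_def N_def powr_divide)
      finally show ?thesis .
    qed
    obtain H where H: "is_subgraph H G" "d ^ (l + 1) - \<epsilon> / 4 * n powr (1 + 1 / l) \<le> num_edges H"
      using n0[OF G(1,2)] G(3) by (auto simp: n_def d_def)
    have "num_edges H \<le> num_edges G"
      using H(1) simple_graph_finite_edges[OF G(1)] by (auto simp: is_subgraph_def num_edges_def intro: card_mono)
    then have "real (num_edges H) \<le> n / 2 * d"
      using n by (simp add: d_def average_degree_eq[OF G(1)] n_def)
    moreover have "n powr (1 + 1 / l) = n * N" using n by (simp add: N_def powr_add)
    ultimately have le: "d ^ (l + 1) \<le> n / 2 * d + \<epsilon> / 4 * (n * N)" using H(2) by simp
    show "average_degree G \<le> (1 + \<epsilon>) * (real (num_verts G) / 2) powr (1 / l)"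
      unfolding d_def[symmetric] n_def[symmetric] M_def[symmetric]
    proof (rule ccontr)
      assume "\<not> d \<le> (1 + \<epsilon>) * M"
      then have d: "d > (1 + \<epsilon>) * M" by simp
      have "M \<le> (1 + \<epsilon>) * M" using \<epsilon> pos by simp
      then have dM: "d > M" using d by linarith
      have "(1 + \<epsilon>) * (n / 2) \<le> (1 + \<epsilon>) ^ l * M ^ l"
        unfolding Ml using \<epsilon> l n self_le_power[of "1 + \<epsilon>" l] by (intro mult_right_mono) auto
      also have "\<dots> = ((1 + \<epsilon>) * M) ^ l" by (simp add: power_mult_distrib)
      also have "\<dots> \<le> d ^ l" using d \<epsilon> pos by (intro power_mono) auto
      finally have "(1 + \<epsilon>) * (n / 2) * d \<le> d ^ l * d" using dM pos by (intro mult_right_mono) auto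
      then have "\<epsilon> * (n / 2) * d \<le> \<epsilon> / 4 * (n * N)" using le by (simp add: algebra_simps)
      then have "\<epsilon> * n * (d / 2) \<le> \<epsilon> * n * (N / 4)" by (simp add: mult_ac)
      then have "d / 2 \<le> N / 4" using \<epsilon> n by simp
      then show False using dM MN by linarith
    qed
  qed
qed

lemma ex_number_le:
  fixes \<epsilon> :: real
  assumes l: "2 \<le> l" and k: "odd k" "k > 2 * l" and \<epsilon>: "\<epsilon> > 0"
  shows "eventually (\<lambda>n. real (ex_number n (even_cycles l \<union> {cycle_graph k}))
    \<le> (1 + \<epsilon>) * (real n / 2) powr (1 + 1 / l)) sequentially"
proof -
  obtain n0 where n0: "\<And>G :: nat sgraph. \<lbrakk>simple_graph G; family_free (even_cycles l \<union> {cycle_graph k}) G;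
      num_verts G \<ge> n0\<rbrakk> \<Longrightarrow> average_degree G \<le> (1 + \<epsilon>) * (real (num_verts G) / 2) powr (1 / l)"
    using average_degree_le[OF assms] by blast
  have "k > 0" using k(2) by simp
  show ?thesis
    using eventually_ge_at_top[of "max 1 n0"]
  proof eventually_elim
    case (elim n)
    have "edges F \<noteq> {}" if "F \<in> even_cycles l \<union> {cycle_graph k}" for F
      using that even_cycles_nontrivial cycle_graph_nontrivial[OF \<open>k > 0\<close>] by blast
    from ex_number_attained[OF this]
    obtain G :: "nat sgraph" where G: "simple_graph G" "num_verts G = n"
      "family_free (even_cycles l \<union> {cycle_graph k}) G"
      "num_edges G = ex_number n (even_cycles l \<union> {cycle_graph k})"
      by blast
    have "real (num_edges G) = real n / 2 * average_degree G"
      using elim by (simp add: average_degree_eq[OF G(1)] G(2))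
    also have "\<dots> \<le> real n / 2 * ((1 + \<epsilon>) * (real n / 2) powr (1 / l))"
      using n0[OF G(1,3)] elim by (intro mult_left_mono) (auto simp: G(2))
    also have "\<dots> = (1 + \<epsilon>) * (real n / 2) powr (1 + 1 / l)"
      using elim by (simp add: powr_add)
    finally show ?case by (simp add: G(4))
  qed
qed

lemma z_number_lower_bound:
  fixes \<delta> :: real
  assumes l: "l \<in> {2, 3, 5}" and \<delta>: "\<delta> > 0"
  shows "eventually (\<lambda>n. (real n / 2) powr (1 + 1 / l) \<le> (1 + \<delta>) ^ (l + 1) * real (z_number n (even_cycles l))) sequentially"
proof -
  have l0: "l > 0" using l by auto
  define N where "N n = nat \<lfloor>(real n / 2) powr (1 / l) / (1 + \<delta>)\<rfloor>" for n
  have N_lim: "filterlim N at_top sequentially"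
  proof -
    have "filterlim (\<lambda>n. (real n / 2) powr (1 / l) / (1 + \<delta>)) at_top sequentially"
      using l0 \<delta> by real_asymp
    then show ?thesis unfolding N_def
      by (intro filterlim_compose[OF filterlim_nat_sequentially] filterlim_compose[OF filterlim_floor_sequentially])
  qed
  have "eventually (\<lambda>n. \<exists>p. prime p \<and> N n < p \<and> real p \<le> (1 + \<delta>) * real (N n)) sequentially"
    by (rule eventually_compose_filterlim[OF exists_prime_in_short_interval[OF \<delta>] N_lim])
  moreover have "eventually (\<lambda>n. N n \<ge> 2) sequentially"
    using N_lim by (simp add: filterlim_at_top)
  ultimately show ?thesis
    using eventually_ge_at_top[of 1]
  proof eventually_elim
    case (elim n)
    then obtain p where p: "prime p" "N n < p" "real p \<le> (1 + \<delta>) * real (N n)" by blast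
    define Y where "Y = (real n / 2) powr (1 / l)"
    have Y: "Y \<ge> 0" "Y ^ l = real n / 2" using l0 elim by (simp_all add: Y_def powr_power)
    have Nn: "real (N n) \<le> Y / (1 + \<delta>)" "real (N n) > Y / (1 + \<delta>) - 1"
      using nat_floor_bounds[of "Y / (1 + \<delta>)"] Y \<delta> by (auto simp: N_def Y_def)
    have "(1 + \<delta>) * real (N n) \<le> Y" using Nn(1) \<delta> by (simp add: field_simps)
    then have "real p \<le> Y" using p(3) by linarith
    then have "real p ^ l \<le> real n / 2" unfolding Y(2)[symmetric] by (intro power_mono) auto
    then have "real (2 * p ^ l) \<le> real n" by simp
    then have "2 * p ^ l \<le> n" by (simp only: of_nat_le_iff)
    then have z: "p ^ (l + 1) \<le> z_number n (even_cycles l)"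
      using p elim by (intro z_number_ge_power[OF l p(1)]) auto
    have "real p \<ge> real (N n) + 1" using p(2) by linarith
    then have "Y / (1 + \<delta>) \<le> real p" using Nn(2) by linarith
    then have "Y \<le> (1 + \<delta>) * real p" using \<delta> by (simp add: field_simps)
    then have "Y ^ (l + 1) \<le> ((1 + \<delta>) * real p) ^ (l + 1)" using Y by (intro power_mono)
    also have "\<dots> = (1 + \<delta>) ^ (l + 1) * real (p ^ (l + 1))" by (simp add: power_mult_distrib)
    also have "\<dots> \<le> (1 + \<delta>) ^ (l + 1) * real (z_number n (even_cycles l))"
      using z \<delta> by (intro mult_left_mono) (simp_all only: of_nat_le_iff zero_le_power add_nonneg_nonneg less_imp_le zero_le_one)
    also have "Y ^ (l + 1) = (real n / 2) powr (1 + 1 / l)"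
      using Y(2) elim by (simp add: Y_def powr_add)
    finally show ?case .
  qed
qed

lemma ex_number_asymp_equiv_z_number:
  assumes l: "l \<in> {2, 3, 5}" and k: "odd k" "k > 2 * l"
  shows "(\<lambda>n. real (ex_number n (even_cycles l \<union> {cycle_graph k}))) \<sim>[sequentially]
    (\<lambda>n. real (z_number n (even_cycles l)))"
proof (rule asymp_equivI', rule order_tendstoI)
  let ?ex = "\<lambda>n. real (ex_number n (even_cycles l \<union> {cycle_graph k}))" and ?z = "\<lambda>n. real (z_number n (even_cycles l))"
  have l2: "2 \<le> l" using l by auto
  have zpos: "eventually (\<lambda>n. ?z n > 0) sequentially"
    using z_number_lower_bound[OF l zero_less_one] eventually_ge_at_top[of 1]
  proof eventually_elim
    case (elim n)
    have "(real n / 2) powr (1 + 1 / l) > 0" using elim by simp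
    then show ?case using elim(1) by (cases "z_number n (even_cycles l)") auto
  qed
  fix c :: real
  {
    assume c: "c < 1"
    show "eventually (\<lambda>n. c < ?ex n / ?z n) sequentially"
      using zpos
    proof eventually_elim
      case (elim n)
      have "?z n \<le> ?ex n" using z_number_le_ex_number[OF k(1)] by simp
      then have "1 \<le> ?ex n / ?z n" using elim by simp
      then show ?case using c by linarith
    qed
  }
  {
    assume c: "c > 1"
    have "((\<lambda>\<delta>::real. (1 + \<delta>) * (1 + \<delta>) ^ (l + 1)) \<longlongrightarrow> (1 + 0) * (1 + 0) ^ (l + 1)) (at_right 0)"
      by (intro tendsto_intros)
    then have "eventually (\<lambda>\<delta>::real. (1 + \<delta>) * (1 + \<delta>) ^ (l + 1) < c) (at_right 0)"
      by (rule order_tendstoD) (use c in simp)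
    moreover have "eventually (\<lambda>\<delta>::real. \<delta> > 0) (at_right 0)" by (rule eventually_at_right_less)
    ultimately have "eventually (\<lambda>\<delta>::real. (1 + \<delta>) * (1 + \<delta>) ^ (l + 1) < c \<and> \<delta> > 0) (at_right 0)"
      by eventually_elim simp
    then obtain \<delta> :: real where \<delta>: "(1 + \<delta>) * (1 + \<delta>) ^ (l + 1) < c" "\<delta> > 0"
      using eventually_happens[of _ "at_right (0::real)"] by force
    show "eventually (\<lambda>n. ?ex n / ?z n < c) sequentially"
      using zpos ex_number_le[OF l2 k \<delta>(2)] z_number_lower_bound[OF l \<delta>(2)]
    proof eventually_elim
      case (elim n)
      have "?ex n \<le> (1 + \<delta>) * (real n / 2) powr (1 + 1 / l)" by (rule elim)
      also have "\<dots> \<le> (1 + \<delta>) * ((1 + \<delta>) ^ (l + 1) * ?z n)"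
        using elim \<delta> by (intro mult_left_mono) auto
      also have "\<dots> < c * ?z n"
        using mult_strict_right_mono[OF \<delta>(1) elim(1)] by (simp add: mult.assoc)
      finally show ?case using elim(1) by (simp add: pos_divide_less_eq)
    qed
  }
qed

lemma asymptotic_bipartite_subgraph:
  fixes G :: "nat \<Rightarrow> 'a sgraph" and n :: "nat \<Rightarrow> nat" and d :: "nat \<Rightarrow> real"
  assumes l: "2 \<le> l" and k: "odd k" "k > 2 * l"
    and G: "\<And>i. simple_graph (G i)" "\<And>i. family_free (even_cycles l \<union> {cycle_graph k}) (G i)"
    and n: "\<And>i. n i = num_verts (G i)" and d: "\<And>i. d i = average_degree (G i)"
    and n_lim: "filterlim n at_top sequentially"
  obtains H r where "\<And>i. is_subgraph (H i) (G i)" "\<And>i. is_bipartite (H i)"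
    "r \<in> o(\<lambda>i. real (n i) powr (1 + 1 / real l))" "\<And>i. real (num_edges (H i)) \<ge> d i ^ (l + 1) - r i"
proof -
  have "\<exists>H. is_subgraph H (G i) \<and> is_bipartite H \<and>
      (\<forall>H'. is_subgraph H' (G i) \<longrightarrow> is_bipartite H' \<longrightarrow> num_edges H' \<le> num_edges H)" for i
    using largest_bipartite_subgraph[OF G(1)] by metis
  then obtain H where H: "\<And>i. is_subgraph (H i) (G i)" "\<And>i. is_bipartite (H i)"
    "\<And>i H'. is_subgraph H' (G i) \<Longrightarrow> is_bipartite H' \<Longrightarrow> num_edges H' \<le> num_edges (H i)"
    by metis
  define r where "r i = max 0 (d i ^ (l + 1) - num_edges (H i))" for i
  have "r \<in> o(\<lambda>i. real (n i) powr (1 + 1 / real l))"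
  proof (rule landau_o.smallI)
    fix c :: real assume c: "c > 0"
    obtain n0 where n0: "\<And>G :: 'a sgraph. \<lbrakk>simple_graph G; family_free (even_cycles l \<union> {cycle_graph k}) G; num_verts G \<ge> n0\<rbrakk> \<Longrightarrow>
      \<exists>H. is_subgraph H G \<and> is_bipartite H \<and>
        average_degree G ^ (l + 1) - c * real (num_verts G) powr (1 + 1 / l) \<le> num_edges H"
      using bipartite_subgraph[OF l k c] by blast
    have "eventually (\<lambda>i. n i \<ge> n0) sequentially" using n_lim by (simp add: filterlim_at_top)
    then show "eventually (\<lambda>i. norm (r i) \<le> c * norm (real (n i) powr (1 + 1 / real l))) sequentially"
    proof eventually_elim
      case (elim i)
      then obtain H' where H': "is_subgraph H' (G i)" "is_bipartite H'"
        "d i ^ (l + 1) - c * real (n i) powr (1 + 1 / l) \<le> num_edges H'"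
        using n0[OF G] unfolding n d by blast
      have "real (num_edges H') \<le> num_edges (H i)" using H(3)[OF H'(1,2)] by simp
      then show ?case using H'(3) c by (simp add: r_def)
    qed
  qed
  moreover have "real (num_edges (H i)) \<ge> d i ^ (l + 1) - r i" for i by (simp add: r_def)
  ultimately show ?thesis using that H by blast
qed

lemma near_extremal:
  fixes G :: "nat \<Rightarrow> 'a sgraph" and n :: "nat \<Rightarrow> nat" and d :: "nat \<Rightarrow> real"
  assumes l: "2 \<le> l" and k: "odd k" "k > 2 * l"
    and G: "\<And>i. simple_graph (G i)" "\<And>i. family_free (even_cycles l \<union> {cycle_graph k}) (G i)"
    and n: "\<And>i. n i = num_verts (G i)" and d: "\<And>i. d i = average_degree (G i)"
    and n_lim: "filterlim n at_top sequentially"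
    and H: "\<And>i. is_subgraph (H i) (G i)"
    and r: "r \<in> o(\<lambda>i. real (n i) powr (1 + 1 / real l))" "\<And>i. real (num_edges (H i)) \<ge> d i ^ (l + 1) - r i"
    and \<epsilon>: "\<epsilon> \<in> o(\<lambda>_. 1)" "\<And>i. d i \<ge> (1 + \<epsilon> i) * (real (n i) / 2) powr (1 / real l)"
  shows "d \<sim>[sequentially] (\<lambda>i. (real (n i) / 2) powr (1 / real l))"
    and "(\<lambda>i. real (num_edges (H i))) \<sim>[sequentially] (\<lambda>i. real (num_edges (G i)))"
    and "(\<lambda>i. real (num_edges (G i))) \<sim>[sequentially] (\<lambda>i. (real (n i) / 2) powr (1 + 1 / real l))"
proof -
  define M where "M i = (real (n i) / 2) powr (1 / real l)" for i
  have n_pos: "eventually (\<lambda>i. n i \<ge> 1) sequentially" using n_lim by (simp add: filterlim_at_top)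
  have M_pos: "eventually (\<lambda>i. M i > 0) sequentially"
    using n_pos by eventually_elim (simp add: M_def)
  have eG: "real (num_edges (G i)) = real (n i) / 2 * d i" if "n i \<ge> 1" for i
    using that by (simp add: d n average_degree_eq[OF G(1)])
  have \<epsilon>0: "\<epsilon> \<longlonglongrightarrow> 0" using smalloD_tendsto[OF \<epsilon>(1)] by simp
  have dM: "(\<lambda>i. d i / M i) \<longlonglongrightarrow> 1"
  proof (rule order_tendstoI)
    fix c :: real assume c: "c < 1"
    have "eventually (\<lambda>i. \<epsilon> i > c - 1) sequentially" using order_tendstoD(1)[OF \<epsilon>0, of "c - 1"] c by simp
    then show "eventually (\<lambda>i. c < d i / M i) sequentially"
      using M_pos
    proof eventually_elim
      case (elim i)
      have "c * M i < (1 + \<epsilon> i) * M i" using elim by (intro mult_strict_right_mono) auto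
      then have "c * M i < d i" using \<epsilon>(2)[of i] by (simp add: M_def)
      then show ?case using elim by (simp add: pos_less_divide_eq)
    qed
  next
    fix c :: real assume c: "c > 1"
    obtain n0 where n0: "\<And>G :: 'a sgraph. \<lbrakk>simple_graph G; family_free (even_cycles l \<union> {cycle_graph k}) G;
      num_verts G \<ge> n0\<rbrakk> \<Longrightarrow> average_degree G \<le> (1 + (c - 1) / 2) * (real (num_verts G) / 2) powr (1 / l)"
      using average_degree_le[OF l k, of "(c - 1) / 2"] c by auto
    have "eventually (\<lambda>i. n i \<ge> n0) sequentially" using n_lim by (simp add: filterlim_at_top)
    then show "eventually (\<lambda>i. d i / M i < c) sequentially"
      using M_pos
    proof eventually_elim
      case (elim i)
      have "d i \<le> (1 + (c - 1) / 2) * M i" using n0[OF G] elim(1) unfolding n d M_def by blast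
      also have "\<dots> < c * M i" using c elim(2) by (intro mult_strict_right_mono) (simp_all add: field_simps)
      finally show ?case using elim(2) by (simp add: pos_divide_less_eq)
    qed
  qed
  then show "d \<sim>[sequentially] (\<lambda>i. (real (n i) / 2) powr (1 / real l))"
    unfolding M_def by (rule asymp_equivI')
  have Mn: "real (n i) / 2 * M i = (real (n i) / 2) powr (1 + 1 / real l)" if "n i \<ge> 1" for i
    using that by (simp add: M_def powr_add)
  have "(\<lambda>i. real (num_edges (G i)) / (real (n i) / 2) powr (1 + 1 / real l)) \<longlonglongrightarrow> 1"
  proof (rule Lim_transform_eventually[OF dM])
    show "eventually (\<lambda>i. d i / M i = real (num_edges (G i)) / (real (n i) / 2) powr (1 + 1 / real l)) sequentially"
      using n_pos by eventually_elim (simp add: eG Mn[symmetric])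
  qed
  then show "(\<lambda>i. real (num_edges (G i))) \<sim>[sequentially] (\<lambda>i. (real (n i) / 2) powr (1 + 1 / real l))"
    by (rule asymp_equivI')
  have d_pos: "eventually (\<lambda>i. d i > 0) sequentially"
    using order_tendstoD(1)[OF dM zero_less_one] M_pos by eventually_elim (simp add: zero_less_divide_iff)
  define \<rho> where "\<rho> i = r i / real (n i) powr (1 + 1 / real l)" for i
  have \<rho>: "\<rho> \<longlonglongrightarrow> 0" unfolding \<rho>_def using r(1) by (rule smalloD_tendsto)
  have lower_lim: "(\<lambda>i. (d i / M i) ^ l - \<rho> i * (2 * 2 powr (1 / real l)) / (d i / M i)) \<longlonglongrightarrow> 1 ^ l - 0 * (2 * 2 powr (1 / real l)) / 1"
    by (intro tendsto_diff tendsto_power tendsto_divide tendsto_mult tendsto_const dM \<rho>) simp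
  have lower: "eventually (\<lambda>i. (d i / M i) ^ l - \<rho> i * (2 * 2 powr (1 / real l)) / (d i / M i)
      \<le> real (num_edges (H i)) / real (num_edges (G i))) sequentially"
    using n_pos d_pos M_pos
  proof eventually_elim
    case (elim i)
    have ni: "real (n i) > 0" using elim by simp
    have Ml: "M i ^ l = real (n i) / 2" using l elim by (simp add: M_def powr_power)
    have "r i = \<rho> i * (real (n i) * real (n i) powr (1 / real l))"
      using ni by (simp add: \<rho>_def powr_add)
    moreover have "real (n i) powr (1 / real l) = M i * 2 powr (1 / real l)"
      using ni by (simp add: M_def powr_divide)
    ultimately have r_eq: "r i = \<rho> i * (real (n i) * (M i * 2 powr (1 / real l)))" by simp
    have "(d i / M i) ^ l - \<rho> i * (2 * 2 powr (1 / real l)) / (d i / M i)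
        = (d i ^ (l + 1) - r i) / (real (n i) / 2 * d i)"
      unfolding r_eq power_divide Ml using elim ni by (simp add: field_simps)
    also have "\<dots> \<le> real (num_edges (H i)) / (real (n i) / 2 * d i)"
      using r(2)[of i] elim by (intro divide_right_mono) auto
    finally show ?case unfolding eG[OF elim(1)] .
  qed
  have upper: "eventually (\<lambda>i. real (num_edges (H i)) / real (num_edges (G i)) \<le> 1) sequentially"
  proof (intro always_eventually allI)
    fix i
    have "num_edges (H i) \<le> num_edges (G i)"
      using H[of i] simple_graph_finite_edges[OF G(1)] by (auto simp: is_subgraph_def num_edges_def intro: card_mono)
    then show "real (num_edges (H i)) / real (num_edges (G i)) \<le> 1" by (cases "num_edges (G i) = 0") auto
  qed
  have "(\<lambda>i. real (num_edges (H i)) / real (num_edges (G i))) \<longlonglongrightarrow> 1"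
    by (rule tendsto_sandwich[OF lower upper]) (use lower_lim in simp_all)
  then show "(\<lambda>i. real (num_edges (H i))) \<sim>[sequentially] (\<lambda>i. real (num_edges (G i)))"
    by (rule asymp_equivI')
qed

theorem theorem1p1:
  fixes l k :: nat
  assumes "l \<in> {2, 3, 5}" and "k > 2 * l" and "odd k"
  shows
    "(\<forall>(G :: nat \<Rightarrow> 'a sgraph) (n :: nat \<Rightarrow> nat) (d :: nat \<Rightarrow> real).
        (\<forall>i. simple_graph (G i)) \<and>
        (\<forall>i. family_free (even_cycles l \<union> {cycle_graph k}) (G i)) \<and>
        (\<forall>i. n i = num_verts (G i)) \<and>
        (\<forall>i. d i = average_degree (G i)) \<and>
        filterlim n at_top sequentially \<and>
        d \<in> \<Theta>(\<lambda>i. real (n i) powr (1 / real l))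
        \<longrightarrow>
        (\<exists>H :: nat \<Rightarrow> 'a sgraph.
           (\<forall>i. is_subgraph (H i) (G i) \<and> is_bipartite (H i)) \<and>
           (\<exists>r :: nat \<Rightarrow> real.
              r \<in> o(\<lambda>i. real (n i) powr (1 + 1 / real l)) \<and>
              (\<forall>i. real (num_edges (H i)) \<ge> d i ^ (l + 1) - r i)) \<and>
           ((\<exists>\<epsilon> :: nat \<Rightarrow> real.
               \<epsilon> \<in> o(\<lambda>_. 1) \<and>
               (\<forall>i. d i \<ge> (1 + \<epsilon> i) * (real (n i) / 2) powr (1 / real l)))
            \<longrightarrow>
            d \<sim>[sequentially] (\<lambda>i. (real (n i) / 2) powr (1 / real l)) \<and>
            (\<lambda>i. real (num_edges (H i))) \<sim>[sequentially]
              (\<lambda>i. real (num_edges (G i))) \<and>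
            (\<lambda>i. real (num_edges (G i))) \<sim>[sequentially]
              (\<lambda>i. (real (n i) / 2) powr (1 + 1 / real l)))))
     \<and>
     (\<lambda>n. real (ex_number n (even_cycles l \<union> {cycle_graph k}))) \<sim>[sequentially]
       (\<lambda>n. real (z_number n (even_cycles l)))"
proof (intro conjI allI impI, goal_cases)
  case (1 G n d)
  have l: "2 \<le> l" using assms(1) by auto
  have G: "\<And>i. simple_graph (G i)" "\<And>i. family_free (even_cycles l \<union> {cycle_graph k}) (G i)"
    "\<And>i. n i = num_verts (G i)" "\<And>i. d i = average_degree (G i)" "filterlim n at_top sequentially"
    using 1 by auto
  obtain H r where H: "\<And>i. is_subgraph (H i) (G i)" "\<And>i. is_bipartite (H i)"
    "r \<in> o(\<lambda>i. real (n i) powr (1 + 1 / real l))" "\<And>i. real (num_edges (H i)) \<ge> d i ^ (l + 1) - r i"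
    using asymptotic_bipartite_subgraph[OF l assms(3,2) G] by blast
  note near = near_extremal[OF l assms(3,2) G H(1,3,4)]
  show ?case
    by (intro exI[of _ H] conjI allI impI H, intro exI[of _ r] conjI allI H)
      (elim exE conjE, intro conjI near; blast)+
next
  case 2
  show ?case by (rule ex_number_asymp_equiv_z_number[OF assms(1,3,2)])
qed

end
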